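(* The set $\{P_n^{-m} : m\in\mathbb{N}_0,\ n\in\mathbb{Z},\ |n|\le m\}$ is a Schauder basis of $\mathcal{H}(\Omega)$. In particular, each $F\in\mathcal{H}(\Omega)$ has a unique representation as $$F(z,w)=\sum_{m=0}^{\infty}\sum_{n=-m}^{m} c_{n,m}\,P_n^{-m}(z,w),\qquad c_{n,m}\in\mathbb{C}.$$ This series converges absolutely and locally uniformly in $\Omega$, and the Schauder coefficients $c_{\pm n,m}$ (where $0\le n\le m$) of $F$ are given by $$c_{\pm n,m}=(2m+1)\binom{m+n}{n}\binom{m}{n}^{-1}\langle F,P_{\pm n}^{-m}\rangle_\Omega .$$
   Context: $\mathbb{N}_0=\{0,1,2,\dots\}$, $\widehat{\mathbb{C}}=\mathbb{C}\cup\{\infty\}$ is the Riemann sphere, with the conventions $\infty\cdot 0=0\cdot\infty=1$ and $\infty\cdot z=z\cdot\infty=\infty$ for $z\in\widehat{\mathbb{C}}\setminus\{0\}$. $\Omega=\{(z,w)\in\widehat{\mathbb{C}}^2 : z\cdot w\ne 1\}$, an open subset of the complex manifold $\widehat{\mathbb{C}}^2$. $\mathcal{H}(\Omega)$ is the Fréchet space of holomorphic functions $\Omega\to\mathbb{C}$ with the topology of locally uniform convergence. Poisson Fourier modes: for $m\in\mathbb{N}_0$, $n\in\mathbb{Z}$, $P_n^{-m}:\Omega\to\mathbb{C}$ is $$P_n^{-m}(z,w)=(-1)^n\binom{m}{|n|}(1-zw)^{-m}\,{}_2F_1(-m,|n|-m;|n|+1;zw)\cdot\begin{cases}w^n & n\ge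 0\\ z^{|n|} & n\le 0\end{cases}$$ with $\binom{m}{|n|}=0$ if $|n|>m$ and ${}_2F_1(a,b;c;t)=\sum_{k\ge0}\frac{(a)_k(b)_k}{(c)_k}\frac{t^k}{k!}$ (a finite sum here), $(a)_k=a(a+1)\cdots(a+k-1)$. Equivalently, for $n\ge0$, $P_n^{-m}(z,w)=(-1)^n\sum_{k=0}^{m-n}\binom{m}{k+n}\binom{m}{k}\frac{z^kw^{k+n}}{(1-zw)^m}=P_{-n}^{-m}(w,z)$. The formulas are for finite $z,w$; at points of $\Omega$ with a coordinate equal to $\infty$ they are understood via the (unique) holomorphic extension. For $F,G\in\mathcal{H}(\Omega)$: $\langle F,G\rangle_\Omega=\frac1\pi\int_{\mathbb{C}}F(z,-\overline z)\,\overline{G(z,-\overline z)}\,\frac{dA(z)}{(1+|z|^2)^2}$, where $dA$ is Lebesgue measure on $\mathbb{C}\cong\mathbb{R}^2$. *)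

theory Defs
  imports "HOL-Analysis.Analysis"
begin

text \<open>
  The Riemann sphere is the one-point compactification of the complex plane, with \<open>None\<close> as the
  point at infinity.
\<close>

type_synonym riemann_sphere = "complex option"

abbreviation sphere_topology :: "riemann_sphere topology" where
  "sphere_topology \<equiv> Alexandroff_compactification (euclidean :: complex topology)"

abbreviation sphere2_topology :: "(riemann_sphere \<times> riemann_sphere) topology" where
  "sphere2_topology \<equiv> prod_topology sphere_topology sphere_topology"

text \<open>Note the convention that zero times infinity is one.\<close>

fun sphere_mult :: "riemann_sphere \<Rightarrow> riemann_sphere \<Rightarrow> riemann_sphere" where
  "sphere_mult (Some z) (Some w) = Some (z * w)"
| "sphere_mult (Some z) None = (if z = 0 then Some 1 else None)"
| "sphere_mult None (Some w) = (if w = 0 then Some 1 else None)"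
| "sphere_mult None None = None"

definition Omega :: "(riemann_sphere \<times> riemann_sphere) set" where
  "Omega = {(z, w). sphere_mult z w \<noteq> Some 1}"

text \<open>
  Holomorphy in two complex variables (meant for open \<open>S\<close>): the real derivative exists and is
  complex linear.
\<close>

definition holomorphic2_on :: "(complex \<times> complex \<Rightarrow> complex) \<Rightarrow> (complex \<times> complex) set \<Rightarrow> bool" where
  "holomorphic2_on f S \<longleftrightarrow>
     (\<forall>p\<in>S. \<exists>a b. (f has_derivative (\<lambda>(h, k). a * h + b * k)) (at p))"

text \<open>
  The inverses of the two standard charts of the sphere: the inclusion of the plane, and
  \<open>u \<mapsto> 1 / u\<close> extended by \<open>0 \<mapsto> \<infinity>\<close>.
\<close>

definition chart_at_infinity :: "complex \<Rightarrow> riemann_sphere" where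
  "chart_at_infinity u = (if u = 0 then None else Some (1 / u))"

definition sphere_charts :: "(complex \<Rightarrow> riemann_sphere) set" where
  "sphere_charts = {Some, chart_at_infinity}"

definition holomorphic_on_Omega :: "(riemann_sphere \<times> riemann_sphere \<Rightarrow> complex) \<Rightarrow> bool" where
  "holomorphic_on_Omega F \<longleftrightarrow>
     (\<forall>\<phi>\<in>sphere_charts. \<forall>\<psi>\<in>sphere_charts.
        holomorphic2_on (\<lambda>(u, v). F (\<phi> u, \<psi> v)) {(u, v). (\<phi> u, \<psi> v) \<in> Omega})"

text \<open>
  A holomorphic function on \<open>Omega\<close> is represented by its extension by zero to the whole product
  of spheres, so that equality of functions in \<open>H_Omega\<close> is equality on \<open>Omega\<close> and the
  pointwise vector space operations restrict to \<open>H_Omega\<close>.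
\<close>

definition H_Omega :: "(riemann_sphere \<times> riemann_sphere \<Rightarrow> complex) set" where
  "H_Omega = {F. holomorphic_on_Omega F \<and> (\<forall>p. p \<notin> Omega \<longrightarrow> F p = 0)}"

abbreviation compact_in_Omega :: "(riemann_sphere \<times> riemann_sphere) set \<Rightarrow> bool" where
  "compact_in_Omega K \<equiv> compactin (subtopology sphere2_topology Omega) K"

text \<open>
  The topology of locally uniform convergence is generated by the balls of the seminorms
  \<open>sup\<^sub>K |F|\<close>, for \<open>K\<close> a compact subset of \<open>Omega\<close>.
\<close>

definition H_topology :: "(riemann_sphere \<times> riemann_sphere \<Rightarrow> complex) topology" where
  "H_topology = topology_generated_by
     {{G \<in> H_Omega. \<forall>p\<in>K. cmod (G p - F p) < e} | F K e.
        F \<in> H_Omega \<and> compact_in_Omega K \<and> e > 0}"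

lemma topspace_H_topology [simp]: "topspace H_topology = H_Omega"
proof -
  have "F \<in> \<Union> {{G \<in> H_Omega. \<forall>p\<in>K. cmod (G p - F p) < e} | F K e.
        F \<in> H_Omega \<and> compact_in_Omega K \<and> e > 0}" if "F \<in> H_Omega" for F
  proof
    show "F \<in> {G \<in> H_Omega. \<forall>p\<in>{}. cmod (G p - F p) < 1}"
      using that by simp
    show "{G \<in> H_Omega. \<forall>p\<in>{}. cmod (G p - F p) < 1} \<in>
      {{G \<in> H_Omega. \<forall>p\<in>K. cmod (G p - F p) < e} | F K e.
        F \<in> H_Omega \<and> compact_in_Omega K \<and> e > 0}"
      using that by (intro CollectI exI[of _ F] exI[of _ "{}"] exI[of _ "1::real"]) auto
  qed
  then show ?thesis
    unfolding H_topology_def topology_generated_by_topspace by blast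
qed

text \<open>
  Schauder bases in a topological vector space of complex-valued functions whose topology is \<open>T\<close>.
  Continuity of the coefficient functionals is part of the definition (for Frechet spaces it is
  automatic). A set is a basis if it is one with respect to every enumeration of its elements.
\<close>

definition schauder_expansion ::
    "('a \<Rightarrow> complex) topology \<Rightarrow> (nat \<Rightarrow> 'a \<Rightarrow> complex) \<Rightarrow> ('a \<Rightarrow> complex) \<Rightarrow> (nat \<Rightarrow> complex) \<Rightarrow> bool" where
  "schauder_expansion T b F c \<longleftrightarrow> limitin T (\<lambda>N x. \<Sum>k<N. c k * b k x) F sequentially"

definition schauder_sequence :: "('a \<Rightarrow> complex) topology \<Rightarrow> (nat \<Rightarrow> 'a \<Rightarrow> complex) \<Rightarrow> bool" where
  "schauder_sequence T b \<longleftrightarrow>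
     range b \<subseteq> topspace T \<and>
     (\<forall>F\<in>topspace T. \<exists>!c. schauder_expansion T b F c) \<and>
     (\<forall>k. continuous_map T euclidean (\<lambda>F. (THE c. schauder_expansion T b F c) k))"

definition schauder_basis :: "('a \<Rightarrow> complex) topology \<Rightarrow> ('a \<Rightarrow> complex) set \<Rightarrow> bool" where
  "schauder_basis T B \<longleftrightarrow>
     countable B \<and> infinite B \<and>
     (\<forall>b. bij_betw b (UNIV :: nat set) B \<longrightarrow> schauder_sequence T b)"

definition hypergeometric_2F1 :: "complex \<Rightarrow> complex \<Rightarrow> complex \<Rightarrow> complex \<Rightarrow> complex" where
  "hypergeometric_2F1 a b c t =
     (\<Sum>k. pochhammer a k * pochhammer b k / pochhammer c k * (t ^ k / fact k))"

text \<open>\<open>poisson_formula n m z w\<close> and \<open>poisson_mode n m (z, w)\<close> stand for $P_n^{-m}(z,w)$.\<close>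

definition poisson_formula :: "int \<Rightarrow> nat \<Rightarrow> complex \<Rightarrow> complex \<Rightarrow> complex" where
  "poisson_formula n m z w =
     (-1) ^ nat \<bar>n\<bar> * of_nat (m choose nat \<bar>n\<bar>) / (1 - z * w) ^ m *
     hypergeometric_2F1 (- of_nat m) (of_int \<bar>n\<bar> - of_nat m) (of_int \<bar>n\<bar> + 1) (z * w) *
     (if n \<ge> 0 then w ^ nat \<bar>n\<bar> else z ^ nat \<bar>n\<bar>)"

text \<open>The unique holomorphic extension of the formula to \<open>Omega\<close>.\<close>

definition poisson_mode :: "int \<Rightarrow> nat \<Rightarrow> riemann_sphere \<times> riemann_sphere \<Rightarrow> complex" where
  "poisson_mode n m =
     (THE G. G \<in> H_Omega \<and>
        (\<forall>z w. (Some z, Some w) \<in> Omega \<longrightarrow> G (Some z, Some w) = poisson_formula n m z w))"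

definition inner_Omega ::
    "(riemann_sphere \<times> riemann_sphere \<Rightarrow> complex) \<Rightarrow> (riemann_sphere \<times> riemann_sphere \<Rightarrow> complex) \<Rightarrow> complex" where
  "inner_Omega F G =
     1 / of_real pi *
     (LINT z|lborel. F (Some z, Some (- cnj z)) * cnj (G (Some z, Some (- cnj z)))
        / of_real ((1 + (cmod z)\<^sup>2)\<^sup>2))"

text \<open>
  The double series: outer summation over \<open>m\<close>, inner summation over \<open>-m \<le> n \<le> m\<close>. Its value is
  taken in \<open>H_topology\<close>.
\<close>

definition poisson_partial_sum ::
    "(int \<Rightarrow> nat \<Rightarrow> complex) \<Rightarrow> nat \<Rightarrow> riemann_sphere \<times> riemann_sphere \<Rightarrow> complex" where
  "poisson_partial_sum c M p = (\<Sum>m\<le>M. \<Sum>n = - int m..int m. c n m * poisson_mode n m p)"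

definition poisson_expansion ::
    "(riemann_sphere \<times> riemann_sphere \<Rightarrow> complex) \<Rightarrow> (int \<Rightarrow> nat \<Rightarrow> complex) \<Rightarrow> bool" where
  "poisson_expansion F c \<longleftrightarrow> limitin H_topology (poisson_partial_sum c) F sequentially"

end

theory Submission
  imports Defs "HOL-Complex_Analysis.Complex_Analysis" "HOL-Real_Asymp.Real_Asymp"
begin

text \<open>
  The idea of the proof. The functions \<open>A = 1 / (1 - z w)\<close>, \<open>B = w / (1 - z w)\<close> and \<open>C = z / (1 - z w)\<close> identify \<open>\<Omega>\<close>
  with the affine quadric \<open>B C = A (A - 1)\<close>. The punctured plane acts on it by
  \<open>(A, B, C) \<mapsto> (A, \<lambda> B, C / \<lambda>)\<close>, and \<open>A\<close> is invariant. In these coordinates the Poisson mode with indices \<open>n\<close> and \<open>m\<close> is,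
  up to sign, \<open>B\<^sup>n\<close> (for negative \<open>n\<close>, the corresponding power of \<open>C\<close>) times a Jacobi polynomial of degree
  \<open>m - \<bar>n\<bar>\<close> in \<open>A\<close> (\<open>poisson_mode_eq\<close>).

  On the antidiagonal \<open>w = - cnj z\<close>, a sphere if \<open>(\<infinity>, \<infinity>)\<close> is included, \<open>A\<close> is the height, the area measure projects to the uniform
  measure on the heights in \<open>[0, 1]\<close>, and \<open>\<bar>B\<^sup>n\<bar>\<^sup>2\<close> becomes the weight for which the Jacobi polynomials are orthogonal.
  Modes with different \<open>n\<close> are orthogonal by rotation invariance. Hence the modes are an orthogonal
  system with explicit norms (\<open>inner_jacobi_modes\<close>). As this sphere is compact, the inner product is
  continuous on \<open>H(\<Omega>)\<close>; this yields uniqueness of expansions, the formula for the coefficients and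
  the continuity of the coefficient functionals.

  For existence, \<open>F\<close> is expanded into a Laurent series along the orbits of the action, whose coefficients are
  entire functions of \<open>A\<close> (\<open>H_Omega_laurent_expansion\<close>). Their Taylor series lead to a double series in the monomials
  \<open>B\<^sup>n A\<^sup>k\<close> and \<open>C\<^sup>n A\<^sup>k\<close>. Because \<open>F\<close> is holomorphic on the whole quadric, its coefficients decay faster than
  \<open>R\<close> to the power \<open>- n - k\<close> for every \<open>R\<close> (\<open>taylor_coeff_bound\<close>). On the other hand, the coefficients of \<open>A\<^sup>k\<close> in terms of Jacobi
  polynomials, and the modes on a compact set, grow only exponentially. So replacing \<open>A\<^sup>k\<close> by its Jacobi
  expansion produces a triple series that converges absolutely and uniformly on compact sets; summing it
  in the other order gives the expansion in Poisson modes (\<open>mode_expansion\<close>, \<open>uniform_mode_expansion\<close>).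
\<close>

section \<open>Jacobi polynomials on the unit interval\<close>

text \<open>
  This is the Jacobi polynomial \<open>P\<^sub>j\<close> with both parameters equal to \<open>l\<close>, in the variable \<open>2 x - 1\<close>. The
  form with powers of \<open>x - 1\<close> and \<open>x\<close> is the one in which it occurs in the Poisson modes with
  \<open>\<bar>n\<bar> = l\<close> and \<open>m = l + j\<close>.
\<close>

definition jacobi :: "nat \<Rightarrow> nat \<Rightarrow> 'a::comm_ring_1 poly" where
  "jacobi l j = (\<Sum>i\<le>j. of_nat (((l + j) choose i) * ((l + j) choose (l + i))) *
     ([:-1, 1:] ^ i * [:0, 1:] ^ (j - i)))"

lemma poly_jacobi:
  "poly (jacobi l j) x =
     (\<Sum>i\<le>j. of_nat (((l + j) choose i) * ((l + j) choose (l + i))) * ((x - 1) ^ i * x ^ (j - i)))"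
  by (simp add: jacobi_def poly_sum algebra_simps)

lemma poly_jacobi_of_real:
  "poly (jacobi l j) (of_real x :: 'a::{real_normed_field}) = of_real (poly (jacobi l j) x)"
  by (simp add: poly_jacobi)

lemma vandermonde_shifted:
  "(\<Sum>i\<le>j. ((l + j) choose i) * ((l + j) choose (l + i))) = (2 * (l + j)) choose j"
proof -
  have "(\<Sum>i\<le>j. ((l + j) choose i) * ((l + j) choose (l + i))) =
        (\<Sum>i\<le>j. ((l + j) choose i) * ((l + j) choose (j - i)))"
    by (intro sum.cong refl) (subst (2) binomial_symmetric, auto)
  also have "\<dots> = ((l + j) + (l + j)) choose j"
    by (rule vandermonde)
  finally show ?thesis unfolding mult_2 .
qed

text \<open>
  The coefficients in the defining sum add up to a binomial coefficient by Vandermonde, hence to at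
  most \<open>4\<close> to the power \<open>l + j\<close>. Exponential growth in the degree is all that convergence needs, since the
  coefficients of a function in \<open>H(\<Omega>)\<close> decay faster than any exponential.
\<close>

lemma norm_poly_jacobi_le:
  fixes x :: "'a::{real_normed_field}"
  assumes "norm x \<le> M" "norm (x - 1) \<le> M"
  shows "norm (poly (jacobi l j) x) \<le> 4 ^ (l + j) * M ^ j"
proof -
  have M: "M \<ge> 0" using assms(1) norm_ge_zero order_trans by blast
  have "norm (poly (jacobi l j) x) \<le>
     (\<Sum>i\<le>j. real (((l + j) choose i) * ((l + j) choose (l + i))) * M ^ j)"
    unfolding poly_jacobi
  proof (rule sum_norm_le)
    fix i assume i: "i \<in> {..j}"
    have "norm ((x - 1) ^ i * x ^ (j - i)) \<le> M ^ i * M ^ (j - i)"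
      unfolding norm_mult norm_power using assms M by (intro mult_mono power_mono) auto
    also have "\<dots> = M ^ j" using i by (simp flip: power_add)
    finally show "norm (of_nat (((l + j) choose i) * ((l + j) choose (l + i))) *
        ((x - 1) ^ i * x ^ (j - i))) \<le> real (((l + j) choose i) * ((l + j) choose (l + i))) * M ^ j"
      by (subst norm_mult, subst norm_of_nat) (intro mult_left_mono, auto)
  qed
  also have "\<dots> = real ((2 * (l + j)) choose j) * M ^ j"
    by (simp only: sum_distrib_right[symmetric] of_nat_sum[symmetric] vandermonde_shifted)
  also have "\<dots> \<le> 4 ^ (l + j) * M ^ j"
  proof (rule mult_right_mono)
    have "(2 * (l + j)) choose j \<le> 2 ^ (2 * (l + j))" by (rule binomial_le_pow2)
    also have "\<dots> = 4 ^ (l + j)" unfolding power_mult by simp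
    finally have "(2 * (l + j)) choose j \<le> 4 ^ (l + j)" .
    then show "real ((2 * (l + j)) choose j) \<le> 4 ^ (l + j)"
      by (metis of_nat_le_iff of_nat_numeral of_nat_power)
  qed (use M in auto)
  finally show ?thesis .
qed

lemma pderiv_power_linear:
  "pderiv ([:a, 1:] ^ Suc m) = smult (of_nat (Suc m)) ([:a, 1:] ^ m :: 'a::{comm_semiring_1,semiring_no_zero_divisors} poly)"
  by (simp add: pderiv_power_Suc pderiv_pCons del: power_Suc)

lemma higher_pderiv_power_linear:
  fixes a :: "'a::field_char_0"
  assumes "i \<le> m"
  shows "(pderiv ^^ i) ([:a, 1:] ^ m) = smult (fact m / fact (m - i)) ([:a, 1:] ^ (m - i))"
  using assms
proof (induction i)
  case (Suc i)
  obtain d where d: "m - i = Suc d" "m - Suc i = d"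
    using Suc.prems by (metis Suc_diff_Suc Suc_le_lessD)
  show ?case using Suc d
    by (simp add: pderiv_smult pderiv_power_linear del: power_Suc of_nat_Suc)
qed simp

lemma higher_pderiv_mult:
  fixes p q :: "'a::idom poly"
  shows "(pderiv ^^ j) (p * q) =
     (\<Sum>i\<le>j. of_nat (j choose i) * ((pderiv ^^ i) p * (pderiv ^^ (j - i)) q))"
proof (induction j)
  case (Suc j)
  let ?f = "\<lambda>i k. (pderiv ^^ i) p * (pderiv ^^ k) q"
  have D: "pderiv (of_nat n * r) = of_nat n * pderiv r" for n and r :: "'a poly"
    by (simp add: pderiv_mult)
  have "(pderiv ^^ Suc j) (p * q) =
      (\<Sum>i\<le>j. of_nat (j choose i) * (?f (Suc i) (j - i) + ?f i (Suc (j - i))))"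
    using Suc.IH
    by (simp only: funpow.simps comp_def higher_pderiv_sum[of 1, simplified] D pderiv_mult)
      (simp add: algebra_simps)
  also have "\<dots> = (\<Sum>i\<le>j. of_nat (j choose i) * ?f (Suc i) (j - i)) +
      (\<Sum>i\<le>j. of_nat (j choose i) * ?f i (Suc j - i))"
    by (simp add: algebra_simps sum.distrib Suc_diff_le)
  also have "(\<Sum>i\<le>j. of_nat (j choose i) * ?f i (Suc j - i)) =
      (\<Sum>i\<le>Suc j. of_nat (j choose i) * ?f i (Suc j - i))"
    by (simp add: binomial_eq_0)
  also have "\<dots> = ?f 0 (Suc j) + (\<Sum>i\<le>j. of_nat (j choose Suc i) * ?f (Suc i) (j - i))"
    by (subst sum.atMost_Suc_shift) simp
  also have "(\<Sum>i\<le>j. of_nat (j choose i) * ?f (Suc i) (j - i)) + \<dots> =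
     ?f 0 (Suc j) + (\<Sum>i\<le>j. of_nat (Suc j choose Suc i) * ?f (Suc i) (j - i))"
    by (simp add: algebra_simps sum.distrib)
  also have "\<dots> = (\<Sum>i\<le>Suc j. of_nat (Suc j choose i) * ?f i (Suc j - i))"
    by (simp only: sum.atMost_Suc_shift) simp
  finally show ?case .
qed simp

lemma smult_sum_right: "smult c (sum f S) = (\<Sum>i\<in>S. smult c (f i))"
  by (induction S rule: infinite_finite_induct) (auto simp: smult_add_right)

text \<open>
  Leibniz' rule applied to the two powers produces exactly the binomial sum that defines
  \<open>jacobi\<close>. Orthogonality and norms follow from this formula by partial integration.
\<close>

lemma rodrigues:
  "(pderiv ^^ j) ([:0, 1:] ^ (l + j) * [:-1, 1:] ^ (l + j)) =
     smult (fact j) (([:0, 1:] * [:-1, 1:]) ^ l * jacobi l j :: 'a::field_char_0 poly)"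
proof -
  let ?X = "[:0, 1:] :: 'a poly" and ?Y = "[:-1, 1:] :: 'a poly"
  have "of_nat (j choose i) * ((pderiv ^^ i) (?X ^ (l + j)) * (pderiv ^^ (j - i)) (?Y ^ (l + j))) =
     smult (fact j) ((?X * ?Y) ^ l * (of_nat (((l + j) choose i) * ((l + j) choose (l + i))) *
       (?Y ^ i * ?X ^ (j - i))))" if "i \<le> j" for i
  proof -
    have c: "of_nat (j choose i) * (fact (l + j) / fact (l + j - i)) *
        (fact (l + j) / fact (l + i)) =
        (fact j * of_nat (((l + j) choose i) * ((l + j) choose (l + i))) :: 'a)"
      using that by (simp add: binomial_fact field_simps)
    have "of_nat (j choose i) * ((pderiv ^^ i) (?X ^ (l + j)) * (pderiv ^^ (j - i)) (?Y ^ (l + j))) =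
       smult (of_nat (j choose i) * (fact (l + j) / fact (l + j - i)) *
        (fact (l + j) / fact (l + i))) (?X ^ (l + j - i) * ?Y ^ (l + i))"
      using that by (simp add: higher_pderiv_power_linear of_nat_poly mult_ac)
    also have "?X ^ (l + j - i) * ?Y ^ (l + i) = (?X * ?Y) ^ l * (?Y ^ i * ?X ^ (j - i))"
    proof -
      have "l + j - i = l + (j - i)" using that by simp
      then show ?thesis by (simp only: power_add power_mult_distrib mult_ac)
    qed
    finally show ?thesis unfolding c by (simp add: of_nat_poly)
  qed
  then show ?thesis
    unfolding higher_pderiv_mult jacobi_def sum_distrib_left
    by (simp only: smult_sum_right sum_distrib_left) (intro sum.cong, auto)
qed

text \<open>
  Integration over \<open>[0, 1]\<close> is regarded as a linear functional on polynomials, so that partial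
  integration and the Beta integrals are identities between polynomials and their derivatives.
\<close>

definition poly_integral :: "real poly \<Rightarrow> real" where
  "poly_integral p = integral {0..1} (poly p)"

lemma poly_integrable [simp, intro]: "poly p integrable_on {a..b::real}"
  by (intro integrable_continuous_interval continuous_intros)

lemma poly_integral_add: "poly_integral (p + q) = poly_integral p + poly_integral q"
proof -
  have "poly (p + q) = (\<lambda>x. poly p x + poly q x)" by (simp add: fun_eq_iff)
  then show ?thesis unfolding poly_integral_def by (simp add: integral_add)
qed

lemma poly_integral_smult: "poly_integral (smult c p) = c * poly_integral p"
proof -
  have "poly (smult c p) = (\<lambda>x. c * poly p x)" by (simp add: fun_eq_iff)
  then show ?thesis unfolding poly_integral_def by simp
qed

lemma poly_integral_0 [simp]: "poly_integral 0 = 0"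
  using poly_integral_smult[of 0 0] by simp

lemma poly_integral_sum: "poly_integral (sum f S) = (\<Sum>i\<in>S. poly_integral (f i))"
  by (induction S rule: infinite_finite_induct) (auto simp: poly_integral_add)

lemma poly_integral_pderiv: "poly_integral (pderiv p) = poly p 1 - poly p 0"
  unfolding poly_integral_def
  by (intro integral_unique fundamental_theorem_of_calculus)
     (auto intro!: poly_DERIV[THEN DERIV_subset] simp flip: has_real_derivative_iff_has_vector_derivative)

lemma poly_integral_monom: "poly_integral (monom c k) = c / (real k + 1)"
proof -
  have "monom c k = pderiv (monom (c / (real k + 1)) (Suc k))"
    by (simp add: pderiv_monom add_divide_eq_iff field_simps)
  then have "poly_integral (monom c k) = poly_integral (pderiv (monom (c / (real k + 1)) (Suc k)))"
    by (rule arg_cong)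
  also have "\<dots> = c / (real k + 1)"
    by (subst poly_integral_pderiv) (simp add: poly_monom)
  finally show ?thesis .
qed

lemma abs_poly_integral_le:
  assumes "\<And>x. x \<in> {0..1} \<Longrightarrow> \<bar>poly p x\<bar> \<le> M"
  shows "\<bar>poly_integral p\<bar> \<le> M"
proof -
  have "continuous_on {0..1} (\<lambda>x. poly p x)" by (intro continuous_intros)
  then show ?thesis using integral_bound[of 0 1 "poly p" M] assms by (auto simp: poly_integral_def)
qed

lemma poly_integral_by_parts:
  assumes "\<And>i. i < j \<Longrightarrow> poly ((pderiv ^^ i) r) 0 = 0" "\<And>i. i < j \<Longrightarrow> poly ((pderiv ^^ i) r) 1 = 0"
  shows "poly_integral (q * (pderiv ^^ j) r) = (-1) ^ j * poly_integral ((pderiv ^^ j) q * r)"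
  using assms
proof (induction j arbitrary: q)
  case (Suc j)
  let ?d = "(pderiv ^^ j) r"
  have "poly_integral (q * pderiv ?d) + poly_integral (pderiv q * ?d) =
        poly_integral (pderiv (q * ?d))"
    by (simp add: pderiv_mult poly_integral_add[symmetric] algebra_simps)
  also have "\<dots> = 0" using Suc.prems by (simp add: poly_integral_pderiv)
  finally have "poly_integral (q * pderiv ?d) = - poly_integral (pderiv q * ?d)" by simp
  also have "\<dots> = - ((-1) ^ j * poly_integral ((pderiv ^^ j) (pderiv q) * r))"
    using Suc by simp
  finally show ?case by (simp add: funpow_swap1)
qed simp

text \<open>
  One partial integration moves a power from \<open>x - 1\<close> to \<open>x\<close>, which gives a recursion in \<open>b\<close>.
\<close>

lemma beta_poly_integral:
  "poly_integral ([:0, 1:] ^ a * [:-1, 1:] ^ b) = (-1) ^ b * fact a * fact b / fact (a + b + 1)"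
proof (induction b arbitrary: a)
  case 0
  then show ?case using poly_integral_monom[of 1 a] by (simp add: monom_altdef)
next
  case (Suc b)
  let ?X = "[:0, 1:] :: real poly" and ?Y = "[:-1, 1:] :: real poly"
  have "pderiv (?X ^ Suc a * ?Y ^ Suc b) =
      smult (Suc a) (?X ^ a * ?Y ^ Suc b) + smult (Suc b) (?X ^ Suc a * ?Y ^ b)"
    by (subst pderiv_mult, subst (1 2) pderiv_power_linear) (simp add: mult_ac del: power_Suc)
  moreover have "poly_integral (pderiv (?X ^ Suc a * ?Y ^ Suc b)) = 0"
    by (simp add: poly_integral_pderiv)
  ultimately have "real (Suc a) * poly_integral (?X ^ a * ?Y ^ Suc b) =
      - (real (Suc b) * poly_integral (?X ^ Suc a * ?Y ^ b))"
    by (simp add: poly_integral_add poly_integral_smult del: power_Suc of_nat_Suc)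
  then have "poly_integral (?X ^ a * ?Y ^ Suc b) =
      - (real (Suc b) * poly_integral (?X ^ Suc a * ?Y ^ b)) / real (Suc a)"
    by (simp add: field_simps del: power_Suc of_nat_Suc)
  also have "\<dots> = - (real (Suc b) * ((-1) ^ b * (real (Suc a) * fact a) * fact b / fact (a + Suc b + 1))) / real (Suc a)"
    by (simp only: Suc.IH fact_Suc[of a] add_Suc add_Suc_right)
  also have "\<dots> = (-1) ^ Suc b * fact a * (real (Suc b) * fact b) / fact (a + Suc b + 1)"
  proof -
    have "- (B * (s * (A * f) * g / h)) / A = (-1 * s) * f * (B * g) / h" if "A \<noteq> 0" for A B s f g h :: real
      using that by simp
    from this[of "real (Suc a)"] show ?thesis unfolding power_Suc by (simp only: of_nat_eq_0_iff)
  qed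
  finally show ?case by (simp only: fact_Suc)
qed

lemma jacobi_degree_coeff:
  shows degree_jacobi: "degree (jacobi l j :: 'a::field_char_0 poly) = j"
    and coeff_jacobi: "coeff (jacobi l j :: 'a::field_char_0 poly) j = of_nat ((2 * (l + j)) choose j)"
proof -
  have deg: "degree ([:-1, 1:] ^ i * [:0, 1:] ^ (j - i) :: 'a poly) = j"
    and co: "coeff ([:-1, 1:] ^ i * [:0, 1:] ^ (j - i) :: 'a poly) j = 1" if "i \<le> j" for i
  proof -
    show "degree ([:-1, 1:] ^ i * [:0, 1:] ^ (j - i) :: 'a poly) = j"
      using that by (simp add: degree_mult_eq degree_linear_power)
    then have "coeff ([:-1, 1:] ^ i * [:0, 1:] ^ (j - i) :: 'a poly) j =
       lead_coeff ([:-1, 1:] ^ i * [:0, 1:] ^ (j - i) :: 'a poly)" by simp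
    also have "\<dots> = 1" by (simp only: lead_coeff_mult lead_coeff_power) simp
    finally show "coeff ([:-1, 1:] ^ i * [:0, 1:] ^ (j - i) :: 'a poly) j = 1" .
  qed
  have "coeff (jacobi l j :: 'a poly) j =
      (\<Sum>i\<le>j. of_nat (((l + j) choose i) * ((l + j) choose (l + i))))"
    unfolding jacobi_def coeff_sum
    by (intro sum.cong refl) (simp add: of_nat_poly co)
  also have "\<dots> = of_nat ((2 * (l + j)) choose j)"
    by (simp only: of_nat_sum[symmetric] vandermonde_shifted)
  finally show c: "coeff (jacobi l j :: 'a poly) j = of_nat ((2 * (l + j)) choose j)" .
  show "degree (jacobi l j :: 'a poly) = j"
  proof (rule antisym)
    show "degree (jacobi l j :: 'a poly) \<le> j"
      unfolding jacobi_def
      by (intro degree_sum_le) (auto simp: of_nat_poly deg intro!: degree_smult_le[THEN order_trans])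
    show "j \<le> degree (jacobi l j :: 'a poly)"
      by (rule le_degree) (use c in auto)
  qed
qed

text \<open>
  The weight \<open>(x (1 - x))\<^sup>l\<close> is the squared modulus of the non-polynomial factor of a Poisson mode, seen
  as a function of the height \<open>x\<close> on the sphere.
\<close>

definition jacobi_inner :: "nat \<Rightarrow> real poly \<Rightarrow> real poly \<Rightarrow> real" where
  "jacobi_inner l p q = poly_integral (([:0, 1:] * [:1, -1:]) ^ l * (p * q))"

lemma jacobi_inner_commute: "jacobi_inner l p q = jacobi_inner l q p"
  by (simp add: jacobi_inner_def mult_ac)

text \<open>
  The boundary terms of the partial integrations vanish because, by Rodrigues' formula again, the lower
  derivatives of \<open>(x (x - 1))\<close> to the power \<open>l + j\<close> still contain a positive power of \<open>x (x - 1)\<close>.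
\<close>

lemma jacobi_inner_rodrigues:
  "jacobi_inner l q (jacobi l j) =
     (-1) ^ (l + j) / fact j * poly_integral ((pderiv ^^ j) q * ([:0, 1:] ^ (l + j) * [:-1, 1:] ^ (l + j)))"
proof -
  let ?X = "[:0, 1:] :: real poly" and ?Y = "[:-1, 1:] :: real poly"
  let ?r = "?X ^ (l + j) * ?Y ^ (l + j)"
  have Y: "[:1, -1:] = smult (-1) ?Y" by simp
  have zero: "poly ((pderiv ^^ i) ?r) x = 0" if "i < j" "x = 0 \<or> x = 1" for i x
  proof -
    have "l + j = (l + j - i) + i" using that by simp
    then have "(pderiv ^^ i) ?r = smult (fact i) ((?X * ?Y) ^ (l + j - i) * jacobi (l + j - i) i)"
      using rodrigues[of i "l + j - i"] by metis
    then show ?thesis using that by auto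
  qed
  have "(?X * [:1, -1:]) ^ l * (q * jacobi l j) =
      smult ((-1) ^ l / fact j) (q * smult (fact j) ((?X * ?Y) ^ l * jacobi l j))"
    unfolding Y power_mult_distrib smult_power mult_smult_left mult_smult_right smult_smult
    by (simp add: mult_ac del: mult_pCons_left mult_pCons_right)
  also have "\<dots> = smult ((-1) ^ l / fact j) (q * (pderiv ^^ j) ?r)"
    by (simp only: rodrigues)
  finally have "jacobi_inner l q (jacobi l j) = (-1) ^ l / fact j * poly_integral (q * (pderiv ^^ j) ?r)"
    by (simp only: jacobi_inner_def poly_integral_smult)
  also have "poly_integral (q * (pderiv ^^ j) ?r) = (-1) ^ j * poly_integral ((pderiv ^^ j) q * ?r)"
    by (rule poly_integral_by_parts) (auto intro!: zero)
  finally show ?thesis by (simp add: power_add)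
qed

lemma higher_pderiv_eq_0:
  fixes q :: "'a::field_char_0 poly"
  assumes "degree q < j"
  shows "(pderiv ^^ j) q = 0"
  by (rule poly_eqI) (use assms in \<open>auto simp: coeff_higher_pderiv coeff_eq_0\<close>)

lemma jacobi_inner_low_degree:
  assumes "degree q < j"
  shows "jacobi_inner l q (jacobi l j) = 0"
  using assms by (simp add: jacobi_inner_rodrigues higher_pderiv_eq_0)

lemma jacobi_orthogonal:
  assumes "i \<noteq> j"
  shows "jacobi_inner l (jacobi l i) (jacobi l j) = 0"
proof (cases "i < j")
  case True
  then show ?thesis by (intro jacobi_inner_low_degree) (simp add: degree_jacobi)
next
  case False
  then show ?thesis using assms
    by (subst jacobi_inner_commute, intro jacobi_inner_low_degree) (simp add: degree_jacobi)
qed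

text \<open>
  The squared norm of the Poisson mode with \<open>\<bar>n\<bar> = l\<close>; its reciprocal is the factor in the
  formula for the Schauder coefficients.
\<close>

definition mode_sqnorm :: "nat \<Rightarrow> nat \<Rightarrow> real" where
  "mode_sqnorm l m = real (m choose l) / (real (2 * m + 1) * real ((m + l) choose l))"

lemma mode_sqnorm_pos: "l \<le> m \<Longrightarrow> mode_sqnorm l m > 0"
  by (simp add: mode_sqnorm_def zero_less_binomial)

lemma inverse_mode_sqnorm_le:
  assumes "l \<le> m"
  shows "1 / mode_sqnorm l m \<le> 12 ^ m"
proof -
  have "1 / mode_sqnorm l m = real (2 * m + 1) * (real ((m + l) choose l) / real (m choose l))"
    by (simp add: mode_sqnorm_def)
  also have "\<dots> \<le> 3 ^ m * 4 ^ m"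
  proof (rule mult_mono)
    have "2 * m + 1 \<le> 3 ^ m" by (induction m) auto
    then show "real (2 * m + 1) \<le> 3 ^ m"
      by (metis of_nat_le_iff of_nat_numeral of_nat_power)
    have "real ((m + l) choose l) / real (m choose l) \<le> real ((m + l) choose l)"
      using assms zero_less_binomial[OF assms]
      by (simp add: divide_le_eq mult_le_cancel_left1 Suc_le_eq del: zero_less_binomial_iff)
    also have "(m + l) choose l \<le> 2 ^ (m + l)" by (rule binomial_le_pow2)
    also have "real (2 ^ (m + l)) \<le> 2 ^ (2 * m)"
      using assms by (simp add: power_increasing)
    also have "\<dots> = (4::real) ^ m" by (simp add: power_mult)
    finally show "real ((m + l) choose l) / real (m choose l) \<le> 4 ^ m" by simp
  qed auto
  also have "\<dots> = 12 ^ m" by (simp flip: power_mult_distrib)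
  finally show ?thesis .
qed

text \<open>
  Rodrigues' formula reduces the norm to the leading coefficient of \<open>jacobi l j\<close> times the symmetric Beta
  integral.
\<close>

lemma jacobi_sqnorm: "jacobi_inner l (jacobi l j) (jacobi l j) = mode_sqnorm l (l + j)"
proof -
  let ?m = "l + j"
  have "(pderiv ^^ j) (jacobi l j :: real poly) = [:fact j * real ((2 * ?m) choose j):]"
  proof (rule poly_eqI)
    fix i
    show "coeff ((pderiv ^^ j) (jacobi l j)) i = coeff [:fact j * real ((2 * ?m) choose j):] i"
      by (cases i) (auto simp: coeff_higher_pderiv coeff_jacobi pochhammer_fact coeff_eq_0 degree_jacobi)
  qed
  then have "jacobi_inner l (jacobi l j) (jacobi l j) =
     (-1) ^ ?m / fact j * (fact j * real ((2 * ?m) choose j) * poly_integral ([:0, 1:] ^ ?m * [:-1, 1:] ^ ?m))"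
    by (simp add: jacobi_inner_rodrigues poly_integral_smult)
  also have "\<dots> = real ((2 * ?m) choose j) * (fact ?m * fact ?m / fact (2 * ?m + 1))"
  proof -
    have "(-1) ^ ?m * ((-1) ^ ?m * c) = c" for c :: real
      by (simp flip: power_mult_distrib mult.assoc)
    then show ?thesis unfolding beta_poly_integral mult_2[symmetric]
      by (simp add: mult_ac del: fact_Suc)
  qed
  also have "\<dots> = fact ?m * fact ?m / (fact j * fact (2 * l + j) * real (2 * ?m + 1))"
  proof -
    have "real ((2 * ?m) choose j) = fact (2 * ?m) / (fact j * fact (2 * l + j))"
      using binomial_fact[of j "2 * ?m", where 'a=real] by (simp add: add.commute)
    moreover have "(fact (2 * ?m + 1) :: real) = real (2 * ?m + 1) * fact (2 * ?m)"
      by (simp only: fact_Suc flip: Suc_eq_plus1)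
    ultimately show ?thesis by (simp only:) (simp add: divide_simps del: of_nat_Suc of_nat_add)
  qed
  also have "\<dots> = mode_sqnorm l ?m"
  proof -
    have "real (?m choose l) = fact ?m / (fact l * fact j)"
      using binomial_fact[of l ?m, where 'a=real] by simp
    moreover have "real ((?m + l) choose l) = fact (2 * l + j) / (fact l * fact ?m)"
      using binomial_fact[of l "?m + l", where 'a=real] by (simp add: mult_2 add_ac)
    ultimately show ?thesis unfolding mode_sqnorm_def
      by (simp only:) (simp add: divide_simps del: of_nat_Suc of_nat_add)
  qed
  finally show ?thesis .
qed

text \<open>
  The Fourier coefficients of \<open>x\<^sup>k\<close> with respect to the orthogonal system \<open>jacobi l\<close>.
\<close>

definition jacobi_power_coeff :: "nat \<Rightarrow> nat \<Rightarrow> nat \<Rightarrow> real" where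
  "jacobi_power_coeff l k j = jacobi_inner l (monom 1 k) (jacobi l j) / mode_sqnorm l (l + j)"

lemma jacobi_span:
  "degree (q :: real poly) \<le> k \<Longrightarrow> \<exists>e. q = (\<Sum>j\<le>k. smult (e j) (jacobi l j))"
proof (induction k arbitrary: q)
  case 0
  then obtain c where "q = [:c:]" by (metis degree_eq_zeroE le_zero_eq)
  moreover have "jacobi l 0 = ([:1:] :: real poly)" by (simp add: jacobi_def one_pCons)
  ultimately show ?case by (intro exI[of _ "\<lambda>_. c"]) simp
next
  case (Suc k)
  define c where "c = coeff q (Suc k) / coeff (jacobi l (Suc k)) (Suc k)"
  let ?r = "q - smult c (jacobi l (Suc k))"
  have "coeff (jacobi l (Suc k) :: real poly) (Suc k) \<noteq> 0"
    unfolding coeff_jacobi of_nat_eq_0_iff binomial_eq_0_iff by simp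
  then have "coeff ?r (Suc k) = 0" by (simp add: c_def)
  moreover have "degree ?r \<le> Suc k"
    using Suc.prems by (intro degree_diff_le) (auto simp: degree_jacobi intro!: degree_smult_le[THEN order_trans])
  ultimately have "degree ?r \<le> k"
    by (metis degree_0 eq_zero_or_degree_less le_0_eq less_Suc_eq_le zero_le order_le_less)
  then obtain e where e: "?r = (\<Sum>j\<le>k. smult (e j) (jacobi l j))"
    using Suc.IH by blast
  have "q = ?r + smult c (jacobi l (Suc k))" by simp
  also have "\<dots> = (\<Sum>j\<le>Suc k. smult ((e(Suc k := c)) j) (jacobi l j))"
    unfolding e by simp
  finally show ?case by blast
qed

lemma jacobi_inner_sum_left:
  "jacobi_inner l (\<Sum>j\<in>S. smult (e j) (f j)) q = (\<Sum>j\<in>S. e j * jacobi_inner l (f j) q)"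
  by (simp add: jacobi_inner_def sum_distrib_left sum_distrib_right poly_integral_sum poly_integral_smult)

lemma power_eq_sum_jacobi_real:
  "monom 1 k = (\<Sum>j\<le>k. smult (jacobi_power_coeff l k j) (jacobi l j))"
proof -
  obtain e where e: "monom 1 k = (\<Sum>j\<le>k. smult (e j) (jacobi l j) :: real poly)"
    using jacobi_span[of "monom 1 k" k l] by (auto simp: degree_monom_le)
  have "jacobi_power_coeff l k j = e j" if "j \<le> k" for j
  proof -
    have "jacobi_inner l (monom 1 k) (jacobi l j) = (\<Sum>i\<le>k. e i * jacobi_inner l (jacobi l i) (jacobi l j))"
      unfolding e jacobi_inner_sum_left ..
    also have "\<dots> = (\<Sum>i\<le>k. if i = j then e j * mode_sqnorm l (l + j) else 0)"
      by (intro sum.cong) (auto simp: jacobi_orthogonal jacobi_sqnorm)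
    also have "\<dots> = e j * mode_sqnorm l (l + j)" using that by simp
    finally show ?thesis using mode_sqnorm_pos[of l "l + j"] by (simp add: jacobi_power_coeff_def)
  qed
  then show ?thesis unfolding e by (intro sum.cong) auto
qed

text \<open>
  The identity holds on the real line, hence it is an identity between polynomials.
\<close>

lemma power_eq_sum_jacobi:
  fixes x :: complex
  shows "x ^ k = (\<Sum>j\<le>k. of_real (jacobi_power_coeff l k j) * poly (jacobi l j) x)"
proof -
  define P where "P = monom 1 k - (\<Sum>j\<le>k. smult (complex_of_real (jacobi_power_coeff l k j)) (jacobi l j))"
  have "poly P (of_real t) = 0" for t :: real
  proof -
    have "poly (monom 1 k) t = (\<Sum>j\<le>k. jacobi_power_coeff l k j * poly (jacobi l j) t)"
      by (subst power_eq_sum_jacobi_real[of k l]) (simp add: poly_sum)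
    then have "complex_of_real (t ^ k) = of_real (\<Sum>j\<le>k. jacobi_power_coeff l k j * poly (jacobi l j) t)"
      by (simp add: poly_monom)
    then show ?thesis by (simp add: P_def poly_sum poly_monom poly_jacobi_of_real)
  qed
  then have "range complex_of_real \<subseteq> {x. poly P x = 0}" by auto
  moreover have "infinite (range complex_of_real)"
    by (simp add: finite_image_iff inj_of_real infinite_UNIV_char_0)
  ultimately have "P = 0" using poly_roots_finite finite_subset by blast
  then have "poly P x = 0" by simp
  then show ?thesis by (simp add: P_def poly_sum poly_monom)
qed

lemma abs_jacobi_inner_monom_le: "\<bar>jacobi_inner l (monom 1 k) (jacobi l j)\<bar> \<le> 4 ^ (l + j)"
  unfolding jacobi_inner_def
proof (rule abs_poly_integral_le)
  fix x :: real assume x: "x \<in> {0..1}"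
  have "\<bar>poly (jacobi l j) x\<bar> \<le> 4 ^ (l + j)"
    using norm_poly_jacobi_le[of x 1 l j] x by auto
  moreover have "\<bar>x ^ k\<bar> \<le> 1" "\<bar>(x * (1 - x)) ^ l\<bar> \<le> 1"
    using x by (auto simp: power_abs abs_mult intro!: power_le_one mult_le_one)
  ultimately have "\<bar>(x * (1 - x)) ^ l\<bar> * (\<bar>x ^ k\<bar> * \<bar>poly (jacobi l j) x\<bar>) \<le> 1 * (1 * 4 ^ (l + j))"
    by (intro mult_mono) auto
  then show "\<bar>poly (([:0, 1:] * [:1, -1:]) ^ l * (monom 1 k * jacobi l j)) x\<bar> \<le> 4 ^ (l + j)"
    by (simp add: poly_monom abs_mult)
qed

text \<open>
  On \<open>[0, 1]\<close> the power and the weight are at most \<open>1\<close>, so that only the growth of the Jacobi polynomial and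
  of the reciprocal norm enter.
\<close>

lemma abs_jacobi_power_coeff_le: "\<bar>jacobi_power_coeff l k j\<bar> \<le> 48 ^ (l + j)"
proof -
  have "\<bar>jacobi_power_coeff l k j\<bar> = \<bar>jacobi_inner l (monom 1 k) (jacobi l j)\<bar> * (1 / mode_sqnorm l (l + j))"
    using mode_sqnorm_pos[of l "l + j"] by (simp add: jacobi_power_coeff_def)
  also have "\<dots> \<le> 4 ^ (l + j) * 12 ^ (l + j)"
    using mode_sqnorm_pos[of l "l + j"]
    by (intro mult_mono abs_jacobi_inner_monom_le inverse_mode_sqnorm_le) auto
  also have "\<dots> = 48 ^ (l + j)" by (simp flip: power_mult_distrib)
  finally show ?thesis .
qed

section \<open>Rotations and radial integrals in the plane\<close>

lemma plane_maps_measurable [measurable]: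
  "(\<lambda>(x, y). (x + s * y, y) :: real \<times> real) \<in> borel_measurable borel"
  "(\<lambda>(x, y). (x, y + s * x) :: real \<times> real) \<in> borel_measurable borel"
  "(\<lambda>(x, y). (y, x) :: real \<times> real) \<in> borel_measurable borel"
  "(\<lambda>(x, y). Complex x y) \<in> borel_measurable borel"
  by (auto simp: split_beta Complex_eq intro!: borel_measurable_continuous_onI continuous_intros)

text \<open>
  On every horizontal line the shear is a translation, so a box and its preimage have the same area by
  Fubini. A rotation is a product of three shears, which is how its invariance is obtained below.
\<close>

lemma lborel_shear_fst:
  "distr lborel borel (\<lambda>(x, y). (x + s * y, y)) = (lborel :: (real \<times> real) measure)"
proof (rule lborel_eqI[symmetric])
  fix l u :: "real \<times> real"
  assume lu: "\<And>b. b \<in> Basis \<Longrightarrow> l \<bullet> b \<le> u \<bullet> b"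
  obtain l1 l2 u1 u2 where [simp]: "l = (l1, l2)" "u = (u1, u2)" by (cases l; cases u)
  have le: "l1 \<le> u1" "l2 \<le> u2" using lu[of "(1, 0)"] lu[of "(0, 1)"] by (auto simp: Basis_prod_def)
  let ?S = "{p. (fst p + s * snd p, snd p) \<in> box l u}"
  have "?S = (\<lambda>(x, y). (x + s * y, y)) -` box l u \<inter> space borel" by auto
  also have "\<dots> \<in> sets borel" by (rule measurable_sets[OF plane_maps_measurable(1)]) simp
  finally have S [measurable]: "?S \<in> sets (lborel \<Otimes>\<^sub>M lborel)"
    by (simp only: lborel_prod sets_lborel)
  have "emeasure (distr lborel borel (\<lambda>(x, y). (x + s * y, y))) (box l u) =
      emeasure (lborel \<Otimes>\<^sub>M lborel) ?S"
    by (subst emeasure_distr)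
      (auto simp: lborel_prod split_beta vimage_def plane_maps_measurable[unfolded split_beta])
  also have "\<dots> = (\<integral>\<^sup>+ y. emeasure lborel ((\<lambda>x. (x, y)) -` ?S) \<partial>lborel)"
    by (rule lborel_pair.emeasure_pair_measure_alt2) (rule S)
  also have "\<dots> = (\<integral>\<^sup>+ y. ennreal (u1 - l1) * indicator {l2<..<u2} y \<partial>lborel)"
  proof (intro nn_integral_cong)
    fix y :: real
    have "(\<lambda>x. (x, y)) -` ?S = (if y \<in> {l2<..<u2} then {l1 - s * y<..<u1 - s * y} else {})"
      by (auto simp: box_prod box_real algebra_simps)
    then show "emeasure lborel ((\<lambda>x. (x, y)) -` ?S) = ennreal (u1 - l1) * indicator {l2<..<u2} y"
      using le by auto
  qed
  also have "\<dots> = ennreal (u1 - l1) * ennreal (u2 - l2)"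
    using le by (simp add: nn_integral_cmult)
  also have "\<dots> = ennreal (\<Prod>b\<in>Basis. (u - l) \<bullet> b)"
    using le by (simp add: Basis_prod_def ennreal_mult prod.union_disjoint mult.commute)
  finally show "emeasure (distr lborel borel (\<lambda>(x, y). (x + s * y, y))) (box l u) =
    ennreal (\<Prod>b\<in>Basis. (u - l) \<bullet> b)" .
qed simp

lemma lborel_swap_real:
  "distr lborel borel (\<lambda>(x, y). (y, x)) = (lborel :: (real \<times> real) measure)"
proof -
  have "lborel = distr lborel (lborel :: (real \<times> real) measure) (\<lambda>(x, y). (y, x))"
    using lborel_pair.distr_pair_swap[where 'a=real and 'b=real] by (simp add: lborel_prod)
  also have "\<dots> = distr lborel borel (\<lambda>(x, y). (y, x))"
    by (rule distr_cong) auto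
  finally show ?thesis ..
qed

lemma lborel_shear_snd:
  "distr lborel borel (\<lambda>(x, y). (x, y + s * x)) = (lborel :: (real \<times> real) measure)"
proof -
  let ?w = "\<lambda>(x, y). (y, x :: real) :: real \<times> real" and ?f = "\<lambda>(x, y). (x + s * y, y) :: real \<times> real"
  have "distr lborel borel (\<lambda>(x, y). (x, y + s * x)) =
      distr (distr (distr lborel borel ?w) borel ?f) borel ?w"
  proof -
    have "distr (distr lborel borel ?w) borel ?f = distr lborel borel (?f \<circ> ?w)"
      by (rule distr_distr) (simp_all add: plane_maps_measurable)
    moreover have "distr (distr lborel borel (?f \<circ> ?w)) borel ?w = distr lborel borel (?w \<circ> (?f \<circ> ?w))"
    proof (rule distr_distr)
      show "?f \<circ> ?w \<in> measurable lborel borel"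
        by (rule measurable_comp[of _ _ borel]) (simp_all add: plane_maps_measurable)
    qed (simp add: plane_maps_measurable)
    ultimately show ?thesis by (simp only:) (simp add: comp_def case_prod_unfold)
  qed
  then show ?thesis by (simp only: lborel_swap_real lborel_shear_fst)
qed

lemma lborel_complex:
  "distr lborel borel (\<lambda>(x, y). Complex x y) = (lborel :: complex measure)"
proof (rule lborel_eqI[symmetric])
  have [measurable]: "(\<lambda>(x, y). Complex x y) \<in> borel_measurable (borel :: (real \<times> real) measure)"
    by (auto simp: Complex_eq split_beta intro!: borel_measurable_continuous_onI continuous_intros)
  fix l u :: complex
  assume lu: "\<And>b. b \<in> Basis \<Longrightarrow> l \<bullet> b \<le> u \<bullet> b"
  have le: "Re l \<le> Re u" "Im l \<le> Im u" using lu[of 1] lu[of \<i>] by (auto simp: Basis_complex_def)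
  have "emeasure (distr lborel borel (\<lambda>(x, y). Complex x y)) (box l u) =
      emeasure lborel (box (Re l, Im l) (Re u, Im u))"
    by (subst emeasure_distr) (auto simp: box_def Basis_complex_def Basis_prod_def intro!: arg_cong2[where f=emeasure])
  also have "\<dots> = ennreal (\<Prod>b\<in>Basis. (u - l) \<bullet> b)"
    using le by (subst emeasure_lborel_box) (auto simp: Basis_prod_def Basis_complex_def prod.union_disjoint)
  finally show "emeasure (distr lborel borel (\<lambda>(x, y). Complex x y)) (box l u) =
      ennreal (\<Prod>b\<in>Basis. (u - l) \<bullet> b)" .
qed simp

lemma lborel_rotation:
  assumes "cmod \<omega> = 1" "\<omega> \<noteq> -1"
  shows "distr lborel borel (\<lambda>z. \<omega> * z) = (lborel :: complex measure)"
proof -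
  define a b where "a = Re \<omega>" and "b = Im \<omega>"
  have ab: "a\<^sup>2 + b\<^sup>2 = 1" using assms(1) cmod_power2[of \<omega>] by (simp add: a_def b_def)
  have a: "a + 1 \<noteq> 0"
  proof
    assume "a + 1 = 0"
    then have "a = -1" by simp
    then have "b = 0" using ab by simp
    then show False using \<open>a = -1\<close> assms(2) by (simp add: a_def b_def complex_eq_iff)
  qed
  define s where "s = - b / (a + 1)"
  have sb: "1 + s * b = a" "2 * s + s * s * b = - b"
  proof -
    have "s * (a + 1) = - b" using a by (simp add: s_def)
    moreover have "b\<^sup>2 = (1 - a) * (a + 1)" using ab by (simp add: algebra_simps power2_eq_square)
    ultimately have "(1 + s * b) * (a + 1) = a * (a + 1)" by algebra
    then show 1: "1 + s * b = a" using a by simp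
    have "2 * s + s * s * b = s * (1 + (1 + s * b))" by (simp add: algebra_simps)
    also have "\<dots> = s * (a + 1)" by (simp only: 1 add.commute)
    also have "\<dots> = - b" using a by (simp add: s_def)
    finally show "2 * s + s * s * b = - b" .
  qed
  let ?f = "\<lambda>(x, y). (x + s * y, y) :: real \<times> real" and ?g = "\<lambda>(x, y). (x, y + b * x) :: real \<times> real"
  let ?c = "\<lambda>(x, y). Complex x y"
  have [measurable]: "?c \<in> borel_measurable (borel :: (real \<times> real) measure)"
    by (auto simp: Complex_eq split_beta intro!: borel_measurable_continuous_onI continuous_intros)
  have rot: "\<omega> * ?c p = ?c (?f (?g (?f p)))" for p
  proof -
    obtain x y where p: "p = (x, y)" by (cases p)
    have "a * x - b * y = (1 + s * b) * x + (2 * s + s * s * b) * y" "b * x + a * y = b * x + (1 + s * b) * y"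
      unfolding sb by simp_all
    then show ?thesis unfolding p by (simp add: complex_eq_iff a_def[symmetric] b_def[symmetric] algebra_simps)
  qed
  have "distr lborel borel (\<lambda>z. \<omega> * z) = distr (distr lborel borel ?c) borel (\<lambda>z. \<omega> * z)"
    by (simp only: lborel_complex)
  also have "\<dots> = distr lborel borel (\<lambda>p. ?c (?f (?g (?f p))))"
    by (subst distr_distr) (auto simp: comp_def rot)
  also have "\<dots> = distr (distr (distr (distr lborel borel ?f) borel ?g) borel ?f) borel ?c"
    by (simp add: distr_distr plane_maps_measurable comp_def)
  also have "\<dots> = lborel" by (simp only: lborel_shear_fst lborel_shear_snd lborel_complex)
  finally show ?thesis .
qed

lemma integral_rotation:
  fixes f :: "complex \<Rightarrow> complex"
  assumes "f \<in> borel_measurable borel" "cmod \<omega> = 1" "\<omega> \<noteq> -1"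
  shows "(LINT z|lborel. f (\<omega> * z)) = (LINT z|lborel. f z)"
proof -
  have "(LINT z|lborel. f z) = (LINT z|distr lborel borel (\<lambda>z. \<omega> * z). f z)"
    using lborel_rotation[OF assms(2,3)] by simp
  also have "\<dots> = (LINT z|lborel. f (\<omega> * z))"
    using assms(1) by (subst integral_distr) auto
  finally show ?thesis ..
qed

lemma emeasure_norm_square_le: "t \<ge> 0 \<Longrightarrow> emeasure lborel {z::complex. (cmod z)\<^sup>2 \<le> t} = ennreal (pi * t)"
proof -
  assume t: "t \<ge> 0"
  have "{z::complex. (cmod z)\<^sup>2 \<le> t} = cball 0 (sqrt t)"
    using t by (auto simp: real_le_rsqrt intro: sqrt_ge_absD)
  then show ?thesis using t by (simp add: emeasure_cball eval_unit_ball_vol)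
qed

lemma DERIV_inverse_power_shift:
  fixes t :: real
  assumes "t \<ge> 0"
  shows "((\<lambda>t. 1 / (1 + t) ^ n) has_real_derivative - (real n / (1 + t) ^ (n + 1))) (at t)"
proof -
  have "((\<lambda>t. 1 / (1 + t) ^ n) has_real_derivative - (real n * (1 + t) ^ (n - 1)) / ((1 + t) ^ n * (1 + t) ^ n)) (at t)"
    using assms by (auto intro!: derivative_eq_intros)
  also have "- (real n * (1 + t) ^ (n - 1)) / ((1 + t) ^ n * (1 + t) ^ n) = - (real n / (1 + t) ^ (n + 1))"
    using assms by (cases n) (auto simp: divide_simps)
  finally show ?thesis .
qed

text \<open>
  The area of the disc of radius \<open>\<surd>t\<close> is \<open>\<pi> t\<close>. The integrand, a decreasing function of \<open>\<bar>z\<bar>\<^sup>2\<close>, is written as the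
  integral of minus its derivative over \<open>t \<ge> \<bar>z\<bar>\<^sup>2\<close>; exchanging the integrals leaves an elementary one over \<open>t\<close>.
  With \<open>x = 1 / (1 + \<bar>z\<bar>\<^sup>2)\<close> the result says that the normalized area of the sphere projects to
  the uniform measure on \<open>[0, 1]\<close>.
\<close>

lemma sphere_area_moment:
  "has_bochner_integral lborel (\<lambda>z::complex. 1 / (1 + (cmod z)\<^sup>2) ^ (k + 2)) (pi / (real k + 1))"
proof (rule has_bochner_integral_nn_integral)
  let ?h = "\<lambda>t::real. real (k + 2) / (1 + t) ^ (k + 3)"
  have "(\<integral>\<^sup>+z. ennreal (1 / (1 + (cmod (z::complex))\<^sup>2) ^ (k + 2)) \<partial>lborel) =
     (\<integral>\<^sup>+z. (\<integral>\<^sup>+t. ennreal (?h t) * indicator {(cmod (z::complex))\<^sup>2..} t \<partial>lborel) \<partial>lborel)"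
  proof (intro nn_integral_cong)
    fix z :: complex
    have "(\<integral>\<^sup>+t. ennreal (?h t) * indicator {(cmod (z::complex))\<^sup>2..} t \<partial>lborel) =
        ennreal (0 - (- 1 / (1 + (cmod z)\<^sup>2) ^ (k + 2)))"
    proof (rule nn_integral_FTC_atLeast)
      fix t assume "(cmod z)\<^sup>2 \<le> t"
      then have t: "0 \<le> t" by (meson order_trans zero_le_power2)
      show "0 \<le> ?h t" using t by simp
      show "((\<lambda>t. - 1 / (1 + t) ^ (k + 2)) has_real_derivative ?h t) (at t)"
        using DERIV_minus[OF DERIV_inverse_power_shift[OF t, of "k + 2"]] by (simp add: numeral_3_eq_3)
    next
      show "((\<lambda>t::real. - 1 / (1 + t) ^ (k + 2)) \<longlongrightarrow> 0) at_top" by real_asymp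
    qed simp
    then show "ennreal (1 / (1 + (cmod (z::complex))\<^sup>2) ^ (k + 2)) =
        (\<integral>\<^sup>+t. ennreal (?h t) * indicator {(cmod (z::complex))\<^sup>2..} t \<partial>lborel)" by simp
  qed
  also have "\<dots> = (\<integral>\<^sup>+t. (\<integral>\<^sup>+z. ennreal (?h t) * indicator {(cmod (z::complex))\<^sup>2..} t \<partial>lborel) \<partial>lborel)"
    unfolding indicator_def atLeast_iff by (rule lborel_pair.Fubini') measurable
  also have "\<dots> = (\<integral>\<^sup>+t. ennreal (pi * (?h t * t)) * indicator {0..} t \<partial>lborel)"
  proof (intro nn_integral_cong)
    fix t :: real
    have "(\<integral>\<^sup>+z. ennreal (?h t) * indicator {(cmod (z::complex))\<^sup>2..} t \<partial>lborel) =
      (\<integral>\<^sup>+z. ennreal (?h t) * indicator {z. (cmod z)\<^sup>2 \<le> t} z \<partial>lborel)"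
      by (intro nn_integral_cong) (auto simp: indicator_def)
    also have "\<dots> = ennreal (?h t) * emeasure lborel {z::complex. (cmod z)\<^sup>2 \<le> t}"
      by (subst nn_integral_cmult_indicator) auto
    also have "\<dots> = ennreal (pi * (?h t * t)) * indicator {0..} t"
    proof (cases "t \<ge> 0")
      case True
      then show ?thesis by (simp add: emeasure_norm_square_le ennreal_mult[symmetric] mult_ac)
    next
      case False
      then have "{z::complex. (cmod z)\<^sup>2 \<le> t} = {}" by (auto simp: not_le intro: less_le_trans)
      then show ?thesis using False by simp
    qed
    finally show "(\<integral>\<^sup>+z. ennreal (?h t) * indicator {(cmod (z::complex))\<^sup>2..} t \<partial>lborel) =
      ennreal (pi * (?h t * t)) * indicator {0..} t" .
  qed
  also have "\<dots> = ennreal (0 - pi * (1 / (1 + 0) ^ (k + 2) - real (k + 2) / (real k + 1) / (1 + 0) ^ (k + 1)))"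
  proof (rule nn_integral_FTC_atLeast)
    fix t :: real assume t: "0 \<le> t"
    show "0 \<le> pi * (?h t * t)" using t by simp
    have "((\<lambda>t. pi * (1 / (1 + t) ^ (k + 2) - real (k + 2) / (real k + 1) / (1 + t) ^ (k + 1)))
       has_real_derivative pi * (- (real (k + 2) / (1 + t) ^ (k + 2 + 1)) -
         real (k + 2) / (real k + 1) * (- (real (k + 1) / (1 + t) ^ (k + 1 + 1))))) (at t)"
      using DERIV_cmult[OF DERIV_diff[OF DERIV_inverse_power_shift[OF t, of "k + 2"]
          DERIV_cmult[OF DERIV_inverse_power_shift[OF t, of "k + 1"], of "real (k + 2) / (real k + 1)"]], of pi]
      by (simp only: times_divide_eq_right mult_1_right)
    also have "- (real (k + 2) / (1 + t) ^ (k + 2 + 1)) -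
         real (k + 2) / (real k + 1) * (- (real (k + 1) / (1 + t) ^ (k + 1 + 1))) = ?h t * t"
    proof -
      have "(1 + t) ^ (k + 3) = (1 + t) ^ (k + 2) * (1 + t)" "(1 + t) ^ (k + 2 + 1) = (1 + t) ^ (k + 2) * (1 + t)"
        "(1 + t) ^ (k + 1 + 1) = (1 + t) ^ (k + 2)" by (simp_all add: numeral_3_eq_3)
      moreover have "(1 + t) ^ (k + 2) \<noteq> 0" using t by simp
      moreover have "- (c / (p * (1 + t))) - c / (real k + 1) * (- (real (k + 1) / p)) = c / (p * (1 + t)) * t"
        if "p \<noteq> 0" for c p using that t by (simp add: divide_simps) (simp add: algebra_simps)
      ultimately show ?thesis by presburger
    qed
    finally show "((\<lambda>t. pi * (1 / (1 + t) ^ (k + 2) - real (k + 2) / (real k + 1) / (1 + t) ^ (k + 1)))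
       has_real_derivative pi * (?h t * t)) (at t)" .
  next
    show "((\<lambda>t. pi * (1 / (1 + t) ^ (k + 2) - real (k + 2) / (real k + 1) / (1 + t) ^ (k + 1))) \<longlongrightarrow> 0) at_top"
      by real_asymp
  qed simp
  also have "0 - pi * (1 / (1 + 0) ^ (k + 2) - real (k + 2) / (real k + 1) / (1 + 0) ^ (k + 1)) = pi / (real k + 1)"
    by (simp add: field_simps)
  finally show "(\<integral>\<^sup>+z. ennreal (1 / (1 + (cmod (z::complex))\<^sup>2) ^ (k + 2)) \<partial>lborel) = ennreal (pi / (real k + 1))" .
qed auto

section \<open>Laurent expansion of holomorphic families\<close>

text \<open>
  Cauchy's formula for an annulus: the difference quotient of \<open>f\<close> at \<open>b\<close> extends holomorphically to \<open>b\<close>, so its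
  integrals over the two circles agree, while \<open>1 / (\<beta> - b)\<close> integrates to \<open>2 \<pi> \<i>\<close> on the outer circle and to \<open>0\<close>
  on the inner one.
\<close>

lemma laurent_split:
  assumes f: "f holomorphic_on - {0}" and r: "0 < r" "r < cmod b" "cmod b < R"
  shows "2 * of_real pi * \<i> * f b =
    contour_integral (circlepath 0 R) (\<lambda>\<beta>. f \<beta> / (\<beta> - b)) -
    contour_integral (circlepath 0 r) (\<lambda>\<beta>. f \<beta> / (\<beta> - b))"
proof -
  define h where "h \<beta> = (if \<beta> = b then deriv f b else (f \<beta> - f b) / (\<beta> - b))" for \<beta>
  have "h holomorphic_on - {0}"
    unfolding h_def by (rule pole_lemma_open[OF f]) auto
  then have eq: "contour_integral (circlepath 0 R) h = contour_integral (circlepath 0 r) h"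
    using r by (intro contour_integral_circlepath_eq(3)[of UNIV]) (auto simp: Compl_eq_Diff_UNIV)
  have split: "contour_integral (circlepath 0 s) h =
      contour_integral (circlepath 0 s) (\<lambda>\<beta>. f \<beta> / (\<beta> - b)) -
      f b * contour_integral (circlepath 0 s) (\<lambda>\<beta>. 1 / (\<beta> - b))"
    if s: "s > 0" "s \<noteq> cmod b" for s
  proof -
    have "contour_integral (circlepath 0 s) h =
        contour_integral (circlepath 0 s) (\<lambda>\<beta>. f \<beta> / (\<beta> - b) - f b * (1 / (\<beta> - b)))"
      using s by (intro contour_integral_eq) (auto simp: h_def diff_divide_distrib)
    also have "\<dots> = contour_integral (circlepath 0 s) (\<lambda>\<beta>. f \<beta> / (\<beta> - b)) -
      contour_integral (circlepath 0 s) (\<lambda>\<beta>. f b * (1 / (\<beta> - b)))"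
      using s by (intro contour_integral_diff contour_integrable_continuous_circlepath
         continuous_intros continuous_on_subset[OF holomorphic_on_imp_continuous_on[OF f]]) auto
    also have "contour_integral (circlepath 0 s) (\<lambda>\<beta>. f b * (1 / (\<beta> - b))) =
       f b * contour_integral (circlepath 0 s) (\<lambda>\<beta>. 1 / (\<beta> - b))"
      using s by (intro contour_integral_lmul contour_integrable_continuous_circlepath continuous_intros) auto
    finally show ?thesis .
  qed
  have "contour_integral (circlepath 0 R) (\<lambda>\<beta>. 1 / (\<beta> - b)) = 2 * of_real pi * \<i> * 1"
    using r by (intro contour_integral_unique Cauchy_integral_circlepath_simple) auto
  moreover have "contour_integral (circlepath 0 r) (\<lambda>\<beta>. 1 / (\<beta> - b)) = 0"
    using r by (intro contour_integral_unique Cauchy_theorem_disc_simple[of _ 0 "cmod b"] holomorphic_intros) auto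
  ultimately show ?thesis
    using eq split[of R] split[of r] r by (auto simp: algebra_simps)
qed

definition unit_circle :: "real \<Rightarrow> complex" where
  "unit_circle t = exp (2 * of_real pi * \<i> * of_real t)"

lemma unit_circle [simp]: "unit_circle t \<noteq> 0" "cmod (unit_circle t) = 1"
  using norm_exp_i_times[of "2 * pi * t"] by (simp_all add: unit_circle_def mult_ac)

lemma continuous_on_unit_circle [continuous_intros]:
  "continuous_on S f \<Longrightarrow> continuous_on S (\<lambda>x. unit_circle (f x))"
  unfolding unit_circle_def by (intro continuous_intros)

lemma contour_integral_circlepath_0:
  "contour_integral (circlepath 0 r) f =
    integral {0..1} (\<lambda>t. f (of_real r * unit_circle t) * (2 * of_real pi * \<i> * of_real r * unit_circle t))"
  unfolding contour_integral_integral vector_derivative_circlepath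
  by (simp add: circlepath unit_circle_def mult_ac)

lemma contour_integral_circlepath_inversion:
  assumes "0 < r" "0 < d" and k: "continuous_on (sphere 0 (d / r)) k"
  shows "contour_integral (circlepath 0 r) (\<lambda>\<beta>. k (of_real d / \<beta>) / \<beta>) =
         contour_integral (circlepath 0 (d / r)) (\<lambda>\<gamma>. k \<gamma> / \<gamma>)"
proof -
  have inv: "unit_circle (1 - t) = inverse (unit_circle t)" for t
  proof -
    have "unit_circle (1 - t) * unit_circle t = exp (2 * of_real pi * \<i>)"
      unfolding unit_circle_def exp_add[symmetric] by (rule arg_cong[of _ _ exp]) (simp add: algebra_simps)
    then have "unit_circle (1 - t) * unit_circle t = 1" by simp
    then show ?thesis using inverse_unique[of "unit_circle t" "unit_circle (1 - t)"] by (simp add: mult.commute)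
  qed
  define G where "G t = 2 * of_real pi * \<i> * k (of_real (d / r) * unit_circle t)" for t
  have "continuous_on {0..1} G"
    unfolding G_def using assms(1,2)
    by (intro continuous_intros continuous_on_compose2[OF k]) (auto simp: norm_mult simp del: of_real_divide)
  then have G: "(G has_integral integral {0..1} G) (cbox 0 1)"
    by (simp add: integrable_continuous_real integrable_integral)
  have im: "(\<lambda>x. (1 / -1) *\<^sub>R x + -((1 / -1) *\<^sub>R 1)) ` cbox 0 1 = {0..1::real}"
    using image_affinity_atLeastAtMost[of "-1" 1 0 "1::real"] by simp
  have "((\<lambda>t. G (-1 *\<^sub>R t + 1)) has_integral (1 / (\<bar>-1\<bar> ^ DIM(real))) *\<^sub>R integral {0..1} G)
     ((\<lambda>x. (1 / -1) *\<^sub>R x + -((1 / -1) *\<^sub>R 1)) ` cbox 0 1)"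
    by (rule has_integral_affinity[OF G]) simp
  then have "((\<lambda>t. G (1 - t)) has_integral integral {0..1} G) {0..1}"
    unfolding im by simp
  then have reflect: "integral {0..1} (\<lambda>t. G (1 - t)) = integral {0..1} G"
    by (rule integral_unique)
  have "contour_integral (circlepath 0 r) (\<lambda>\<beta>. k (of_real d / \<beta>) / \<beta>) = integral {0..1} (\<lambda>t. G (1 - t))"
    unfolding contour_integral_circlepath_0 G_def inv
    using assms(1,2) by (intro integral_cong) (simp add: divide_simps)
  also have "\<dots> = contour_integral (circlepath 0 (d / r)) (\<lambda>\<gamma>. k \<gamma> / \<gamma>)"
    unfolding contour_integral_circlepath_0 reflect unfolding G_def
    using assms(1,2) by (intro integral_cong) (simp add: mult_ac)
  finally show ?thesis .
qed

text \<open>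
  The inner circle of the annulus is moved by the inversion \<open>\<beta> \<mapsto> d / \<beta>\<close> to a large circle in the other
  coordinate. Both parts of the expansion of \<open>f\<close> then are Cauchy integrals over large circles, and both will
  be expanded in nonnegative powers. A positive \<open>d\<close> keeps the starting points of the circles on the
  positive axis; other values are reached later by analytic continuation.
\<close>

lemma laurent_split_inversion:
  assumes f: "f holomorphic_on - {0}" and q: "continuous_on (- {0}) q"
    and fq: "\<And>\<beta>. \<beta> \<noteq> 0 \<Longrightarrow> f \<beta> = q (of_real d / \<beta>)"
    and d: "0 < d" and b: "b \<noteq> 0" and R: "cmod b < R" and S: "cmod (of_real d / b) < S"
  shows "2 * of_real pi * \<i> * f b =
    contour_integral (circlepath 0 R) (\<lambda>\<beta>. f \<beta> / (\<beta> - b)) +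
    (contour_integral (circlepath 0 S) (\<lambda>\<gamma>. q \<gamma> / (\<gamma> - of_real d / b)) -
     contour_integral (circlepath 0 S) (\<lambda>\<gamma>. q \<gamma> / \<gamma>))"
proof -
  define c where "c = of_real d / b"
  define r where "r = d / S"
  have c: "c \<noteq> 0" "b = of_real d / c" using b d by (auto simp: c_def)
  have S0: "0 < S" using S by (meson norm_ge_zero le_less_trans)
  have "d < S * cmod b" using S d b by (simp add: norm_divide field_simps)
  then have r: "0 < r" "r < cmod b" using d S0 by (auto simp: r_def field_simps)
  define k where "k \<gamma> = - q \<gamma> * ((of_real d / \<gamma>) / (of_real d / \<gamma> - b))" for \<gamma>
  have keq: "k \<gamma> / \<gamma> = q \<gamma> / (\<gamma> - c) - q \<gamma> / \<gamma>" if "\<gamma> \<noteq> 0" "\<gamma> \<noteq> c" for \<gamma>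
  proof -
    have "of_real d / \<gamma> - of_real d / c = of_real d * (c - \<gamma>) / (\<gamma> * c)"
      using that c d by (simp add: field_simps)
    then show ?thesis unfolding k_def c(2) using that c(1) d by (simp add: field_simps)
  qed
  have dr: "d / r = S" using d by (simp add: r_def)
  have Sc: "S \<noteq> cmod c" using S by (simp add: c_def)
  have qS: "continuous_on (sphere 0 S) q" using S0 by (intro continuous_on_subset[OF q]) auto
  have contk: "continuous_on (sphere 0 S) k"
    unfolding k_def using S0 Sc d c
    by (intro continuous_intros qS) (auto simp: field_simps)
  have "- contour_integral (circlepath 0 r) (\<lambda>\<beta>. f \<beta> / (\<beta> - b)) =
     contour_integral (circlepath 0 r) (\<lambda>\<beta>. - (f \<beta> / (\<beta> - b)))"
    by (rule contour_integral_neg[symmetric])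
  also have "\<dots> = contour_integral (circlepath 0 r) (\<lambda>\<beta>. k (of_real d / \<beta>) / \<beta>)"
    using r d by (intro contour_integral_eq) (auto simp: k_def fq)
  also have "\<dots> = contour_integral (circlepath 0 S) (\<lambda>\<gamma>. k \<gamma> / \<gamma>)"
    using contour_integral_circlepath_inversion[OF r(1) d, of k] contk by (simp add: dr)
  also have "\<dots> = contour_integral (circlepath 0 S) (\<lambda>\<gamma>. q \<gamma> / (\<gamma> - c) - q \<gamma> / \<gamma>)"
    using S0 Sc by (intro contour_integral_eq keq) auto
  also have "\<dots> = contour_integral (circlepath 0 S) (\<lambda>\<gamma>. q \<gamma> / (\<gamma> - c)) -
     contour_integral (circlepath 0 S) (\<lambda>\<gamma>. q \<gamma> / \<gamma>)"
    using S0 Sc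
    by (intro contour_integral_diff contour_integrable_continuous_circlepath continuous_intros)
       (auto intro!: qS)
  finally show ?thesis
    using laurent_split[OF f r R] by (simp add: c_def)
qed

lemma holomorphic_suminf:
  assumes u: "\<And>n::nat. u n holomorphic_on UNIV"
    and bound: "\<And>\<rho>. \<exists>b. summable b \<and> (\<forall>z n. cmod z \<le> \<rho> \<longrightarrow> cmod (u n z) \<le> b n)"
  shows "(\<lambda>z. \<Sum>n. u n z) holomorphic_on UNIV"
proof (rule holomorphic_uniform_sequence[where f = "\<lambda>N z. \<Sum>n<N. u n z"])
  show "(\<lambda>z. \<Sum>n<N. u n z) holomorphic_on UNIV" for N
    by (intro holomorphic_intros u)
  fix x :: complex
  obtain b where b: "summable b" "\<And>z n. cmod z \<le> cmod x + 1 \<Longrightarrow> cmod (u n z) \<le> b n"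
    using bound by blast
  have "cmod z \<le> cmod x + 1" if "z \<in> cball x 1" for z
    using norm_triangle_ineq2[of z x] that by (simp add: dist_norm norm_minus_commute)
  then have "uniform_limit (cball x 1) (\<lambda>N z. \<Sum>n<N. u n z) (\<lambda>z. \<Sum>n. u n z) sequentially"
    by (intro Weierstrass_m_test[OF _ b(1)] b(2))
  then show "\<exists>d>0. cball x d \<subseteq> UNIV \<and>
      uniform_limit (cball x d) (\<lambda>N z. \<Sum>n<N. u n z) (\<lambda>z. \<Sum>n. u n z) sequentially"
    by (intro exI[of _ 1]) auto
qed auto

text \<open>
  A function in \<open>H(\<Omega>)\<close>, restricted to the points with \<open>B \<noteq> 0\<close>, is such a family: \<open>\<alpha>\<close> is the invariant
  coordinate \<open>A\<close>, and \<open>\<beta>\<close> parametrizes the orbits of the action of the punctured plane.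
\<close>

locale laurent_family =
  fixes \<Phi> :: "complex \<Rightarrow> complex \<Rightarrow> complex"
  assumes continuous: "continuous_on (UNIV \<times> - {0}) (\<lambda>(\<alpha>, \<beta>). \<Phi> \<alpha> \<beta>)"
    and holomorphic_fst: "\<beta> \<noteq> 0 \<Longrightarrow> (\<lambda>\<alpha>. \<Phi> \<alpha> \<beta>) holomorphic_on UNIV"
    and holomorphic_snd: "(\<lambda>\<beta>. \<Phi> \<alpha> \<beta>) holomorphic_on - {0}"
begin

definition coeff :: "nat \<Rightarrow> complex \<Rightarrow> complex" where
  "coeff n \<alpha> = contour_integral (circlepath 0 1) (\<lambda>\<beta>. \<Phi> \<alpha> \<beta> / \<beta> ^ Suc n) / (2 * of_real pi * \<i>)"

definition coeff2 :: "nat \<Rightarrow> nat \<Rightarrow> complex" where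
  "coeff2 n k = (deriv ^^ k) (coeff n) 0 / fact k"

lemma continuous_snd: "continuous_on (- {0}) (\<Phi> \<alpha>)"
  using holomorphic_on_imp_continuous_on[OF holomorphic_snd] .

lemma has_integral_coeff:
  assumes "R > 0"
  shows "((\<lambda>\<beta>. \<Phi> \<alpha> \<beta> / \<beta> ^ Suc n) has_contour_integral (2 * of_real pi * \<i> * coeff n \<alpha>)) (circlepath 0 R)"
proof -
  have hol: "(\<lambda>\<beta>. \<Phi> \<alpha> \<beta> / \<beta> ^ Suc n) holomorphic_on UNIV - {0}"
    using holomorphic_snd[of \<alpha>] by (intro holomorphic_intros) (auto simp: Compl_eq_Diff_UNIV)
  have eq: "contour_integral (circlepath 0 R) (\<lambda>\<beta>. \<Phi> \<alpha> \<beta> / \<beta> ^ Suc n) =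
      contour_integral (circlepath 0 1) (\<lambda>\<beta>. \<Phi> \<alpha> \<beta> / \<beta> ^ Suc n)"
  proof (cases "R \<le> 1")
    case True
    show ?thesis by (rule contour_integral_circlepath_eq(3)[OF open_UNIV hol, symmetric]) (use True assms in auto)
  next
    case False
    show ?thesis by (rule contour_integral_circlepath_eq(3)[OF open_UNIV hol]) (use False in auto)
  qed
  have "(\<lambda>\<beta>. \<Phi> \<alpha> \<beta> / \<beta> ^ Suc n) contour_integrable_on circlepath 0 R"
    using contour_integral_circlepath_eq(1)[OF open_UNIV hol, of R R] assms by auto
  from has_contour_integral_integral[OF this]
  show ?thesis unfolding eq coeff_def by simp
qed

lemma bounded_on_torus:
  assumes "R > 0"
  shows "\<exists>M\<ge>0. \<forall>\<alpha> \<beta>. cmod \<alpha> \<le> R \<longrightarrow> cmod \<beta> = R \<longrightarrow> cmod (\<Phi> \<alpha> \<beta>) \<le> M"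
proof -
  let ?f = "\<lambda>(\<alpha>, \<beta>). \<Phi> \<alpha> \<beta>"
  have "continuous_on (cball 0 R \<times> sphere 0 R) ?f"
    using assms by (intro continuous_on_subset[OF continuous]) auto
  then have "compact (?f ` (cball 0 R \<times> sphere 0 R))"
    by (intro compact_continuous_image compact_Times) auto
  then have "bounded (?f ` (cball 0 R \<times> sphere 0 R))" by (rule compact_imp_bounded)
  then obtain M where M: "\<And>x. x \<in> ?f ` (cball 0 R \<times> sphere 0 R) \<Longrightarrow> cmod x \<le> M"
    unfolding bounded_iff by blast
  show ?thesis
  proof (intro exI[of _ "max M 0"] conjI allI impI)
    fix \<alpha> \<beta> :: complex assume "cmod \<alpha> \<le> R" "cmod \<beta> = R"
    then have "cmod (?f (\<alpha>, \<beta>)) \<le> M" by (intro M imageI) simp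
    then show "cmod (\<Phi> \<alpha> \<beta>) \<le> max M 0" by simp
  qed simp
qed

text \<open>
  The circle of integration can be chosen with any radius, which makes the coefficients decay faster
  than any geometric sequence.
\<close>

lemma coeff_bound:
  assumes "R > 0"
  shows "\<exists>M\<ge>0. \<forall>n \<alpha>. cmod \<alpha> \<le> R \<longrightarrow> cmod (coeff n \<alpha>) \<le> M / R ^ n"
proof -
  obtain M where M: "M \<ge> 0" "\<forall>\<alpha> \<beta>. cmod \<alpha> \<le> R \<longrightarrow> cmod \<beta> = R \<longrightarrow> cmod (\<Phi> \<alpha> \<beta>) \<le> M"
    using bounded_on_torus[OF assms] by blast
  show ?thesis
  proof (intro exI[of _ M] conjI allI impI M(1))
    fix n \<alpha> assume \<alpha>: "cmod \<alpha> \<le> R"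
    have "cmod (2 * of_real pi * \<i> * coeff n \<alpha>) \<le> M / R ^ Suc n * (2 * pi * R)"
    proof (rule has_contour_integral_bound_circlepath[OF has_integral_coeff[OF assms]])
      fix \<beta> :: complex assume "cmod (\<beta> - 0) = R"
      then show "cmod (\<Phi> \<alpha> \<beta> / \<beta> ^ Suc n) \<le> M / R ^ Suc n"
        unfolding norm_divide norm_power using M(1) M(2)[rule_format, of \<alpha> \<beta>] \<alpha> assms
        by (intro frac_le) auto
    qed (use assms M(1) in auto)
    also have "\<dots> = 2 * pi * (M / R ^ n)" using assms by simp
    finally have "(2 * pi) * cmod (coeff n \<alpha>) \<le> (2 * pi) * (M / R ^ n)" by (simp add: norm_mult)
    then show "cmod (coeff n \<alpha>) \<le> M / R ^ n" by (subst (asm) mult_le_cancel_left_pos) auto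
  qed
qed

lemma continuous_coeff: "continuous_on UNIV (coeff n)"
proof -
  define k where "k = 2 * of_real pi * \<i>"
  have eq: "coeff n \<alpha> = integral (cbox 0 1) (\<lambda>t. \<Phi> \<alpha> (unit_circle t) / unit_circle t ^ Suc n * (k * unit_circle t)) / k" for \<alpha>
    by (simp only: coeff_def contour_integral_circlepath_0 k_def of_real_1 mult_1_left mult_1_right cbox_interval)
  have sub: "(\<lambda>x. (fst x, unit_circle (snd x))) ` (UNIV \<times> cbox 0 1) \<subseteq> UNIV \<times> - {0 :: complex}"
    by auto
  have "continuous_on (UNIV \<times> cbox 0 1) (\<lambda>x. (\<lambda>(\<alpha>, \<beta>). \<Phi> \<alpha> \<beta>) (fst x, unit_circle (snd x)))"
    by (rule continuous_on_compose2[OF continuous _ sub]) (intro continuous_intros)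
  then have "continuous_on (UNIV \<times> cbox 0 1)
     (\<lambda>x. \<Phi> (fst x) (unit_circle (snd x)) / unit_circle (snd x) ^ Suc n * (k * unit_circle (snd x)))"
    unfolding split_beta by (intro continuous_intros) auto
  then have "continuous_on UNIV (\<lambda>\<alpha>. integral (cbox 0 1)
     (\<lambda>t. \<Phi> \<alpha> (unit_circle t) / unit_circle t ^ Suc n * (k * unit_circle t)))"
    by (intro integral_continuous_on_param) (simp only: case_prod_unfold)
  then show ?thesis unfolding eq by (intro continuous_intros) (simp_all add: k_def)
qed

text \<open>
  Exchanging the integral over \<open>\<beta>\<close> with the Cauchy integral in \<open>\<alpha>\<close> shows that the coefficient is itself a
  Cauchy integral of a continuous function.
\<close>

lemma holomorphic_coeff: "coeff n holomorphic_on UNIV"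
proof -
  have "\<exists>D. (coeff n has_field_derivative D) (at w)" for w
  proof -
    define r where "r = cmod w + 1"
    have r: "r > 0" "w \<in> ball 0 r" by (auto simp: r_def add_nonneg_pos)
    define k where "k = 2 * of_real pi * \<i>"
    have k: "k \<noteq> 0" by (simp add: k_def)
    have int: "((\<lambda>u. coeff n u / (u - v) ^ 1) has_contour_integral (k * coeff n v)) (circlepath 0 r)"
      if v: "v \<in> ball 0 r" for v
    proof -
      let ?K = "\<lambda>u \<beta>. \<Phi> u \<beta> / \<beta> ^ Suc n / (u - v)"
      have "(\<lambda>u. coeff n u / (u - v) ^ 1) contour_integrable_on circlepath 0 r"
        using v by (intro contour_integrable_continuous_circlepath continuous_intros
          continuous_on_subset[OF continuous_coeff]) auto
      moreover have "contour_integral (circlepath 0 r) (\<lambda>u. coeff n u / (u - v) ^ 1) = k * coeff n v"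
      proof -
        have cont: "continuous_on (sphere 0 r \<times> sphere 0 1) (\<lambda>(u, \<beta>). ?K u \<beta>)"
        proof -
          have "sphere 0 r \<times> sphere 0 1 \<subseteq> UNIV \<times> - {0 :: complex}" by auto
          then show ?thesis
            using continuous_on_subset[OF continuous, of "sphere 0 r \<times> sphere 0 1"] v r
            by (auto simp: split_beta intro!: continuous_intros)
        qed
        have "k * contour_integral (circlepath 0 r) (\<lambda>u. coeff n u / (u - v) ^ 1) =
           contour_integral (circlepath 0 r) (\<lambda>u. k * (coeff n u / (u - v) ^ 1))"
          by (rule contour_integral_lmul[symmetric]) fact
        also have "\<dots> = contour_integral (circlepath 0 r) (\<lambda>u. contour_integral (circlepath 0 1) (?K u))"
        proof (intro contour_integral_eq)
          fix u assume "u \<in> path_image (circlepath 0 r)"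
          have "((\<lambda>\<beta>. \<Phi> u \<beta> / \<beta> ^ Suc n / (u - v)) has_contour_integral (k * coeff n u / (u - v))) (circlepath 0 1)"
            unfolding k_def by (intro has_contour_integral_div has_integral_coeff) simp
          then show "k * (coeff n u / (u - v) ^ 1) = contour_integral (circlepath 0 1) (?K u)"
            by (simp add: contour_integral_unique)
        qed
        also have "\<dots> = contour_integral (circlepath 0 1) (\<lambda>\<beta>. contour_integral (circlepath 0 r) (\<lambda>u. ?K u \<beta>))"
          using cont r
          by (intro contour_integral_swap)
             (auto simp: vector_derivative_circlepath intro!: continuous_intros)
        also have "\<dots> = contour_integral (circlepath 0 1) (\<lambda>\<beta>. k * (\<Phi> v \<beta> / \<beta> ^ Suc n))"
        proof (intro contour_integral_eq contour_integral_unique)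
          fix \<beta> :: complex assume "\<beta> \<in> path_image (circlepath 0 1)"
          then have \<beta>: "\<beta> \<noteq> 0" by auto
          have "((\<lambda>u. (\<Phi> u \<beta> / \<beta> ^ Suc n) / (u - v)) has_contour_integral
              (2 * of_real pi * \<i> * (\<Phi> v \<beta> / \<beta> ^ Suc n))) (circlepath 0 r)"
            using v \<beta> holomorphic_fst[OF \<beta>]
            by (intro Cauchy_integral_circlepath_simple holomorphic_intros)
               (auto intro: holomorphic_on_subset)
          then show "((\<lambda>u. ?K u \<beta>) has_contour_integral k * (\<Phi> v \<beta> / \<beta> ^ Suc n)) (circlepath 0 r)"
            by (simp add: k_def)
        qed
        also have "\<dots> = k * (k * coeff n v)"
          unfolding k_def
          by (intro contour_integral_unique has_contour_integral_lmul has_integral_coeff) simp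
        finally show ?thesis using k by simp
      qed
      ultimately show ?thesis
        using has_contour_integral_integral by metis
    qed
    have "((\<lambda>v. k * coeff n v) has_field_derivative
        (1 * contour_integral (circlepath 0 r) (\<lambda>u. coeff n u / (u - w) ^ Suc 1))) (at w)"
      using Cauchy_next_derivative_circlepath(2)[OF continuous_on_subset[OF continuous_coeff] int _ r(2)]
      by simp
    from DERIV_cmult[OF this, of "1 / k"] show ?thesis using k by auto
  qed
  then show ?thesis by (simp add: holomorphic_on_open)
qed

lemma coeff2_bound:
  assumes "R > 0"
  shows "\<exists>M\<ge>0. \<forall>n k. cmod (coeff2 n k) \<le> M / R ^ (n + k)"
proof -
  obtain M where M: "M \<ge> 0" "\<And>n \<alpha>. cmod \<alpha> \<le> R \<Longrightarrow> cmod (coeff n \<alpha>) \<le> M / R ^ n"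
    using coeff_bound[OF assms] by blast
  show ?thesis
  proof (intro exI[of _ M] conjI allI M(1))
    fix n k
    have "cmod ((deriv ^^ k) (coeff n) 0) \<le> fact k * (M / R ^ n) / R ^ k"
      using assms M(2)
      by (intro Cauchy_inequality holomorphic_on_subset[OF holomorphic_coeff]
           continuous_on_subset[OF continuous_coeff]) auto
    then show "cmod (coeff2 n k) \<le> M / R ^ (n + k)"
      by (simp add: coeff2_def norm_divide power_add field_simps)
  qed
qed

lemma coeff_sums: "(\<lambda>k. coeff2 n k * \<alpha> ^ k) sums coeff n \<alpha>"
  using holomorphic_power_series[OF holomorphic_on_subset[OF holomorphic_coeff], of 0 "cmod \<alpha> + 1" \<alpha> n]
  by (simp add: coeff2_def)

text \<open>
  The Cauchy kernel is expanded as a finite geometric sum with an explicit remainder of order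
  \<open>(\<bar>b\<bar> / R)\<^sup>N\<close>.
\<close>

lemma cauchy_part_sums:
  assumes b: "cmod b < R"
  shows "(\<lambda>n. coeff n \<alpha> * b ^ n) sums
     (contour_integral (circlepath 0 R) (\<lambda>\<beta>. \<Phi> \<alpha> \<beta> / (\<beta> - b)) / (2 * of_real pi * \<i>))"
proof -
  define k where "k = 2 * of_real pi * \<i>"
  have k: "k \<noteq> 0" by (simp add: k_def)
  have R: "R > 0" using b by (meson norm_ge_zero le_less_trans)
  let ?I = "contour_integral (circlepath 0 R) (\<lambda>\<beta>. \<Phi> \<alpha> \<beta> / (\<beta> - b))"
  define q where "q = cmod b / R"
  have q: "0 \<le> q" "q < 1" using b R by (auto simp: q_def)
  have cont: "continuous_on (sphere 0 R) (\<Phi> \<alpha>)"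
    using R by (intro continuous_on_subset[OF continuous_snd]) auto
  obtain M where M: "M \<ge> 0" "\<And>\<beta>. cmod \<beta> = R \<Longrightarrow> cmod (\<Phi> \<alpha> \<beta>) \<le> M"
  proof -
    have "bounded (\<Phi> \<alpha> ` sphere 0 R)"
      by (intro compact_imp_bounded compact_continuous_image cont) auto
    then obtain M where "\<And>x. x \<in> \<Phi> \<alpha> ` sphere 0 R \<Longrightarrow> cmod x \<le> M"
      unfolding bounded_iff by blast
    then have "cmod (\<Phi> \<alpha> \<beta>) \<le> max M 0" if "cmod \<beta> = R" for \<beta>
      using that by (intro max.coboundedI1) simp
    then show ?thesis using that[of "max M 0"] by (meson max.cobounded2)
  qed
  have rem: "cmod (?I - (\<Sum>n<N. k * (coeff n \<alpha> * b ^ n))) \<le> M * q ^ N / (R - cmod b) * (2 * pi * R)" for N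
  proof -
    let ?t = "\<lambda>n \<beta>. \<Phi> \<alpha> \<beta> / \<beta> ^ Suc n * b ^ n"
    have 1: "((\<lambda>\<beta>. \<Phi> \<alpha> \<beta> / (\<beta> - b)) has_contour_integral ?I) (circlepath 0 R)"
      using b by (intro has_contour_integral_integral contour_integrable_continuous_circlepath
          continuous_intros) (use R in \<open>auto intro!: cont\<close>)
    have "(?t n has_contour_integral (k * coeff n \<alpha> * b ^ n)) (circlepath 0 R)" for n
      unfolding k_def by (rule has_contour_integral_rmul[OF has_integral_coeff[OF R]])
    then have 2: "((\<lambda>\<beta>. \<Sum>n<N. ?t n \<beta>) has_contour_integral
        (\<Sum>n<N. k * coeff n \<alpha> * b ^ n)) (circlepath 0 R)"
      by (rule has_contour_integral_sum[OF finite_lessThan])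
    have "((\<lambda>\<beta>. \<Phi> \<alpha> \<beta> / (\<beta> - b) - (\<Sum>n<N. ?t n \<beta>)) has_contour_integral
        (?I - (\<Sum>n<N. k * coeff n \<alpha> * b ^ n))) (circlepath 0 R)"
      by (rule has_contour_integral_diff[OF 1 2])
    then have "cmod (?I - (\<Sum>n<N. k * coeff n \<alpha> * b ^ n)) \<le> M * q ^ N / (R - cmod b) * (2 * pi * R)"
    proof (rule has_contour_integral_bound_circlepath)
      fix \<beta> assume "cmod (\<beta> - 0) = R"
      then have \<beta>: "cmod \<beta> = R" "\<beta> \<noteq> 0" "\<beta> \<noteq> b" using R b by auto
      have "(\<Sum>n<N. \<Phi> \<alpha> \<beta> / \<beta> ^ Suc n * b ^ n) = \<Phi> \<alpha> \<beta> / \<beta> * (\<Sum>n<N. (b / \<beta>) ^ n)"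
        unfolding sum_distrib_left by (intro sum.cong refl) (simp add: power_divide)
      also have "(\<Sum>n<N. (b / \<beta>) ^ n) = (1 - (b / \<beta>) ^ N) / (1 - b / \<beta>)"
        using \<beta> by (subst sum_gp_strict) auto
      also have "1 - b / \<beta> = (\<beta> - b) / \<beta>"
        using \<beta> by (simp add: diff_divide_distrib)
      also have "\<Phi> \<alpha> \<beta> / \<beta> * ((1 - (b / \<beta>) ^ N) / ((\<beta> - b) / \<beta>)) =
          \<Phi> \<alpha> \<beta> / (\<beta> - b) * (1 - (b / \<beta>) ^ N)"
        using \<beta> by simp
      finally have "\<Phi> \<alpha> \<beta> / (\<beta> - b) - (\<Sum>n<N. \<Phi> \<alpha> \<beta> / \<beta> ^ Suc n * b ^ n) =
         \<Phi> \<alpha> \<beta> * (b / \<beta>) ^ N / (\<beta> - b)"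
        by (simp add: right_diff_distrib)
      also have "cmod \<dots> = cmod (\<Phi> \<alpha> \<beta>) * q ^ N / cmod (\<beta> - b)"
        by (simp add: norm_mult norm_divide norm_power q_def \<beta>)
      also have "\<dots> \<le> M * q ^ N / (R - cmod b)"
        using M \<beta> b q norm_triangle_ineq2[of \<beta> b] by (intro frac_le mult_right_mono mult_nonneg_nonneg) auto
      finally show "cmod (\<Phi> \<alpha> \<beta> / (\<beta> - b) - (\<Sum>n<N. \<Phi> \<alpha> \<beta> / \<beta> ^ Suc n * b ^ n)) \<le> M * q ^ N / (R - cmod b)" .
    qed (use M q b R in auto)
    then show ?thesis by (simp add: mult.assoc)
  qed
  have "(\<lambda>N. q ^ N) \<longlonglongrightarrow> 0" using q by (intro LIMSEQ_realpow_zero) auto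
  then have "(\<lambda>N. q ^ N * (M / (R - cmod b) * (2 * pi * R))) \<longlonglongrightarrow> 0"
    by (rule tendsto_mult_left_zero)
  then have lim: "(\<lambda>N. M * q ^ N / (R - cmod b) * (2 * pi * R)) \<longlonglongrightarrow> 0" by (simp add: mult_ac)
  have "(\<lambda>N. ?I - (\<Sum>n<N. k * (coeff n \<alpha> * b ^ n))) \<longlonglongrightarrow> 0"
    by (rule Lim_null_comparison[OF always_eventually lim]) (use rem in blast)
  from tendsto_diff[OF tendsto_const[of ?I] this]
  have "(\<lambda>n. k * (coeff n \<alpha> * b ^ n)) sums ?I" by (simp add: sums_def)
  from sums_divide[OF this, of k]
  have "(\<lambda>n. coeff n \<alpha> * b ^ n) sums (?I / k)" using k by simp
  then show ?thesis unfolding k_def .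
qed

lemma coeff_series_bound:
  assumes R: "R > 0" and c: "c \<le> R / 2"
  shows "\<exists>b. summable b \<and> (\<forall>\<alpha> \<beta> n. cmod \<alpha> \<le> R \<longrightarrow> cmod \<beta> \<le> c \<longrightarrow> cmod (coeff n \<alpha> * \<beta> ^ n) \<le> b n)"
proof -
  obtain M where M: "M \<ge> 0" "\<And>n \<alpha>. cmod \<alpha> \<le> R \<Longrightarrow> cmod (coeff n \<alpha>) \<le> M / R ^ n"
    using coeff_bound[OF R] by blast
  have "cmod (coeff n \<alpha> * \<beta> ^ n) \<le> M * (1 / 2) ^ n" if "cmod \<alpha> \<le> R" "cmod \<beta> \<le> c" for \<alpha> \<beta> n
  proof -
    have "cmod (coeff n \<alpha> * \<beta> ^ n) \<le> M / R ^ n * (R / 2) ^ n"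
      unfolding norm_mult norm_power using M that c R by (intro mult_mono power_mono) auto
    also have "\<dots> = M * (1 / 2) ^ n" using R by (simp add: power_divide)
    finally show ?thesis .
  qed
  then show ?thesis by (intro exI[of _ "\<lambda>n. M * (1 / 2) ^ n"]) (auto intro!: summable_mult summable_geometric)
qed

end

text \<open>
  For real \<open>\<alpha> > 1\<close> the number \<open>d = \<alpha> (\<alpha> - 1)\<close> is positive and the annulus formula applies. Both sides are
  entire functions of \<open>\<alpha>\<close> for fixed \<open>b\<close>, so the formula persists for all \<open>\<alpha>\<close>, including the degenerate values \<open>0\<close>
  and \<open>1\<close>.
\<close>

lemma two_sided_expansion:
  assumes "laurent_family \<Phi>" "laurent_family \<Psi>"
    and eq: "\<And>\<alpha> \<beta>. \<alpha> \<noteq> 0 \<Longrightarrow> \<alpha> \<noteq> 1 \<Longrightarrow> \<beta> \<noteq> 0 \<Longrightarrow> \<Phi> \<alpha> \<beta> = \<Psi> \<alpha> (\<alpha> * (\<alpha> - 1) / \<beta>)"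
    and b: "b \<noteq> 0"
  shows "\<Phi> \<alpha> b = (\<Sum>n. laurent_family.coeff \<Phi> n \<alpha> * b ^ n) +
     (\<Sum>n. laurent_family.coeff \<Psi> (Suc n) \<alpha> * (\<alpha> * (\<alpha> - 1) / b) ^ Suc n)"
proof -
  interpret P: laurent_family \<Phi> by fact
  interpret Q: laurent_family \<Psi> by fact
  let ?S = "\<lambda>\<alpha>. (\<Sum>n. P.coeff n \<alpha> * b ^ n) + (\<Sum>n. Q.coeff (Suc n) \<alpha> * (\<alpha> * (\<alpha> - 1) / b) ^ Suc n)"
  define h where "h \<alpha> = \<Phi> \<alpha> b - ?S \<alpha>" for \<alpha>
  have "h holomorphic_on UNIV"
    unfolding h_def
  proof (intro holomorphic_intros P.holomorphic_fst b holomorphic_suminf P.holomorphic_coeff Q.holomorphic_coeff)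
    fix \<rho> :: real
    define R where "R = max (2 * cmod b) \<rho> + 1"
    have "R > 0" "cmod b \<le> R / 2" "\<rho> \<le> R"
      using norm_ge_zero[of b] by (auto simp: R_def simp del: norm_ge_zero)
    then show "\<exists>ba. summable ba \<and> (\<forall>z n. cmod z \<le> \<rho> \<longrightarrow> cmod (P.coeff n z * b ^ n) \<le> ba n)"
      using P.coeff_series_bound[of R "cmod b"] by (meson order_refl order_trans)
  next
    fix \<rho> :: real
    define c where "c = \<bar>\<rho>\<bar> * (\<bar>\<rho>\<bar> + 1) / cmod b"
    define R where "R = max (2 * c) \<bar>\<rho>\<bar> + 1"
    have R: "R > 0" "c \<le> R / 2" "\<rho> \<le> R" by (auto simp: R_def)
    obtain B where B: "summable B" "\<And>\<alpha> \<beta> n. cmod \<alpha> \<le> R \<Longrightarrow> cmod \<beta> \<le> c \<Longrightarrow> cmod (Q.coeff n \<alpha> * \<beta> ^ n) \<le> B n"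
      using Q.coeff_series_bound[OF R(1,2)] by blast
    have "cmod (Q.coeff (Suc n) z * (z * (z - 1) / b) ^ Suc n) \<le> B (Suc n)" if z: "cmod z \<le> \<rho>" for z n
    proof (rule B)
      have "cmod (z - 1) \<le> \<bar>\<rho>\<bar> + 1" using norm_triangle_ineq4[of z 1] z by simp
      then have "cmod z * cmod (z - 1) \<le> \<bar>\<rho>\<bar> * (\<bar>\<rho>\<bar> + 1)" using z by (intro mult_mono) auto
      then show "cmod (z * (z - 1) / b) \<le> c" unfolding c_def norm_mult norm_divide by (rule divide_right_mono) simp
    qed (use z R in auto)
    moreover have "summable (\<lambda>n. B (Suc n))" using B(1) by (simp add: summable_Suc_iff)
    ultimately show "\<exists>ba. summable ba \<and>
        (\<forall>z n. cmod z \<le> \<rho> \<longrightarrow> cmod (Q.coeff (Suc n) z * (z * (z - 1) / b) ^ Suc n) \<le> ba n)" by blast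
  qed
  moreover have "h z = 0" if "z \<in> of_real ` {1::real<..}" for z
  proof -
    have "\<exists>x::real. z = of_real x \<and> x > 1" using that by auto
    then obtain x :: real where x: "z = of_real x" "x > 1" by blast
    define d where "d = x * (x - 1)"
    have d: "d > 0" using x by (simp add: d_def)
    have dz: "of_real d = z * (z - 1)" by (simp add: d_def x)
    have z: "z \<noteq> 0" "z \<noteq> 1" using x by auto
    define c where "c = of_real d / b"
    define k where "k = 2 * of_real pi * \<i>"
    have k: "k \<noteq> 0" by (simp add: k_def)
    let ?p = "contour_integral (circlepath 0 (cmod b + 1)) (\<lambda>\<beta>. \<Phi> z \<beta> / (\<beta> - b))"
    let ?q = "contour_integral (circlepath 0 (cmod c + 1)) (\<lambda>\<gamma>. \<Psi> z \<gamma> / (\<gamma> - c))"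
    have "k * \<Phi> z b = ?p + (?q - contour_integral (circlepath 0 (cmod c + 1)) (\<lambda>\<gamma>. \<Psi> z \<gamma> / \<gamma>))"
      unfolding k_def c_def
      by (rule laurent_split_inversion[OF P.holomorphic_snd Q.continuous_snd _ d b])
         (use eq z in \<open>auto simp: dz\<close>)
    \<comment> \<open>The constant term would be counted twice; it is the one that the inversion subtracts.\<close>
    also have "contour_integral (circlepath 0 (cmod c + 1)) (\<lambda>\<gamma>. \<Psi> z \<gamma> / \<gamma>) = k * Q.coeff 0 z"
      using Q.has_integral_coeff[of "cmod c + 1" z 0]
      by (simp add: contour_integral_unique k_def add_nonneg_pos)
    finally have "\<Phi> z b = ?p / k + (?q / k - Q.coeff 0 z)" using k by (simp add: field_simps)
    also have "?p / k = (\<Sum>n. P.coeff n z * b ^ n)"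
      using P.cauchy_part_sums[of b "cmod b + 1" z] by (simp add: sums_iff k_def)
    also have "?q / k - Q.coeff 0 z = (\<Sum>n. Q.coeff (Suc n) z * c ^ Suc n)"
    proof -
      have "(\<lambda>n. Q.coeff n z * c ^ n) sums (?q / k)"
        using Q.cauchy_part_sums[of c "cmod c + 1" z] by (simp add: k_def)
      then have "(\<lambda>n. Q.coeff (Suc n) z * c ^ Suc n) sums (?q / k - Q.coeff 0 z * c ^ 0)"
        by (subst sums_Suc_iff) simp
      then show ?thesis by (simp add: sums_iff)
    qed
    finally show ?thesis by (simp add: h_def c_def dz)
  qed
  moreover have "(2 :: complex) islimpt of_real ` {1::real<..}"
  proof -
    have "(\<lambda>n. complex_of_real (2 + 1 / real (Suc n))) \<longlonglongrightarrow> of_real (2 + 0)"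
      by (intro tendsto_intros LIMSEQ_Suc[OF lim_1_over_n])
    then have lim: "(\<lambda>n. complex_of_real (2 + 1 / real (Suc n))) \<longlonglongrightarrow> 2" by simp
    have "complex_of_real (2 + 1 / real (Suc n)) \<in> of_real ` {1::real<..} - {2}" for n
    proof (intro DiffI imageI)
      have "0 < 1 / real (Suc n)" by simp
      then show "2 + 1 / real (Suc n) \<in> {1<..}" by (simp only: greaterThan_iff)
      show "complex_of_real (2 + 1 / real (Suc n)) \<notin> {2}" by (simp add: complex_eq_iff)
    qed
    then show ?thesis unfolding islimpt_sequential using lim
      by (intro exI[of _ "\<lambda>n. complex_of_real (2 + 1 / real (Suc n))"]) blast
  qed
  ultimately have "h \<alpha> = 0"
    using analytic_continuation[of h UNIV "of_real ` {1::real<..}" 2 \<alpha>] by auto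
  then show ?thesis by (simp add: h_def)
qed

section \<open>Holomorphic functions of two variables\<close>

lemma holomorphic2_onI:
  assumes "\<And>p. p \<in> S \<Longrightarrow> (f has_derivative (\<lambda>x. a p * fst x + b p * snd x)) (at p)"
  shows "holomorphic2_on f S"
  unfolding holomorphic2_on_def case_prod_unfold using assms by blast

lemma holomorphic2_onE:
  assumes "holomorphic2_on f S"
  obtains a b where "\<And>p. p \<in> S \<Longrightarrow> (f has_derivative (\<lambda>x. a p * fst x + b p * snd x)) (at p)"
  using assms unfolding holomorphic2_on_def case_prod_unfold by metis

lemma holomorphic2_on_const: "holomorphic2_on (\<lambda>_. c) S"
  by (rule holomorphic2_onI[where a = "\<lambda>_. 0" and b = "\<lambda>_. 0"]) simp

lemma holomorphic2_on_fst: "holomorphic2_on fst S"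
  by (rule holomorphic2_onI[where a = "\<lambda>_. 1" and b = "\<lambda>_. 0"]) (auto intro!: derivative_eq_intros)

lemma holomorphic2_on_snd: "holomorphic2_on snd S"
  by (rule holomorphic2_onI[where a = "\<lambda>_. 0" and b = "\<lambda>_. 1"]) (auto intro!: derivative_eq_intros)

lemma holomorphic2_on_add:
  assumes "holomorphic2_on f S" "holomorphic2_on g S"
  shows "holomorphic2_on (\<lambda>p. f p + g p) S"
proof -
  obtain a b where f: "\<And>p. p \<in> S \<Longrightarrow> (f has_derivative (\<lambda>x. a p * fst x + b p * snd x)) (at p)"
    using holomorphic2_onE[OF assms(1)] by blast
  obtain c d where g: "\<And>p. p \<in> S \<Longrightarrow> (g has_derivative (\<lambda>x. c p * fst x + d p * snd x)) (at p)"
    using holomorphic2_onE[OF assms(2)] by blast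
  show ?thesis
    by (rule holomorphic2_onI[where a = "\<lambda>p. a p + c p" and b = "\<lambda>p. b p + d p"],
        rule has_derivative_eq_rhs[OF has_derivative_add[OF f g]])
       (auto simp: algebra_simps)
qed

lemma holomorphic2_on_mult:
  assumes "holomorphic2_on f S" "holomorphic2_on g S"
  shows "holomorphic2_on (\<lambda>p. f p * g p) S"
proof -
  obtain a b where f: "\<And>p. p \<in> S \<Longrightarrow> (f has_derivative (\<lambda>x. a p * fst x + b p * snd x)) (at p)"
    using holomorphic2_onE[OF assms(1)] by blast
  obtain c d where g: "\<And>p. p \<in> S \<Longrightarrow> (g has_derivative (\<lambda>x. c p * fst x + d p * snd x)) (at p)"
    using holomorphic2_onE[OF assms(2)] by blast
  show ?thesis
    by (rule holomorphic2_onI[where a = "\<lambda>p. f p * c p + a p * g p" and b = "\<lambda>p. f p * d p + b p * g p"],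
        rule has_derivative_eq_rhs[OF has_derivative_mult[OF f g]])
       (auto simp: algebra_simps)
qed

lemma holomorphic2_on_inverse:
  assumes "holomorphic2_on f S" "\<And>p. p \<in> S \<Longrightarrow> f p \<noteq> 0"
  shows "holomorphic2_on (\<lambda>p. inverse (f p)) S"
proof -
  obtain a b where f: "\<And>p. p \<in> S \<Longrightarrow> (f has_derivative (\<lambda>x. a p * fst x + b p * snd x)) (at p)"
    using holomorphic2_onE[OF assms(1)] by blast
  show ?thesis
    by (rule holomorphic2_onI[where a = "\<lambda>p. - a p / (f p)\<^sup>2" and b = "\<lambda>p. - b p / (f p)\<^sup>2"],
        rule has_derivative_eq_rhs[OF Deriv.has_derivative_inverse[OF _ f]])
       (use assms(2) in \<open>auto simp: fun_eq_iff power2_eq_square field_simps\<close>)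
qed

lemma holomorphic2_on_divide:
  assumes "holomorphic2_on f S" "holomorphic2_on g S" "\<And>p. p \<in> S \<Longrightarrow> g p \<noteq> 0"
  shows "holomorphic2_on (\<lambda>p. f p / g p) S"
  unfolding divide_inverse by (intro holomorphic2_on_mult holomorphic2_on_inverse assms)

lemma holomorphic2_on_uminus: "holomorphic2_on f S \<Longrightarrow> holomorphic2_on (\<lambda>p. - f p) S"
  using holomorphic2_on_mult[OF holomorphic2_on_const[of "-1"]] by simp

lemma holomorphic2_on_diff:
  "holomorphic2_on f S \<Longrightarrow> holomorphic2_on g S \<Longrightarrow> holomorphic2_on (\<lambda>p. f p - g p) S"
  using holomorphic2_on_add[OF _ holomorphic2_on_uminus] by simp

lemma holomorphic2_on_cong_open:
  assumes "holomorphic2_on f S" "open S" "\<And>p. p \<in> S \<Longrightarrow> f p = g p"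
  shows "holomorphic2_on g S"
proof -
  obtain a b where f: "\<And>p. p \<in> S \<Longrightarrow> (f has_derivative (\<lambda>x. a p * fst x + b p * snd x)) (at p)"
    using holomorphic2_onE[OF assms(1)] by blast
  show ?thesis
    by (rule holomorphic2_onI) (rule has_derivative_transform_within_open[OF f assms(2) _ assms(3)])
qed

lemma holomorphic2_on_imp_continuous_on:
  assumes "holomorphic2_on f S"
  shows "continuous_on S f"
  using assms unfolding holomorphic2_on_def
  by (metis continuous_at_imp_continuous_on has_derivative_continuous)

lemma holomorphic2_on_compose:
  assumes G: "holomorphic2_on G S" and T: "open T"
    and f: "f holomorphic_on T" "g holomorphic_on T" and S: "\<And>x. x \<in> T \<Longrightarrow> (f x, g x) \<in> S"
  shows "(\<lambda>x. G (f x, g x)) holomorphic_on T"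
proof -
  have "\<exists>D. ((\<lambda>x. G (f x, g x)) has_field_derivative D) (at x)" if x: "x \<in> T" for x
  proof -
    obtain f' g' where "(f has_field_derivative f') (at x)" "(g has_field_derivative g') (at x)"
      using f x T by (metis holomorphic_on_open)
    then have "((\<lambda>x. (f x, g x)) has_derivative (\<lambda>h. (f' * h, g' * h))) (at x)"
      by (intro has_derivative_Pair) (simp_all add: has_field_derivative_def)
    moreover obtain a b where "(G has_derivative (\<lambda>y. a * fst y + b * snd y)) (at (f x, g x))"
      using G S[OF x] unfolding holomorphic2_on_def case_prod_unfold by blast
    ultimately have "((\<lambda>x. G (f x, g x)) has_derivative (\<lambda>h. a * (f' * h) + b * (g' * h))) (at x)"
      using has_derivative_compose[of "\<lambda>x. (f x, g x)" _ x UNIV G] by fastforce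
    moreover have "(\<lambda>h. a * (f' * h) + b * (g' * h)) = (*) (a * f' + b * g')"
      by (auto simp: algebra_simps)
    ultimately show ?thesis by (auto simp: has_field_derivative_def)
  qed
  then show ?thesis using T by (simp add: holomorphic_on_open)
qed

section \<open>Charts of the Riemann sphere\<close>

lemma chart_at_infinity_0 [simp]: "chart_at_infinity 0 = None"
  by (simp add: chart_at_infinity_def)

lemma open_preimage_reciprocal:
  assumes "open (U :: complex set)"
  shows "open {u. u \<noteq> 0 \<and> 1 / u \<in> U}"
proof -
  have "open ((- {0}) \<inter> (\<lambda>u. 1 / u) -` U)"
    by (rule continuous_open_preimage) (auto intro!: continuous_intros assms)
  then show ?thesis by (simp add: vimage_def Int_def)
qed

text \<open>
  A neighbourhood of infinity is the complement of a compact set, and \<open>1 / u\<close> leaves every compact set as \<open>u\<close>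
  tends to \<open>0\<close>.
\<close>

lemma open_preimage_chart_at_infinity:
  assumes "openin sphere_topology V"
  shows "open {u. chart_at_infinity u \<in> V}"
proof -
  consider U where "open U" "V = Some ` U" | C where "compact C" "V = insert None (Some ` (UNIV - C))"
    using assms by (auto simp: openin_Alexandroff_compactification)
  then show ?thesis
  proof cases
    case 1
    have "{u. chart_at_infinity u \<in> V} = {u. u \<noteq> 0 \<and> 1 / u \<in> U}"
      by (auto simp: 1 chart_at_infinity_def)
    then show ?thesis using open_preimage_reciprocal[OF 1(1)] by simp
  next
    case 2
    obtain M where M: "M > 0" "\<And>z. z \<in> C \<Longrightarrow> cmod z \<le> M"
      using compact_imp_bounded[OF 2(1)] by (auto simp: bounded_pos)
    have "{u. chart_at_infinity u \<in> V} = {u. u \<noteq> 0 \<and> 1 / u \<in> - C} \<union> ball 0 (1 / M)"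
    proof -
      have "1 / u \<notin> C" if "cmod u < 1 / M" "u \<noteq> 0" for u
      proof
        assume "1 / u \<in> C"
        then have "1 / cmod u \<le> M" using M(2) by (metis norm_divide norm_one)
        then show False using that M(1) by (simp add: field_simps)
      qed
      then show ?thesis using M(1) by (auto simp: 2 chart_at_infinity_def)
    qed
    moreover have "open (- C)" using 2(1) by (simp add: compact_imp_closed open_Compl)
    ultimately show ?thesis using open_preimage_reciprocal by (metis open_Un open_ball)
  qed
qed

lemma continuous_chart:
  assumes "\<phi> \<in> sphere_charts"
  shows "continuous_map euclidean sphere_topology \<phi>"
proof -
  have "continuous_map euclidean sphere_topology chart_at_infinity"
    unfolding continuous_map_def
    using open_preimage_chart_at_infinity by (auto simp: chart_at_infinity_def)
  then show ?thesis using assms continuous_map_Some by (auto simp: sphere_charts_def)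
qed

lemma open_chart:
  assumes "\<phi> \<in> sphere_charts" "open U"
  shows "openin sphere_topology (\<phi> ` U)"
proof (cases "\<phi> = Some")
  case True
  then show ?thesis using assms(2) by simp
next
  case False
  then have \<phi>: "\<phi> = chart_at_infinity" using assms by (auto simp: sphere_charts_def)
  have img: "chart_at_infinity ` (U - {0}) = Some ` {z. z \<noteq> 0 \<and> 1 / z \<in> U}"
  proof (intro set_eqI iffI)
    fix y assume "y \<in> Some ` {z. z \<noteq> 0 \<and> 1 / z \<in> U}"
    then obtain z where z: "y = Some z" "z \<noteq> 0" "1 / z \<in> U" by auto
    then show "y \<in> chart_at_infinity ` (U - {0})"
      by (intro image_eqI[of _ _ "1 / z"]) (auto simp: chart_at_infinity_def)
  qed (auto simp: chart_at_infinity_def)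
  show ?thesis
  proof (cases "0 \<in> U")
    case True
    then obtain e where e: "e > 0" "ball 0 e \<subseteq> U" using assms(2) open_contains_ball by blast
    define C where "C = - {z. z \<noteq> 0 \<and> 1 / z \<in> U}"
    have "closed C" unfolding C_def closed_def by (simp add: open_preimage_reciprocal assms(2))
    moreover have "C \<subseteq> cball 0 (1 / e)"
    proof
      fix z assume "z \<in> C"
      then have "z = 0 \<or> 1 / z \<notin> ball 0 e" using e by (auto simp: C_def)
      then show "z \<in> cball 0 (1 / e)"
        using e(1) by (cases "z = 0") (auto simp: norm_divide not_less pos_le_divide_eq mult.commute)
    qed
    ultimately have "compact C" by (meson bounded_cball bounded_subset compact_eq_bounded_closed)
    have "U = insert 0 (U - {0})" using True by auto
    then have "\<phi> ` U = insert None (chart_at_infinity ` (U - {0}))"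
      unfolding \<phi> by (metis chart_at_infinity_0 image_insert)
    also have "\<dots> = insert None (Some ` (UNIV - C))" unfolding img C_def by auto
    finally show ?thesis
      using \<open>compact C\<close> \<open>closed C\<close> by (auto simp: openin_Alexandroff_compactification)
  next
    case False
    then have "\<phi> ` U = Some ` {z. z \<noteq> 0 \<and> 1 / z \<in> U}" using img \<phi> by simp
    then show ?thesis using open_preimage_reciprocal[OF assms(2)] by simp
  qed
qed

lemma chart_cases: obtains \<phi> u where "\<phi> \<in> sphere_charts" "x = \<phi> u"
  by (cases x) (auto simp: sphere_charts_def intro: that[of chart_at_infinity 0])

lemma Some_Some_in_Omega [simp]: "(Some z, Some w) \<in> Omega \<longleftrightarrow> z * w \<noteq> 1"
  by (simp add: Omega_def)

lemma Some_chart_in_Omega [simp]: "(Some z, chart_at_infinity v) \<in> Omega \<longleftrightarrow> z \<noteq> v"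
  by (auto simp: Omega_def chart_at_infinity_def)

lemma chart_Some_in_Omega [simp]: "(chart_at_infinity u, Some w) \<in> Omega \<longleftrightarrow> u \<noteq> w"
  by (auto simp: Omega_def chart_at_infinity_def)

lemma chart_chart_in_Omega [simp]:
  "(chart_at_infinity u, chart_at_infinity v) \<in> Omega \<longleftrightarrow> u * v \<noteq> 1"
  by (auto simp: Omega_def chart_at_infinity_def)

section \<open>The function space H(Omega)\<close>

lemma isCont_holomorphic2: "holomorphic2_on f S \<Longrightarrow> p \<in> S \<Longrightarrow> isCont f p"
  unfolding holomorphic2_on_def using has_derivative_continuous by blast

lemma open_Omega_chart:
  assumes "\<phi> \<in> sphere_charts" "\<psi> \<in> sphere_charts"
  shows "open {(u, v). (\<phi> u, \<psi> v) \<in> Omega}"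
proof -
  have *: "open {p :: complex \<times> complex. fst p * snd p \<noteq> 1}" "open {p :: complex \<times> complex. fst p \<noteq> snd p}"
    by (intro open_Collect_neq continuous_intros)+
  then show ?thesis using assms
    by (auto simp: sphere_charts_def case_prod_unfold)
qed

lemma holomorphic_on_OmegaI:
  assumes "\<And>\<phi> \<psi>. \<phi> \<in> sphere_charts \<Longrightarrow> \<psi> \<in> sphere_charts \<Longrightarrow>
    holomorphic2_on (\<lambda>p. F (\<phi> (fst p), \<psi> (snd p))) {(u, v). (\<phi> u, \<psi> v) \<in> Omega}"
  shows "holomorphic_on_Omega F"
  using assms by (simp add: holomorphic_on_Omega_def case_prod_unfold)

lemma holomorphic_on_OmegaD:
  assumes "holomorphic_on_Omega F" "\<phi> \<in> sphere_charts" "\<psi> \<in> sphere_charts"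
  shows "holomorphic2_on (\<lambda>p. F (\<phi> (fst p), \<psi> (snd p))) {(u, v). (\<phi> u, \<psi> v) \<in> Omega}"
  using assms by (simp add: holomorphic_on_Omega_def case_prod_unfold)

lemma holomorphic_on_Omega_const: "holomorphic_on_Omega (\<lambda>_. c)"
  by (intro holomorphic_on_OmegaI holomorphic2_on_const)

lemma holomorphic_on_Omega_add:
  assumes "holomorphic_on_Omega F" "holomorphic_on_Omega G"
  shows "holomorphic_on_Omega (\<lambda>p. F p + G p)"
proof (rule holomorphic_on_OmegaI)
  fix \<phi> \<psi> assume *: "\<phi> \<in> sphere_charts" "\<psi> \<in> sphere_charts"
  show "holomorphic2_on (\<lambda>p. F (\<phi> (fst p), \<psi> (snd p)) + G (\<phi> (fst p), \<psi> (snd p)))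
      {(u, v). (\<phi> u, \<psi> v) \<in> Omega}"
    by (rule holomorphic2_on_add[OF holomorphic_on_OmegaD[OF assms(1) *] holomorphic_on_OmegaD[OF assms(2) *]])
qed

lemma holomorphic_on_Omega_mult:
  assumes "holomorphic_on_Omega F" "holomorphic_on_Omega G"
  shows "holomorphic_on_Omega (\<lambda>p. F p * G p)"
proof (rule holomorphic_on_OmegaI)
  fix \<phi> \<psi> assume *: "\<phi> \<in> sphere_charts" "\<psi> \<in> sphere_charts"
  show "holomorphic2_on (\<lambda>p. F (\<phi> (fst p), \<psi> (snd p)) * G (\<phi> (fst p), \<psi> (snd p)))
      {(u, v). (\<phi> u, \<psi> v) \<in> Omega}"
    by (rule holomorphic2_on_mult[OF holomorphic_on_OmegaD[OF assms(1) *] holomorphic_on_OmegaD[OF assms(2) *]])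
qed

lemma holomorphic_on_Omega_power:
  "holomorphic_on_Omega F \<Longrightarrow> holomorphic_on_Omega (\<lambda>p. F p ^ n)"
  by (induction n) (simp_all add: holomorphic_on_Omega_const holomorphic_on_Omega_mult)

lemma holomorphic_on_Omega_sum:
  "(\<And>i. i \<in> I \<Longrightarrow> holomorphic_on_Omega (F i)) \<Longrightarrow> holomorphic_on_Omega (\<lambda>p. \<Sum>i\<in>I. F i p)"
  by (induction I rule: infinite_finite_induct)
     (simp_all add: holomorphic_on_Omega_const holomorphic_on_Omega_add)

lemma H_Omega_cutoff:
  assumes "holomorphic_on_Omega F"
  shows "(\<lambda>p. if p \<in> Omega then F p else 0) \<in> H_Omega"
proof -
  have "holomorphic_on_Omega (\<lambda>p. if p \<in> Omega then F p else 0)"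
  proof (rule holomorphic_on_OmegaI)
    fix \<phi> \<psi> assume *: "\<phi> \<in> sphere_charts" "\<psi> \<in> sphere_charts"
    show "holomorphic2_on (\<lambda>p. if (\<phi> (fst p), \<psi> (snd p)) \<in> Omega then F (\<phi> (fst p), \<psi> (snd p)) else 0)
      {(u, v). (\<phi> u, \<psi> v) \<in> Omega}"
      by (rule holomorphic2_on_cong_open[OF holomorphic_on_OmegaD[OF assms *] open_Omega_chart[OF *]]) auto
  qed
  then show ?thesis by (simp add: H_Omega_def)
qed

lemma H_Omega_holomorphic: "F \<in> H_Omega \<Longrightarrow> holomorphic_on_Omega F"
  by (simp add: H_Omega_def)

lemma H_Omega_sum:
  "(\<And>i. i \<in> I \<Longrightarrow> F i \<in> H_Omega) \<Longrightarrow> (\<lambda>p. \<Sum>i\<in>I. c i * F i p) \<in> H_Omega"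
  unfolding H_Omega_def
  by (simp add: holomorphic_on_Omega_sum holomorphic_on_Omega_mult holomorphic_on_Omega_const)

lemma H_Omega_diff:
  assumes "F \<in> H_Omega" "G \<in> H_Omega"
  shows "(\<lambda>p. F p - G p) \<in> H_Omega"
  using H_Omega_sum[of "{0, 1::nat}" "\<lambda>i. if i = 0 then F else G" "\<lambda>i. if i = 0 then 1 else -1"] assms
  by simp

lemma H_Omega_swap:
  assumes "F \<in> H_Omega"
  shows "(\<lambda>p. F (prod.swap p)) \<in> H_Omega"
proof -
  have sw: "prod.swap p \<in> Omega \<longleftrightarrow> p \<in> Omega" for p
    by (cases p; cases "fst p"; cases "snd p") (auto simp: Omega_def mult.commute)
  have "holomorphic_on_Omega (\<lambda>p. F (prod.swap p))"
  proof (rule holomorphic_on_OmegaI)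
    fix \<phi> \<psi> assume *: "\<phi> \<in> sphere_charts" "\<psi> \<in> sphere_charts"
    obtain a b where F: "\<And>p. p \<in> {(u, v). (\<psi> u, \<phi> v) \<in> Omega} \<Longrightarrow>
        ((\<lambda>p. F (\<psi> (fst p), \<phi> (snd p))) has_derivative (\<lambda>x. a p * fst x + b p * snd x)) (at p)"
      using holomorphic2_onE[OF holomorphic_on_OmegaD[OF H_Omega_holomorphic[OF assms] *(2,1)]] by blast
    show "holomorphic2_on (\<lambda>p. F (prod.swap (\<phi> (fst p), \<psi> (snd p)))) {(u, v). (\<phi> u, \<psi> v) \<in> Omega}"
    proof (rule holomorphic2_onI[where a = "\<lambda>p. b (prod.swap p)" and b = "\<lambda>p. a (prod.swap p)"])
      fix p assume "p \<in> {(u, v). (\<phi> u, \<psi> v) \<in> Omega}"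
      then have "prod.swap p \<in> {(u, v). (\<psi> u, \<phi> v) \<in> Omega}"
        using sw[of "(\<phi> (fst p), \<psi> (snd p))"] by (auto simp: case_prod_unfold)
      from F[OF this] have "((\<lambda>p. F (\<psi> (fst p), \<phi> (snd p))) has_derivative
          (\<lambda>x. a (prod.swap p) * fst x + b (prod.swap p) * snd x)) (at (prod.swap p))" .
      moreover have "(prod.swap has_derivative (\<lambda>x. (snd x, fst x))) (at p)"
        unfolding prod.swap_def by (auto intro!: derivative_eq_intros)
      ultimately have "((\<lambda>p. F (\<psi> (fst (prod.swap p)), \<phi> (snd (prod.swap p)))) has_derivative
          (\<lambda>x. a (prod.swap p) * snd x + b (prod.swap p) * fst x)) (at p)"
        using has_derivative_compose[of prod.swap "\<lambda>x. (snd x, fst x)" p UNIV] by fastforce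
      then show "((\<lambda>p. F (prod.swap (\<phi> (fst p), \<psi> (snd p)))) has_derivative
          (\<lambda>x. b (prod.swap p) * fst x + a (prod.swap p) * snd x)) (at p)"
        by (simp add: add.commute)
    qed
  qed
  moreover have "F (prod.swap p) = 0" if "p \<notin> Omega" for p
    using assms that sw[of p] unfolding H_Omega_def by blast
  ultimately show ?thesis unfolding H_Omega_def by blast
qed

text \<open>
  Charts are continuous and open, so continuity in the charts is continuity for the product topology of
  the two spheres.
\<close>

lemma continuous_map_H_Omega:
  assumes "F \<in> H_Omega"
  shows "continuous_map (subtopology sphere2_topology Omega) euclidean F"
proof -
  have "openin (subtopology sphere2_topology Omega) {p \<in> Omega. F p \<in> V}" if "open V" for V
  proof (subst openin_subopen, intro ballI)
    fix p assume p: "p \<in> {p \<in> Omega. F p \<in> V}"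
    obtain \<phi> u where \<phi>: "\<phi> \<in> sphere_charts" "fst p = \<phi> u" by (rule chart_cases)
    obtain \<psi> v where \<psi>: "\<psi> \<in> sphere_charts" "snd p = \<psi> v" by (rule chart_cases)
    let ?D = "{(u, v). (\<phi> u, \<psi> v) \<in> Omega}" and ?G = "\<lambda>p. F (\<phi> (fst p), \<psi> (snd p))"
    have "continuous_on ?D ?G"
      by (rule holomorphic2_on_imp_continuous_on[OF holomorphic_on_OmegaD[OF H_Omega_holomorphic[OF assms] \<phi>(1) \<psi>(1)]])
    then have "open (?D \<inter> ?G -` V)"
      by (rule continuous_open_preimage) (intro open_Omega_chart \<phi> \<psi>, fact)
    moreover have "(u, v) \<in> ?D \<inter> ?G -` V" using p \<phi>(2) \<psi>(2) by (cases p) auto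
    ultimately obtain U1 U2 where U: "open U1" "open U2" "(u, v) \<in> U1 \<times> U2" "U1 \<times> U2 \<subseteq> ?D \<inter> ?G -` V"
      by (rule open_prod_elim)
    have "openin sphere2_topology (\<phi> ` U1 \<times> \<psi> ` U2)"
      using open_chart \<phi> \<psi> U by (simp add: openin_prod_Times_iff)
    then have "openin (subtopology sphere2_topology Omega) ((\<phi> ` U1 \<times> \<psi> ` U2) \<inter> Omega)"
      by (auto simp: openin_subtopology)
    moreover have "p \<in> (\<phi> ` U1 \<times> \<psi> ` U2) \<inter> Omega"
      using p \<phi> \<psi> U(3) by (cases p) auto
    moreover have "(\<phi> ` U1 \<times> \<psi> ` U2) \<inter> Omega \<subseteq> {p \<in> Omega. F p \<in> V}"
      using U(4) by auto
    ultimately show "\<exists>T. openin (subtopology sphere2_topology Omega) T \<and> p \<in> T \<and> T \<subseteq> {p \<in> Omega. F p \<in> V}"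
      by blast
  qed
  moreover have "topspace (subtopology sphere2_topology Omega) = Omega"
    using UNIV_option_conv by (auto simp: topspace_subtopology)
  ultimately show ?thesis unfolding continuous_map_def by simp
qed

lemma compact_in_Omega_subset: "compact_in_Omega K \<Longrightarrow> K \<subseteq> Omega"
  by (auto dest!: compactin_subset_topspace)

lemma H_Omega_bounded_on_compact:
  assumes "F \<in> H_Omega" "compact_in_Omega K"
  obtains M where "M > 0" "\<And>p. p \<in> K \<Longrightarrow> cmod (F p) \<le> M"
proof -
  have "compactin euclidean (F ` K)"
    by (rule image_compactin[OF assms(2) continuous_map_H_Omega[OF assms(1)]])
  then have "bounded (F ` K)" by (simp add: compact_imp_bounded)
  then show ?thesis using that by (auto simp: bounded_pos)
qed

text \<open>
  The finite points of \<open>\<Omega>\<close> are dense: in the chart of a point at infinity, the vanishing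
  coordinates of infinite entries are replaced by \<open>1 / (k + 1)\<close>. This is why the holomorphic extension of the formula for a Poisson mode is unique.
\<close>

lemma H_Omega_eqI:
  assumes "F \<in> H_Omega" "G \<in> H_Omega"
    and eq: "\<And>z w. (Some z, Some w) \<in> Omega \<Longrightarrow> F (Some z, Some w) = G (Some z, Some w)"
  shows "F = G"
proof
  fix p
  define D where "D p = F p - G p" for p
  have D: "D \<in> H_Omega" unfolding D_def by (intro H_Omega_diff assms)
  have fin: "D (Some z, Some w) = 0" for z w
    using eq D by (cases "(Some z, Some w) \<in> Omega") (auto simp: D_def H_Omega_def)
  have "D p = 0"
  proof (cases "p \<in> Omega")
    case True
    define \<phi> where "\<phi> x = (if x = None then chart_at_infinity else Some)" for x :: riemann_sphere
    define u where "u x = (case x of None \<Rightarrow> 0 | Some z \<Rightarrow> z)" for x :: riemann_sphere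
    define t where "t x n = u x + (if x = None then of_real (1 / real (Suc n)) else 0)" for x :: riemann_sphere and n
    have \<phi>: "\<phi> x \<in> sphere_charts" "\<phi> x (u x) = x" for x
      by (auto simp: \<phi>_def u_def sphere_charts_def split: option.splits)
    have lim: "(\<lambda>n. t x n) \<longlonglongrightarrow> u x" for x
    proof (cases "x = None")
      case True
      have "(\<lambda>n. u x + of_real (1 / real (Suc n))) \<longlonglongrightarrow> u x + of_real 0"
        by (intro tendsto_intros LIMSEQ_Suc[OF lim_1_over_n])
      then show ?thesis using True by (simp add: t_def)
    next
      case False
      then have "t x = (\<lambda>_. u x)" by (auto simp: t_def)
      then show ?thesis by simp
    qed
    have nz: "t x n \<noteq> 0" if "x = None" for x n
      using that by (simp add: t_def u_def del: of_nat_Suc)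
    have some: "\<exists>z. \<phi> x (t x n) = Some z" for x n
      using nz[of x n] by (auto simp: \<phi>_def chart_at_infinity_def)
    let ?G = "\<lambda>q. D (\<phi> (fst p) (fst q), \<phi> (snd p) (snd q))"
    have "isCont ?G (u (fst p), u (snd p))"
      by (rule isCont_holomorphic2[OF holomorphic_on_OmegaD[OF H_Omega_holomorphic[OF D] \<phi>(1) \<phi>(1)]])
         (simp add: \<phi>(2) True)
    then have "(\<lambda>n. ?G (t (fst p) n, t (snd p) n)) \<longlonglongrightarrow> ?G (u (fst p), u (snd p))"
      by (rule isCont_tendsto_compose) (intro tendsto_Pair lim)
    moreover have zero: "?G (t (fst p) n, t (snd p) n) = 0" for n
    proof -
      obtain z w where "\<phi> (fst p) (t (fst p) n) = Some z" "\<phi> (snd p) (t (snd p) n) = Some w"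
        using some by blast
      then show ?thesis using fin by (simp only: fst_conv snd_conv)
    qed
    ultimately have "(\<lambda>n::nat. 0) \<longlonglongrightarrow> ?G (u (fst p), u (snd p))"
      by (simp only: zero)
    then have "?G (u (fst p), u (snd p)) = 0" by (simp only: LIMSEQ_const_iff)
    then show ?thesis by (simp only: \<phi>(2) fst_conv snd_conv prod.collapse)
  next
    case False
    then show ?thesis using D unfolding H_Omega_def by blast
  qed
  then show "F p = G p" by (simp add: D_def)
qed

section \<open>Global coordinates on Omega\<close>

text \<open>
  The functions \<open>A = 1 / (1 - z w)\<close>, \<open>B = w / (1 - z w)\<close> and \<open>C = z / (1 - z w)\<close> extend holomorphically to all of \<open>\<Omega>\<close> and
  identify it with the affine quadric \<open>B C = A (A - 1)\<close>. Since division by zero yields zero, the formulas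
  below vanish outside \<open>\<Omega>\<close>, which makes them elements of \<open>H_Omega\<close> without a case distinction.
\<close>

fun coord_A :: "riemann_sphere \<times> riemann_sphere \<Rightarrow> complex" where
  "coord_A (Some z, Some w) = 1 / (1 - z * w)"
| "coord_A (Some z, None) = 0"
| "coord_A (None, w) = 0"

fun coord_B :: "riemann_sphere \<times> riemann_sphere \<Rightarrow> complex" where
  "coord_B (Some z, Some w) = w / (1 - z * w)"
| "coord_B (Some z, None) = - 1 / z"
| "coord_B (None, w) = 0"

definition coord_C :: "riemann_sphere \<times> riemann_sphere \<Rightarrow> complex" where
  "coord_C p = coord_B (prod.swap p)"

lemma coord_A_charts [simp]:
  "coord_A (Some u, chart_at_infinity v) = v / (v - u)"
  "coord_A (chart_at_infinity u, Some w) = u / (u - w)"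
  "coord_A (chart_at_infinity u, chart_at_infinity v) = u * v / (u * v - 1)"
  by (auto simp: chart_at_infinity_def divide_simps)

lemma coord_B_charts [simp]:
  "coord_B (Some u, chart_at_infinity v) = 1 / (v - u)"
  "coord_B (chart_at_infinity u, Some w) = u * w / (u - w)"
  "coord_B (chart_at_infinity u, chart_at_infinity v) = u / (u * v - 1)"
  by (auto simp: chart_at_infinity_def divide_simps)

lemmas holomorphic2_intros =
  holomorphic2_on_divide holomorphic2_on_diff holomorphic2_on_mult holomorphic2_on_const
  holomorphic2_on_fst holomorphic2_on_snd

lemma holomorphic_coord_A: "holomorphic_on_Omega coord_A"
proof (rule holomorphic_on_OmegaI)
  fix \<phi> \<psi> assume "\<phi> \<in> sphere_charts" "\<psi> \<in> sphere_charts"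
  then consider "\<phi> = Some" "\<psi> = Some" | "\<phi> = Some" "\<psi> = chart_at_infinity"
    | "\<phi> = chart_at_infinity" "\<psi> = Some" | "\<phi> = chart_at_infinity" "\<psi> = chart_at_infinity"
    by (auto simp: sphere_charts_def)
  then show "holomorphic2_on (\<lambda>p. coord_A (\<phi> (fst p), \<psi> (snd p))) {(u, v). (\<phi> u, \<psi> v) \<in> Omega}"
    by (cases; simp only: coord_A.simps(1) coord_A_charts; intro holomorphic2_intros; force)
qed

lemma holomorphic_coord_B: "holomorphic_on_Omega coord_B"
proof (rule holomorphic_on_OmegaI)
  fix \<phi> \<psi> assume "\<phi> \<in> sphere_charts" "\<psi> \<in> sphere_charts"
  then consider "\<phi> = Some" "\<psi> = Some" | "\<phi> = Some" "\<psi> = chart_at_infinity"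
    | "\<phi> = chart_at_infinity" "\<psi> = Some" | "\<phi> = chart_at_infinity" "\<psi> = chart_at_infinity"
    by (auto simp: sphere_charts_def)
  then show "holomorphic2_on (\<lambda>p. coord_B (\<phi> (fst p), \<psi> (snd p))) {(u, v). (\<phi> u, \<psi> v) \<in> Omega}"
    by (cases; simp only: coord_B.simps(1) coord_B_charts; intro holomorphic2_intros; force)
qed

lemma coord_H_Omega: "coord_A \<in> H_Omega" "coord_B \<in> H_Omega" "coord_C \<in> H_Omega"
proof -
  have "coord_A p = 0 \<and> coord_B p = 0" if "p \<notin> Omega" for p
    using that by (cases p rule: coord_A.cases) (simp_all add: Omega_def split: if_splits)
  then show A: "coord_A \<in> H_Omega" and B: "coord_B \<in> H_Omega"
    using holomorphic_coord_A holomorphic_coord_B by (auto simp: H_Omega_def)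
  show "coord_C \<in> H_Omega" using H_Omega_swap[OF B] by (simp add: coord_C_def[abs_def])
qed

lemma coord_A_swap: "coord_A (prod.swap p) = coord_A p"
  by (cases p; cases "fst p"; cases "snd p") (auto simp: mult.commute)

lemma coord_B_mult_coord_C:
  assumes "p \<in> Omega"
  shows "coord_B p * coord_C p = coord_A p * (coord_A p - 1)"
  using assms by (cases p; cases "fst p"; cases "snd p") (auto simp: coord_C_def field_simps)

text \<open>
  The point of the quadric with coordinates \<open>A = \<alpha>\<close> and \<open>B = \<beta> \<noteq> 0\<close>. For fixed \<open>\<alpha>\<close> it moves along an orbit of
  \<open>(z, w) \<mapsto> (z / \<lambda>, \<lambda> w)\<close>. The points with \<open>C \<noteq> 0\<close> are obtained by exchanging the two factors.
\<close>

definition orbit_point :: "complex \<Rightarrow> complex \<Rightarrow> riemann_sphere \<times> riemann_sphere" where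
  "orbit_point \<alpha> \<beta> = (Some ((\<alpha> - 1) / \<beta>), chart_at_infinity (\<alpha> / \<beta>))"

lemma orbit_point_coords:
  assumes "p \<in> Omega" "coord_B p \<noteq> 0"
  shows "orbit_point (coord_A p) (coord_B p) = p"
  using assms
  by (cases p; cases "fst p"; cases "snd p")
     (auto simp: orbit_point_def chart_at_infinity_def field_simps)

lemma orbit_point_in_Omega: "\<beta> \<noteq> 0 \<Longrightarrow> orbit_point \<alpha> \<beta> \<in> Omega"
  by (simp add: orbit_point_def field_simps)

lemma orbit_point_inverse:
  assumes "\<alpha> \<noteq> 0" "\<alpha> \<noteq> 1" "\<beta> \<noteq> 0"
  shows "prod.swap (orbit_point \<alpha> (\<alpha> * (\<alpha> - 1) / \<beta>)) = orbit_point \<alpha> \<beta>"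
  using assms by (simp add: orbit_point_def chart_at_infinity_def field_simps)

lemma laurent_family_H_Omega:
  assumes "F \<in> H_Omega"
  shows "laurent_family (\<lambda>\<alpha> \<beta>. F (orbit_point \<alpha> \<beta>))"
proof
  let ?D = "{(u, v). (Some u, chart_at_infinity v) \<in> Omega}"
  let ?G = "\<lambda>p. F (Some (fst p), chart_at_infinity (snd p))"
  have G: "holomorphic2_on ?G ?D"
    by (rule holomorphic_on_OmegaD[OF H_Omega_holomorphic[OF assms]]) (auto simp: sphere_charts_def)
  have D: "((\<alpha> - 1) / \<beta>, \<alpha> / \<beta>) \<in> ?D" if "\<beta> \<noteq> 0" for \<alpha> \<beta>
    using orbit_point_in_Omega[OF that] by (simp add: orbit_point_def)
  have "continuous_on (UNIV \<times> - {0}) (\<lambda>x. ?G ((fst x - 1) / snd x, fst x / snd x))"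
    by (rule continuous_on_compose2[OF holomorphic2_on_imp_continuous_on[OF G]])
       (use D in \<open>auto intro!: continuous_intros\<close>)
  then show "continuous_on (UNIV \<times> - {0}) (\<lambda>(\<alpha>, \<beta>). F (orbit_point \<alpha> \<beta>))"
    by (simp add: orbit_point_def case_prod_unfold)
  show "(\<lambda>\<alpha>. F (orbit_point \<alpha> \<beta>)) holomorphic_on UNIV" if "\<beta> \<noteq> 0" for \<beta>
  proof -
    have "(\<lambda>\<alpha>. ?G ((\<alpha> - 1) / \<beta>, \<alpha> / \<beta>)) holomorphic_on UNIV"
      by (rule holomorphic2_on_compose[OF G open_UNIV])
         (use that D in \<open>auto intro!: holomorphic_intros\<close>)
    then show ?thesis by (simp add: orbit_point_def)
  qed
  show "(\<lambda>\<beta>. F (orbit_point \<alpha> \<beta>)) holomorphic_on - {0}" for \<alpha>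
  proof -
    have "(\<lambda>\<beta>. ?G ((\<alpha> - 1) / \<beta>, \<alpha> / \<beta>)) holomorphic_on - {0}"
      by (rule holomorphic2_on_compose[OF G]) (use D in \<open>auto intro!: holomorphic_intros\<close>)
    then show ?thesis by (simp add: orbit_point_def)
  qed
qed

section \<open>The Poisson modes in global coordinates\<close>

lemma pochhammer_minus_nat:
  "pochhammer (- of_nat m) k = ((-1) ^ k * fact k * of_nat (m choose k) :: complex)"
proof -
  have "(of_nat (m choose k) :: complex) = (-1) ^ k * pochhammer (- of_nat m) k / fact k"
    unfolding binomial_gbinomial gbinomial_pochhammer ..
  then have "(-1) ^ k * fact k * of_nat (m choose k) = ((-1) ^ k * (-1) ^ k) * pochhammer (- of_nat m :: complex) k"
    by simp
  then show ?thesis by (simp flip: power_mult_distrib)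
qed

lemma fact_mult_pochhammer: "fact l * pochhammer (of_nat l + 1) k = (fact (l + k) :: complex)"
proof (induction k)
  case (Suc k)
  have "fact l * pochhammer (of_nat l + 1 :: complex) (Suc k) =
      (fact l * pochhammer (of_nat l + 1) k) * (of_nat l + 1 + of_nat k)"
    by (simp add: pochhammer_Suc)
  also have "\<dots> = fact (l + Suc k)" unfolding Suc.IH by (simp add: mult.commute)
  finally show ?case .
qed simp

lemma binomial_hypergeometric:
  assumes "l \<le> m"
  shows "of_nat (m choose l) * hypergeometric_2F1 (- of_nat m) (of_nat l - of_nat m) (of_nat l + 1) t =
    (\<Sum>k\<le>m - l. of_nat ((m choose k) * (m choose (l + k))) * t ^ k)"
proof -
  let ?u = "\<lambda>k. pochhammer (- of_nat m) k * pochhammer (of_nat l - of_nat m) k / pochhammer (of_nat l + 1) k *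
    (t ^ k / fact k)"
  have b: "of_nat l - of_nat m = (- of_nat (m - l) :: complex)" using assms by simp
  have "hypergeometric_2F1 (- of_nat m) (of_nat l - of_nat m) (of_nat l + 1) t = (\<Sum>k\<le>m - l. ?u k)"
    unfolding hypergeometric_2F1_def
    by (rule suminf_finite) (auto simp: b pochhammer_minus_nat)
  then have "of_nat (m choose l) * hypergeometric_2F1 (- of_nat m) (of_nat l - of_nat m) (of_nat l + 1) t =
      (\<Sum>k\<le>m - l. of_nat (m choose l) * ?u k)" by (simp add: sum_distrib_left)
  also have "\<dots> = (\<Sum>k\<le>m - l. of_nat ((m choose k) * (m choose (l + k))) * t ^ k)"
  proof (rule sum.cong[OF refl])
    fix k assume "k \<in> {..m - l}"
    then have k: "k \<le> m - l" "l + k \<le> m" "k \<le> m" using assms by auto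
    have po: "pochhammer (of_nat l + 1) k = (fact (l + k) / fact l :: complex)"
      using fact_mult_pochhammer[of l k] by (simp add: field_simps)
    have "of_nat (m choose l) * of_nat ((m - l) choose k) * (fact k * fact l) =
        (fact (l + k) * of_nat (m choose (l + k)) :: complex)"
    proof -
      have "m - (l + k) = m - l - k" by simp
      then show ?thesis using k assms by (simp add: binomial_fact)
    qed
    then have c: "of_nat (m choose l) * (fact k * of_nat ((m - l) choose k)) * fact l / fact (l + k) =
        (of_nat (m choose (l + k)) :: complex)"
      by (simp add: field_simps)
    have "of_nat (m choose l) * ?u k = of_nat (m choose k) * ((-1) ^ k * (-1) ^ k) *
        (of_nat (m choose l) * (fact k * of_nat ((m - l) choose k)) * fact l / fact (l + k)) * t ^ k"
      unfolding b pochhammer_minus_nat po by simp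
    also have "\<dots> = of_nat ((m choose k) * (m choose (l + k))) * t ^ k"
      unfolding c by (simp flip: power_mult_distrib)
    finally show "of_nat (m choose l) * ?u k = of_nat ((m choose k) * (m choose (l + k))) * t ^ k" .
  qed
  finally show ?thesis .
qed

text \<open>
  The factor of a Poisson mode that carries its weight under the action of the punctured plane.
\<close>

definition mode_base :: "int \<Rightarrow> riemann_sphere \<times> riemann_sphere \<Rightarrow> complex" where
  "mode_base n p = (if n \<ge> 0 then coord_B p ^ nat n else coord_C p ^ nat (- n))"

text \<open>
  The holomorphic extension of the Poisson mode to \<open>\<Omega>\<close>. It is a polynomial in the coordinates \<open>A\<close>, \<open>B\<close>, \<open>C\<close>, because
  \<open>A - 1 = z w / (1 - z w)\<close> turns the hypergeometric sum into a homogeneous polynomial in \<open>A\<close> and \<open>A - 1\<close>.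
\<close>

definition jacobi_mode :: "int \<Rightarrow> nat \<Rightarrow> riemann_sphere \<times> riemann_sphere \<Rightarrow> complex" where
  "jacobi_mode n m p = (if p \<in> Omega then
     (-1) ^ nat \<bar>n\<bar> * mode_base n p * poly (jacobi (nat \<bar>n\<bar>) (m - nat \<bar>n\<bar>)) (coord_A p) else 0)"

lemma holomorphic_on_Omega_mode_base: "holomorphic_on_Omega (mode_base n)"
  using coord_H_Omega[THEN H_Omega_holomorphic]
  by (cases "n \<ge> 0") (simp_all add: mode_base_def[abs_def] holomorphic_on_Omega_power)

lemma holomorphic_on_Omega_poly: "holomorphic_on_Omega (\<lambda>p. poly q (coord_A p))"
  unfolding poly_altdef
  by (simp add: holomorphic_on_Omega_sum holomorphic_on_Omega_mult holomorphic_on_Omega_const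
      holomorphic_on_Omega_power coord_H_Omega[THEN H_Omega_holomorphic])

lemma jacobi_mode_in_H_Omega: "jacobi_mode n m \<in> H_Omega"
  unfolding jacobi_mode_def[abs_def]
  by (rule H_Omega_cutoff)
     (simp add: holomorphic_on_Omega_mult holomorphic_on_Omega_const holomorphic_on_Omega_mode_base
       holomorphic_on_Omega_poly)

lemma poisson_formula_eq_jacobi_mode:
  assumes "\<bar>n\<bar> \<le> int m" "(Some z, Some w) \<in> Omega"
  shows "jacobi_mode n m (Some z, Some w) = poisson_formula n m z w"
proof -
  define l where "l = nat \<bar>n\<bar>"
  define s where "s = (if n \<ge> 0 then w else z)"
  define x where "x = 1 / (1 - z * w)"
  have l: "l \<le> m" "l + (m - l) = m" "of_int \<bar>n\<bar> = (of_nat l :: complex)" using assms(1) by (auto simp: l_def)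
  have zw: "1 - z * w \<noteq> 0" using assms(2) by simp
  have x1: "x - 1 = z * w * x" using zw by (simp add: x_def field_simps)
  have base: "mode_base n (Some z, Some w) = s ^ l * x ^ l"
    by (auto simp: mode_base_def s_def l_def x_def coord_C_def power_divide mult.commute[of w z])
  have "poly (jacobi l (m - l)) x =
      (\<Sum>i\<le>m - l. of_nat ((m choose i) * (m choose (l + i))) * (z * w) ^ i * x ^ (m - l))"
    unfolding poly_jacobi l(2)
  proof (rule sum.cong[OF refl])
    fix i assume "i \<in> {..m - l}"
    then have "i + (m - l - i) = m - l" by simp
    then have "x ^ i * x ^ (m - l - i) = x ^ (m - l)" by (simp only: power_add[symmetric])
    then have "(x - 1) ^ i * x ^ (m - l - i) = (z * w) ^ i * x ^ (m - l)"
      unfolding x1 power_mult_distrib[of "z * w"] by (simp add: mult.assoc)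
    then show "of_nat ((m choose i) * (m choose (l + i))) * ((x - 1) ^ i * x ^ (m - l - i)) =
        of_nat ((m choose i) * (m choose (l + i))) * (z * w) ^ i * x ^ (m - l)"
      by (simp only: mult.assoc)
  qed
  also have "\<dots> = of_nat (m choose l) *
      hypergeometric_2F1 (- of_nat m) (of_nat l - of_nat m) (of_nat l + 1) (z * w) * x ^ (m - l)"
    unfolding binomial_hypergeometric[OF l(1)] by (simp add: sum_distrib_right)
  finally have "jacobi_mode n m (Some z, Some w) = (-1) ^ l * (s ^ l * x ^ l) * (of_nat (m choose l) *
      hypergeometric_2F1 (- of_nat m) (of_nat l - of_nat m) (of_nat l + 1) (z * w) * x ^ (m - l))"
    using assms(2) by (simp add: jacobi_mode_def base l_def[symmetric] x_def[symmetric])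
  also have "\<dots> = (-1) ^ l * of_nat (m choose l) * (x ^ l * x ^ (m - l)) *
      hypergeometric_2F1 (- of_nat m) (of_nat l - of_nat m) (of_nat l + 1) (z * w) * s ^ l"
    by (simp only: mult_ac)
  also have "x ^ l * x ^ (m - l) = 1 / (1 - z * w) ^ m"
    using l(2) by (simp add: x_def power_divide flip: power_add)
  finally show ?thesis
    unfolding poisson_formula_def l(3) l_def[symmetric] s_def by simp
qed

lemma poisson_mode_eq:
  assumes "\<bar>n\<bar> \<le> int m"
  shows "poisson_mode n m = jacobi_mode n m"
  unfolding poisson_mode_def
proof (rule the_equality)
  show "jacobi_mode n m \<in> H_Omega \<and>
      (\<forall>z w. (Some z, Some w) \<in> Omega \<longrightarrow> jacobi_mode n m (Some z, Some w) = poisson_formula n m z w)"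
    using jacobi_mode_in_H_Omega poisson_formula_eq_jacobi_mode[OF assms] by blast
  then show "G = jacobi_mode n m"
    if "G \<in> H_Omega \<and> (\<forall>z w. (Some z, Some w) \<in> Omega \<longrightarrow> G (Some z, Some w) = poisson_formula n m z w)" for G
    using that by (intro H_Omega_eqI) auto
qed

lemma norm_mode_base_le:
  assumes "cmod (coord_B p) \<le> M" "cmod (coord_C p) \<le> M"
  shows "cmod (mode_base n p) \<le> M ^ nat \<bar>n\<bar>"
  using assms by (auto simp: mode_base_def norm_power intro!: power_mono)

text \<open>
  On a compact set the modes grow at most exponentially in \<open>m\<close>, since \<open>A\<close>, \<open>A - 1\<close>, \<open>B\<close> and \<open>C\<close> are bounded there and the
  degree of the mode in them is \<open>m\<close>.
\<close>

lemma norm_jacobi_mode_le: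
  assumes "cmod (coord_A p) \<le> M" "cmod (coord_A p - 1) \<le> M" "cmod (coord_B p) \<le> M" "cmod (coord_C p) \<le> M"
    and "\<bar>n\<bar> \<le> int m"
  shows "cmod (jacobi_mode n m p) \<le> (4 * M) ^ m"
proof (cases "p \<in> Omega")
  case True
  define l where "l = nat \<bar>n\<bar>"
  have l: "l + (m - l) = m" using assms(5) by (auto simp: l_def)
  have M: "M \<ge> 0" using assms(1) norm_ge_zero order_trans by blast
  have "cmod (jacobi_mode n m p) = cmod (mode_base n p) * cmod (poly (jacobi l (m - l)) (coord_A p))"
    using True by (simp add: jacobi_mode_def norm_mult norm_power l_def)
  also have "\<dots> \<le> M ^ l * (4 ^ (l + (m - l)) * M ^ (m - l))"
    unfolding l_def using M
    by (intro mult_mono norm_mode_base_le norm_poly_jacobi_le assms) auto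
  also have "\<dots> = 4 ^ m * (M ^ l * M ^ (m - l))" using l by simp
  also have "\<dots> = (4 * M) ^ m" using l by (simp add: power_mult_distrib flip: power_add)
  finally show ?thesis .
next
  case False
  have "M \<ge> 0" using assms(1) norm_ge_zero order_trans by blast
  then show ?thesis using False by (simp add: jacobi_mode_def)
qed

lemma coords_bounded_on_compact:
  assumes "compact_in_Omega K"
  obtains M where "M \<ge> 1" "\<And>p. p \<in> K \<Longrightarrow> cmod (coord_A p) \<le> M" "\<And>p. p \<in> K \<Longrightarrow> cmod (coord_A p - 1) \<le> M"
    "\<And>p. p \<in> K \<Longrightarrow> cmod (coord_B p) \<le> M" "\<And>p. p \<in> K \<Longrightarrow> cmod (coord_C p) \<le> M"
proof -
  obtain M1 where M1: "M1 > 0" "\<And>p. p \<in> K \<Longrightarrow> cmod (coord_A p) \<le> M1"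
    using H_Omega_bounded_on_compact[OF coord_H_Omega(1) assms] by metis
  obtain M2 where M2: "M2 > 0" "\<And>p. p \<in> K \<Longrightarrow> cmod (coord_B p) \<le> M2"
    using H_Omega_bounded_on_compact[OF coord_H_Omega(2) assms] by metis
  obtain M3 where M3: "M3 > 0" "\<And>p. p \<in> K \<Longrightarrow> cmod (coord_C p) \<le> M3"
    using H_Omega_bounded_on_compact[OF coord_H_Omega(3) assms] by metis
  show ?thesis
  proof (rule that[of "1 + M1 + M2 + M3"])
    fix p assume p: "p \<in> K"
    show "cmod (coord_A p) \<le> 1 + M1 + M2 + M3" using M1(2)[OF p] M1(1) M2(1) M3(1) by linarith
    show "cmod (coord_A p - 1) \<le> 1 + M1 + M2 + M3"
      using norm_triangle_ineq4[of "coord_A p" 1] M1(2)[OF p] M2(1) M3(1) by simp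
    show "cmod (coord_B p) \<le> 1 + M1 + M2 + M3" using M2(2)[OF p] M1(1) M3(1) by linarith
    show "cmod (coord_C p) \<le> 1 + M1 + M2 + M3" using M3(2)[OF p] M1(1) M2(1) by linarith
  qed (use M1 M2 M3 in auto)
qed

text \<open>
  The subbasic sets are balls around arbitrary centres. If the limit lies in such a ball then, by
  compactness, it does so with a margin, and this margin is what uniform convergence has to beat.
\<close>

lemma limitin_H_topology_iff:
  "limitin H_topology f F sequentially \<longleftrightarrow>
     F \<in> H_Omega \<and> (\<forall>\<^sub>F n in sequentially. f n \<in> H_Omega) \<and>
     (\<forall>K. compact_in_Omega K \<longrightarrow> uniform_limit K f F sequentially)"
proof (intro iffI conjI allI impI)
  assume lim: "limitin H_topology f F sequentially"
  show F: "F \<in> H_Omega" using limitin_topspace[OF lim] by simp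
  have "openin H_topology H_Omega" by (metis openin_topspace topspace_H_topology)
  then show "\<forall>\<^sub>F n in sequentially. f n \<in> H_Omega" using limitinD[OF lim _ F] by blast
  fix K assume K: "compact_in_Omega K"
  show "uniform_limit K f F sequentially"
  proof (rule uniform_limitI)
    fix e :: real assume e: "e > 0"
    let ?U = "{G \<in> H_Omega. \<forall>p\<in>K. cmod (G p - F p) < e}"
    have "openin H_topology ?U"
      unfolding H_topology_def using F K e by (intro topology_generated_by_Basis) blast
    then have "\<forall>\<^sub>F n in sequentially. f n \<in> ?U" by (rule limitinD[OF lim]) (use F e in simp)
    then show "\<forall>\<^sub>F n in sequentially. \<forall>x\<in>K. dist (f n x) (F x) < e"
      by eventually_elim (simp add: dist_norm)
  qed
next
  assume *: "F \<in> H_Omega \<and> (\<forall>\<^sub>F n in sequentially. f n \<in> H_Omega) \<and>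
     (\<forall>K. compact_in_Omega K \<longrightarrow> uniform_limit K f F sequentially)"
  show "limitin H_topology f F sequentially"
    unfolding limitin_def
  proof (intro conjI allI impI)
    show "F \<in> topspace H_topology" using * by simp
    fix U assume "openin H_topology U \<and> F \<in> U"
    then have "generate_topology_on {{G \<in> H_Omega. \<forall>p\<in>K. cmod (G p - F p) < e} | F K e.
        F \<in> H_Omega \<and> compact_in_Omega K \<and> e > 0} U" and "F \<in> U"
      by (auto simp: H_topology_def openin_topology_generated_by_iff)
    then show "\<forall>\<^sub>F n in sequentially. f n \<in> U"
    proof (induction rule: generate_topology_on.induct)
      case (Int a b)
      then show ?case by (auto intro: eventually_conj)
    next
      case (UN \<K>)
      then obtain k where "k \<in> \<K>" "F \<in> k" "\<forall>\<^sub>F n in sequentially. f n \<in> k" by blast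
      then show ?case by (auto elim: eventually_mono)
    next
      case (Basis s)
      then obtain F0 K e where s: "s = {G \<in> H_Omega. \<forall>p\<in>K. cmod (G p - F0 p) < e}"
        and F0: "F0 \<in> H_Omega" "compact_in_Omega K" "e > 0" by blast
      let ?D = "(\<lambda>p. F p - F0 p) ` K"
      have "compactin euclidean ?D"
        by (rule image_compactin[OF F0(2) continuous_map_H_Omega]) (use * F0 in \<open>simp add: H_Omega_diff\<close>)
      then have comp: "compact ?D" by simp
      have "\<exists>d>0. \<forall>p\<in>K. cmod (F p - F0 p) \<le> e - d"
      proof (cases "K = {}")
        case True
        then show ?thesis by (intro exI[of _ 1]) simp
      next
        case False
        then obtain x where x: "x \<in> ?D" "\<And>y. y \<in> ?D \<Longrightarrow> cmod y \<le> cmod x"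
          using continuous_attains_sup[OF comp _ continuous_on_norm_id] by auto
        then have "cmod x < e" using Basis s by auto
        then show ?thesis using x by (intro exI[of _ "e - cmod x"]) auto
      qed
      then obtain d where d: "d > 0" "\<And>p. p \<in> K \<Longrightarrow> cmod (F p - F0 p) \<le> e - d" by blast
      have "uniform_limit K f F sequentially" using * F0 by blast
      from uniform_limitD[OF this d(1)] have "\<forall>\<^sub>F n in sequentially. f n \<in> H_Omega \<and> (\<forall>x\<in>K. dist (f n x) (F x) < d)"
        using * by (auto intro: eventually_conj)
      then show ?case
      proof eventually_elim
        case (elim n)
        have "cmod (f n p - F0 p) < e" if p: "p \<in> K" for p
        proof -
          have "cmod (f n p - F0 p) \<le> cmod (f n p - F p) + cmod (F p - F0 p)"
            using norm_triangle_ineq[of "f n p - F p" "F p - F0 p"] by simp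
          also have "\<dots> < e" using elim p d(2)[OF p] by (force simp: dist_norm)
          finally show ?thesis .
        qed
        then show ?case using elim by (simp add: s)
      qed
    qed simp
  qed
qed

section \<open>The inner product on the antidiagonal\<close>

text \<open>
  Together with \<open>(\<infinity>, \<infinity>)\<close> these points form a copy of the sphere in \<open>\<Omega>\<close>; at finite points \<open>z w = - \<bar>z\<bar>\<^sup>2\<close> is never \<open>1\<close>.
\<close>

definition antidiagonal :: "complex \<Rightarrow> riemann_sphere \<times> riemann_sphere" where
  "antidiagonal z = (Some z, Some (- cnj z))"

lemma one_plus_norm_square_nz: "1 + complex_of_real ((cmod z)\<^sup>2) \<noteq> 0"
proof
  assume "1 + complex_of_real ((cmod z)\<^sup>2) = 0"
  then have "complex_of_real (1 + (cmod z)\<^sup>2) = 0" by simp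
  then have "1 + (cmod z)\<^sup>2 = 0" unfolding of_real_eq_0_iff .
  then show False by (smt (verit) zero_le_power2)
qed

text \<open>
  The unit discs of the two charts cover the sphere. Compactness is what makes the inner product
  continuous for locally uniform convergence.
\<close>

lemma antidiagonal_in_compact: "\<exists>K. compact_in_Omega K \<and> range antidiagonal \<subseteq> K"
proof -
  let ?a = "\<lambda>\<phi> z. (\<phi> z, \<phi> (- cnj z)) :: riemann_sphere \<times> riemann_sphere"
  have nz: "z * cnj z \<noteq> -1" for z
    using one_plus_norm_square_nz[of z] by (simp add: complex_norm_square add_eq_0_iff2 minus_equation_iff del: of_real_power)
  have comp: "compact_in_Omega (?a \<phi> ` cball 0 1)" if \<phi>: "\<phi> \<in> sphere_charts" for \<phi>
  proof (rule image_compactin[of euclidean])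
    have "continuous_map euclidean euclidean (\<lambda>z. - cnj z)" by (auto intro!: continuous_intros)
    from continuous_map_compose[OF this continuous_chart[OF \<phi>]]
    have "continuous_map euclidean sphere2_topology (?a \<phi>)"
      using continuous_chart[OF \<phi>] by (intro continuous_map_pairedI) (simp_all add: o_def)
    moreover have "?a \<phi> z \<in> Omega" for z
      using \<phi> nz[of z] by (auto simp: sphere_charts_def minus_equation_iff)
    ultimately show "continuous_map euclidean (subtopology sphere2_topology Omega) (?a \<phi>)"
      by (auto simp: continuous_map_in_subtopology)
  qed simp
  let ?K = "?a Some ` cball 0 1 \<union> ?a chart_at_infinity ` cball 0 1"
  have "antidiagonal z \<in> ?K" for z
  proof (cases "cmod z \<le> 1")
    case True
    then show ?thesis by (intro UnI1 image_eqI[of _ _ z]) (auto simp: antidiagonal_def)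
  next
    case False
    then have "z \<noteq> 0" by auto
    then show ?thesis using False
      by (intro UnI2 image_eqI[of _ _ "1 / z"])
         (auto simp: antidiagonal_def chart_at_infinity_def norm_divide)
  qed
  moreover have "compact_in_Omega ?K"
    by (intro compactin_Un comp) (auto simp: sphere_charts_def)
  ultimately show ?thesis by blast
qed

text \<open>
  The coordinate \<open>A\<close> on the antidiagonal: the height, between \<open>0\<close> and \<open>1\<close>, of the point with stereographic
  projection \<open>z\<close>.
\<close>

definition height :: "complex \<Rightarrow> real" where
  "height z = 1 / (1 + (cmod z)\<^sup>2)"

lemma height_pos: "height z > 0"
  by (simp add: height_def add_pos_nonneg)

lemma coords_antidiagonal:
  "coord_A (antidiagonal z) = of_real (height z)"
  "coord_B (antidiagonal z) = - cnj z * of_real (height z)"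
  "coord_C (antidiagonal z) = z * of_real (height z)"
proof -
  have "1 + z * cnj z = of_real (1 + (cmod z)\<^sup>2)" by (simp only: complex_norm_square of_real_add of_real_1)
  then show "coord_A (antidiagonal z) = of_real (height z)"
    "coord_B (antidiagonal z) = - cnj z * of_real (height z)"
    "coord_C (antidiagonal z) = z * of_real (height z)"
    by (simp_all add: antidiagonal_def height_def coord_C_def mult.commute[of "cnj z"] del: of_real_add)
qed

lemma antidiagonal_in_Omega: "antidiagonal z \<in> Omega"
  using antidiagonal_in_compact compact_in_Omega_subset by blast

lemma mode_base_antidiagonal_rotate:
  "mode_base n (antidiagonal (cis \<theta> * z)) = cis (- of_int n * \<theta>) * mode_base n (antidiagonal z)"
proof -
  have h: "height (cis \<theta> * z) = height z" by (simp add: height_def norm_mult)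
  show ?thesis
  proof (cases "n \<ge> 0")
    case True
    then have "(cnj (cis \<theta>)) ^ nat n = cis (- of_int n * \<theta>)"
    proof -
      have "real (nat n) * - \<theta> = - of_int n * \<theta>" using True by simp
      then have "cis (- \<theta>) ^ nat n = cis (- of_int n * \<theta>)" by (metis Complex.DeMoivre)
      then show ?thesis by (simp only: cis_cnj)
    qed
    moreover have "coord_B (antidiagonal (cis \<theta> * z)) = cnj (cis \<theta>) * coord_B (antidiagonal z)"
      by (simp add: coords_antidiagonal h mult.assoc)
    ultimately show ?thesis using True by (simp add: mode_base_def power_mult_distrib del: cis_cnj)
  next
    case False
    then have "cis \<theta> ^ nat (- n) = cis (- of_int n * \<theta>)"
    proof -
      have "real (nat (- n)) * \<theta> = - of_int n * \<theta>" using False by simp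
      then show ?thesis by (simp only: Complex.DeMoivre)
    qed
    then show ?thesis using False by (simp add: mode_base_def coords_antidiagonal h power_mult_distrib)
  qed
qed

lemma norm_mode_base_antidiagonal:
  "mode_base n (antidiagonal z) * cnj (mode_base n (antidiagonal z)) =
     of_real ((height z * (1 - height z)) ^ nat \<bar>n\<bar>)"
proof -
  have z: "z * cnj z * of_real (height z) = of_real (1 - height z)"
  proof -
    have "1 + (cmod z)\<^sup>2 \<noteq> 0" using height_pos[of z] by (auto simp: height_def)
    then have "(cmod z)\<^sup>2 * height z = 1 - height z" by (simp add: height_def field_simps)
    then show ?thesis by (simp only: complex_norm_square[symmetric] of_real_mult[symmetric])
  qed
  have BC: "coord_B (antidiagonal z) * cnj (coord_B (antidiagonal z)) = of_real (height z * (1 - height z))"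
    "coord_C (antidiagonal z) * cnj (coord_C (antidiagonal z)) = of_real (height z * (1 - height z))"
    using z by (simp_all add: coords_antidiagonal mult_ac)
  have "x ^ k * cnj (x ^ k) = of_real (r ^ k)" if "x * cnj x = of_real r" for x r k
    using that by (simp flip: power_mult_distrib)
  note pow = this[OF BC(1)] this[OF BC(2)]
  show ?thesis
    by (cases "n \<ge> 0") (simp_all only: mode_base_def if_True if_False pow, simp_all)
qed

definition sphere_integrand ::
    "(riemann_sphere \<times> riemann_sphere \<Rightarrow> complex) \<Rightarrow> (riemann_sphere \<times> riemann_sphere \<Rightarrow> complex) \<Rightarrow> complex \<Rightarrow> complex" where
  "sphere_integrand F G z = F (antidiagonal z) * cnj (G (antidiagonal z)) * of_real ((height z)\<^sup>2)"

lemma inner_Omega_eq: "inner_Omega F G = 1 / of_real pi * (LINT z|lborel. sphere_integrand F G z)"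
  unfolding inner_Omega_def sphere_integrand_def
  by (simp add: antidiagonal_def height_def power_divide)

lemma continuous_antidiagonal:
  assumes "F \<in> H_Omega"
  shows "continuous_on UNIV (\<lambda>z. F (antidiagonal z))"
proof -
  have "holomorphic2_on (\<lambda>p. F (Some (fst p), Some (snd p))) {(u, v). (Some u, Some v) \<in> Omega}"
    by (rule holomorphic_on_OmegaD[OF H_Omega_holomorphic[OF assms]]) (auto simp: sphere_charts_def)
  then have cont: "continuous_on {(u, v). (Some u, Some v) \<in> Omega} (\<lambda>p. F (Some (fst p), Some (snd p)))"
    by (rule holomorphic2_on_imp_continuous_on)
  have "(z, - cnj z) \<in> {(u, v). (Some u, Some v) \<in> Omega}" for z
    using antidiagonal_in_Omega[of z] by (simp add: antidiagonal_def)
  then have "(\<lambda>z. (z, - cnj z)) ` UNIV \<subseteq> {(u, v). (Some u, Some v) \<in> Omega}" by blast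
  then have "continuous_on UNIV (\<lambda>z. F (Some (fst (z, - cnj z)), Some (snd (z, - cnj z))))"
    by (intro continuous_on_compose2[OF cont] continuous_intros)
  then show ?thesis by (simp add: antidiagonal_def)
qed

lemma borel_measurable_sphere_integrand [measurable]:
  assumes "F \<in> H_Omega" "G \<in> H_Omega"
  shows "sphere_integrand F G \<in> borel_measurable borel"
proof -
  have "1 + (cmod z)\<^sup>2 \<noteq> 0" for z using height_pos[of z] by (auto simp: height_def)
  then have "continuous_on UNIV (sphere_integrand F G)"
    unfolding sphere_integrand_def height_def
    by (intro continuous_intros continuous_antidiagonal assms) auto
  then show ?thesis by (rule borel_measurable_continuous_onI)
qed

lemma has_bochner_integral_height_square: "has_bochner_integral lborel (\<lambda>z. (height z)\<^sup>2) pi"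
  using sphere_area_moment[of 0] by (simp add: height_def power_divide power2_eq_square)

lemma norm_sphere_integrand_le:
  assumes "\<And>z. cmod (F (antidiagonal z)) \<le> M" "\<And>z. cmod (G (antidiagonal z)) \<le> N"
  shows "cmod (sphere_integrand F G z) \<le> M * N * (height z)\<^sup>2"
proof -
  have "0 \<le> M" "0 \<le> N" using assms[of 0] norm_ge_zero order_trans by blast+
  then show ?thesis unfolding sphere_integrand_def norm_mult
    using assms by (intro mult_mono) (auto simp: norm_power intro!: mult_nonneg_nonneg)
qed

lemma H_Omega_bounded_on_antidiagonal:
  assumes "F \<in> H_Omega"
  shows "\<exists>M>0. \<forall>z. cmod (F (antidiagonal z)) \<le> M"
proof -
  obtain K where K: "compact_in_Omega K" "range antidiagonal \<subseteq> K"
    using antidiagonal_in_compact by blast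
  obtain M where "M > 0" "\<And>p. p \<in> K \<Longrightarrow> cmod (F p) \<le> M"
    using H_Omega_bounded_on_compact[OF assms K(1)] by metis
  then show ?thesis using K(2) by blast
qed

lemma integrable_sphere_integrand:
  assumes "F \<in> H_Omega" "G \<in> H_Omega"
  shows "integrable lborel (sphere_integrand F G)"
proof -
  obtain M N where MN: "M > 0" "\<And>z. cmod (F (antidiagonal z)) \<le> M" "N > 0" "\<And>z. cmod (G (antidiagonal z)) \<le> N"
    using H_Omega_bounded_on_antidiagonal assms by metis
  have "integrable lborel (\<lambda>z. M * N * (height z)\<^sup>2)"
    using has_bochner_integral_height_square by (intro integrable_mult_right) (auto simp: has_bochner_integral_iff)
  then show ?thesis
  proof (rule Bochner_Integration.integrable_bound)
    show "sphere_integrand F G \<in> borel_measurable lborel"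
      using borel_measurable_sphere_integrand[OF assms] by simp
    show "AE z in lborel. cmod (sphere_integrand F G z) \<le> norm (M * N * (height z)\<^sup>2)"
      using norm_sphere_integrand_le[of F M G N] MN by (intro AE_I2) (simp add: abs_mult)
  qed
qed

text \<open>
  The measure of the inner product has total mass \<open>1\<close>.
\<close>

lemma norm_inner_Omega_le:
  assumes "\<And>z. cmod (F (antidiagonal z)) \<le> M" "\<And>z. cmod (G (antidiagonal z)) \<le> N"
  shows "cmod (inner_Omega F G) \<le> M * N"
proof -
  have "0 \<le> M" "0 \<le> N" using assms[of 0] norm_ge_zero order_trans by blast+
  have int: "has_bochner_integral lborel (\<lambda>z. M * N * (height z)\<^sup>2) (M * N * pi)"
    by (intro has_bochner_integral_mult_right has_bochner_integral_height_square)
  have "cmod (LINT z|lborel. sphere_integrand F G z) \<le> (LINT z|lborel. M * N * (height z)\<^sup>2)"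
  proof (cases "integrable lborel (sphere_integrand F G)")
    case True
    show ?thesis
      by (rule Bochner_Integration.integral_norm_bound_integral[OF True])
         (use int norm_sphere_integrand_le[of F M G N, OF assms] in \<open>simp_all add: has_bochner_integral_iff\<close>)
  next
    case False
    then show ?thesis using int \<open>0 \<le> M\<close> \<open>0 \<le> N\<close>
      by (simp add: not_integrable_integral_eq has_bochner_integral_iff)
  qed
  also have "\<dots> = M * N * pi" using int by (simp add: has_bochner_integral_iff)
  finally show ?thesis by (simp add: inner_Omega_eq norm_mult norm_divide field_simps)
qed

lemma inner_Omega_sum_left:
  assumes "\<And>i. i \<in> I \<Longrightarrow> F i \<in> H_Omega" "G \<in> H_Omega"
  shows "inner_Omega (\<lambda>p. \<Sum>i\<in>I. c i * F i p) G = (\<Sum>i\<in>I. c i * inner_Omega (F i) G)"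
proof -
  have "sphere_integrand (\<lambda>p. \<Sum>i\<in>I. c i * F i p) G z = (\<Sum>i\<in>I. c i * sphere_integrand (F i) G z)" for z
    by (simp add: sphere_integrand_def sum_distrib_right mult.assoc)
  then have "(LINT z|lborel. sphere_integrand (\<lambda>p. \<Sum>i\<in>I. c i * F i p) G z) =
      (LINT z|lborel. (\<Sum>i\<in>I. c i * sphere_integrand (F i) G z))" by simp
  also have "\<dots> = (\<Sum>i\<in>I. LINT z|lborel. c i * sphere_integrand (F i) G z)"
    using assms by (intro Bochner_Integration.integral_sum) (simp add: integrable_sphere_integrand)
  finally show ?thesis by (simp add: inner_Omega_eq sum_distrib_left mult_ac)
qed

lemma inner_Omega_diff_left:
  assumes "F \<in> H_Omega" "F' \<in> H_Omega" "G \<in> H_Omega"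
  shows "inner_Omega (\<lambda>p. F p - F' p) G = inner_Omega F G - inner_Omega F' G"
  using inner_Omega_sum_left[of "{0, 1::nat}" "\<lambda>i. if i = 0 then F else F'" G "\<lambda>i. if i = 0 then 1 else -1"] assms
  by simp

text \<open>
  The area measure of the sphere projects to the uniform measure on the interval of heights; for
  polynomials it suffices to compare moments.
\<close>

lemma has_bochner_integral_poly_height:
  "has_bochner_integral lborel (\<lambda>z. poly P (height z) * (height z)\<^sup>2) (pi * poly_integral P)"
proof -
  have "has_bochner_integral lborel (\<lambda>z. \<Sum>k\<le>degree P. coeff P k * (height z) ^ (k + 2))
     (\<Sum>k\<le>degree P. coeff P k * (pi / (real k + 1)))"
  proof (intro has_bochner_integral_sum has_bochner_integral_mult_right)
    show "has_bochner_integral lborel (\<lambda>z. height z ^ (k + 2)) (pi / (real k + 1))" for k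
      using sphere_area_moment[of k] by (simp add: height_def power_divide)
  qed
  moreover have "(\<Sum>k\<le>degree P. coeff P k * (pi / (real k + 1))) = pi * poly_integral P"
    by (subst (2) poly_as_sum_of_monoms[symmetric])
       (simp add: poly_integral_sum poly_integral_monom sum_distrib_left mult_ac)
  moreover have "(\<Sum>k\<le>degree P. coeff P k * (height z) ^ (k + 2)) = poly P (height z) * (height z)\<^sup>2" for z
    unfolding poly_altdef sum_distrib_right
    by (intro sum.cong refl) (simp add: power_add power2_eq_square)
  ultimately show ?thesis by simp
qed

text \<open>
  For equal weights the integrand depends on the height only, and the integral becomes one over
  \<open>[0, 1]\<close> with the Jacobi weight. For different weights a rotation multiplies the integrand by a constant
  other than \<open>1\<close>.
\<close>

lemma inner_Omega_separated:
  assumes H: "F \<in> H_Omega" "G \<in> H_Omega"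
    and F: "\<And>z. F (antidiagonal z) = mode_base n (antidiagonal z) * of_real (poly q (height z))"
    and G: "\<And>z. G (antidiagonal z) = mode_base n' (antidiagonal z) * of_real (poly r (height z))"
  shows "inner_Omega F G = (if n = n' then of_real (jacobi_inner (nat \<bar>n\<bar>) q r) else 0)"
proof (cases "n = n'")
  case True
  define P where "P = ([:0, 1:] * [:1, -1:]) ^ nat \<bar>n\<bar> * (q * r)"
  have "sphere_integrand F G z = of_real (poly P (height z) * (height z)\<^sup>2)" for z
  proof -
    have "sphere_integrand F G z = (mode_base n (antidiagonal z) * cnj (mode_base n (antidiagonal z))) *
        of_real (poly q (height z) * poly r (height z) * (height z)\<^sup>2)"
      by (simp add: sphere_integrand_def F G True mult_ac)
    also have "\<dots> = of_real (poly P (height z) * (height z)\<^sup>2)"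
      unfolding norm_mode_base_antidiagonal of_real_mult[symmetric] P_def by (simp add: mult_ac)
    finally show ?thesis .
  qed
  then have "(LINT z|lborel. sphere_integrand F G z) = of_real (pi * poly_integral P)"
    using has_bochner_integral_poly_height[of P] by (simp add: has_bochner_integral_iff del: of_real_mult)
  then show ?thesis using True by (simp add: inner_Omega_eq jacobi_inner_def P_def)
next
  case False
  define D where "D = real_of_int (n' - n)"
  \<comment> \<open>The angle for which the integrand is multiplied by \<open>\<i>\<close>; it is at most a right angle, which excludes the half turn.\<close>
  define \<theta> where "\<theta> = pi / (2 * D)"
  have d1: "\<bar>D\<bar> \<ge> 1" using False unfolding D_def by linarith
  then have d: "D \<noteq> 0" by auto
  have "cis \<theta> \<noteq> -1"
  proof -
    have "\<bar>\<theta>\<bar> = pi / (2 * \<bar>D\<bar>)" by (simp add: \<theta>_def abs_mult)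
    also have "\<dots> \<le> pi / 2" using d1 by (intro divide_left_mono) auto
    finally have "cos \<theta> \<ge> 0" by (intro cos_ge_zero) auto
    then show ?thesis by (auto simp: complex_eq_iff)
  qed
  have rot: "sphere_integrand F G (cis \<theta> * z) = \<i> * sphere_integrand F G z" for z
  proof -
    have h: "height (cis \<theta> * z) = height z" by (simp add: height_def norm_mult)
    have "cis (- of_int n * \<theta>) * cnj (cis (- of_int n' * \<theta>)) = cis (D * \<theta>)"
      by (simp add: D_def cis_cnj cis_mult algebra_simps)
    also have "D * \<theta> = pi / 2" using d by (simp add: \<theta>_def)
    finally have "cis (- of_int n * \<theta>) * cnj (cis (- of_int n' * \<theta>)) = \<i>" by simp
    moreover have "sphere_integrand F G (cis \<theta> * z) =
        (cis (- of_int n * \<theta>) * cnj (cis (- of_int n' * \<theta>))) * sphere_integrand F G z"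
      unfolding sphere_integrand_def F G mode_base_antidiagonal_rotate h complex_cnj_mult
      by (simp only: mult_ac)
    ultimately show ?thesis by simp
  qed
  have "(LINT z|lborel. sphere_integrand F G z) = (LINT z|lborel. sphere_integrand F G (cis \<theta> * z))"
    by (rule integral_rotation[symmetric]) (use H \<open>cis \<theta> \<noteq> -1\<close> borel_measurable_sphere_integrand in auto)
  also have "\<dots> = \<i> * (LINT z|lborel. sphere_integrand F G z)" unfolding rot by simp
  finally have "(1 - \<i>) * (LINT z|lborel. sphere_integrand F G z) = 0" by (simp add: algebra_simps)
  moreover have "1 - \<i> \<noteq> 0" by (simp add: complex_eq_iff)
  ultimately show ?thesis using False by (simp add: inner_Omega_eq)
qed

lemma inner_jacobi_modes:
  assumes "\<bar>n\<bar> \<le> int m" "\<bar>n'\<bar> \<le> int m'"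
  shows "inner_Omega (jacobi_mode n m) (jacobi_mode n' m') =
    (if n = n' \<and> m = m' then of_real (mode_sqnorm (nat \<bar>n\<bar>) m) else 0)"
proof -
  let ?q = "\<lambda>n m. smult ((-1) ^ nat \<bar>n\<bar>) (jacobi (nat \<bar>n\<bar>) (m - nat \<bar>n\<bar>)) :: real poly"
  have val: "jacobi_mode n m (antidiagonal z) = mode_base n (antidiagonal z) * of_real (poly (?q n m) (height z))" for n m z
    by (simp add: jacobi_mode_def antidiagonal_in_Omega coords_antidiagonal poly_jacobi_of_real)
  have "inner_Omega (jacobi_mode n m) (jacobi_mode n' m') =
      (if n = n' then of_real (jacobi_inner (nat \<bar>n\<bar>) (?q n m) (?q n' m')) else 0)"
    by (rule inner_Omega_separated[OF jacobi_mode_in_H_Omega jacobi_mode_in_H_Omega val val])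
  also have "(if n = n' then complex_of_real (jacobi_inner (nat \<bar>n\<bar>) (?q n m) (?q n' m')) else 0) =
      (if n = n' then of_real (jacobi_inner (nat \<bar>n\<bar>) (jacobi (nat \<bar>n\<bar>) (m - nat \<bar>n\<bar>)) (jacobi (nat \<bar>n\<bar>) (m' - nat \<bar>n\<bar>))) else 0)"
    by (auto simp: jacobi_inner_def poly_integral_smult simp flip: power_mult_distrib)
  also have "\<dots> = (if n = n' \<and> m = m' then of_real (mode_sqnorm (nat \<bar>n\<bar>) m) else 0)"
  proof -
    have "jacobi_inner (nat \<bar>n\<bar>) (jacobi (nat \<bar>n\<bar>) (m - nat \<bar>n\<bar>)) (jacobi (nat \<bar>n\<bar>) (m' - nat \<bar>n\<bar>)) = 0"
      if "m \<noteq> m'" "n = n'"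
      using that assms by (intro jacobi_orthogonal) linarith
    moreover have "jacobi_inner (nat \<bar>n\<bar>) (jacobi (nat \<bar>n\<bar>) (m - nat \<bar>n\<bar>)) (jacobi (nat \<bar>n\<bar>) (m - nat \<bar>n\<bar>)) =
        mode_sqnorm (nat \<bar>n\<bar>) m"
      using assms(1) by (subst jacobi_sqnorm) simp
    ultimately show ?thesis by auto
  qed
  finally show ?thesis .
qed

section \<open>Expansion in monomials of the coordinates\<close>

abbreviation swapped :: "(riemann_sphere \<times> riemann_sphere \<Rightarrow> complex) \<Rightarrow> riemann_sphere \<times> riemann_sphere \<Rightarrow> complex" where
  "swapped F \<equiv> (\<lambda>p. F (prod.swap p))"

text \<open>
  The Laurent coefficients along the orbits, as entire functions of the coordinate \<open>A\<close>.
\<close>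

definition orbit_coeff :: "(riemann_sphere \<times> riemann_sphere \<Rightarrow> complex) \<Rightarrow> nat \<Rightarrow> complex \<Rightarrow> complex" where
  "orbit_coeff F = laurent_family.coeff (\<lambda>\<alpha> \<beta>. F (orbit_point \<alpha> \<beta>))"

text \<open>
  The coefficient of \<open>B\<^sup>n A\<^sup>k\<close> for \<open>n \<ge> 0\<close> and of \<open>C\<close> to the power \<open>- n\<close> times \<open>A\<^sup>k\<close> for \<open>n < 0\<close>. Modulo the equation of the quadric these monomials
  are a basis of the polynomials in \<open>A\<close>, \<open>B\<close>, \<open>C\<close>.
\<close>

definition taylor_coeff :: "(riemann_sphere \<times> riemann_sphere \<Rightarrow> complex) \<Rightarrow> int \<Rightarrow> nat \<Rightarrow> complex" where
  "taylor_coeff F n k = (if n \<ge> 0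
     then laurent_family.coeff2 (\<lambda>\<alpha> \<beta>. F (orbit_point \<alpha> \<beta>)) (nat n) k
     else laurent_family.coeff2 (\<lambda>\<alpha> \<beta>. swapped F (orbit_point \<alpha> \<beta>)) (nat (- n)) k)"

lemma orbit_expansion:
  assumes "F \<in> H_Omega" "\<beta> \<noteq> 0"
  shows "F (orbit_point \<alpha> \<beta>) = (\<Sum>n. orbit_coeff F n \<alpha> * \<beta> ^ n) +
     (\<Sum>n. orbit_coeff (swapped F) (Suc n) \<alpha> * (\<alpha> * (\<alpha> - 1) / \<beta>) ^ Suc n)"
  unfolding orbit_coeff_def
  using two_sided_expansion[OF laurent_family_H_Omega[OF assms(1)] laurent_family_H_Omega[OF H_Omega_swap[OF assms(1)]] _ assms(2)]
  by (simp add: orbit_point_inverse)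

lemma orbit_coeff_summable:
  assumes "F \<in> H_Omega"
  shows "summable (\<lambda>n. orbit_coeff F n \<alpha> * \<beta> ^ n)"
  unfolding orbit_coeff_def
  using laurent_family.cauchy_part_sums[OF laurent_family_H_Omega[OF assms], of \<beta> "cmod \<beta> + 1" \<alpha>]
  by (auto simp: sums_iff)

text \<open>
  For \<open>\<alpha> \<in> {0, 1}\<close> the coordinate \<open>C\<close> vanishes on the orbit, the negative part of the Laurent series drops out, and the
  orbit acquires a limit point as \<open>\<beta>\<close> tends to \<open>0\<close>. The constant term is the value there, which is the
  same for \<open>F\<close> and for \<open>F\<close> with exchanged arguments.
\<close>

lemma orbit_coeff_0:
  assumes F: "F \<in> H_Omega"
  shows "orbit_coeff F 0 1 = F (Some 0, Some 0)" "orbit_coeff F 0 0 = F (None, None)"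
proof -
  have lim: "((\<lambda>\<beta>. F (orbit_point \<alpha> \<beta>)) \<longlongrightarrow> orbit_coeff F 0 \<alpha>) (at 0)" if \<alpha>: "\<alpha> * (\<alpha> - 1) = 0" for \<alpha>
  proof (rule powser_limit_0_strong[of 1 "\<lambda>n. orbit_coeff F n \<alpha>"])
    fix \<beta> :: complex assume "\<beta> \<noteq> 0"
    then have "F (orbit_point \<alpha> \<beta>) = (\<Sum>n. orbit_coeff F n \<alpha> * \<beta> ^ n)"
      using orbit_expansion[OF F, of \<beta> \<alpha>] \<alpha> by simp
    then show "(\<lambda>n. orbit_coeff F n \<alpha> * \<beta> ^ n) sums F (orbit_point \<alpha> \<beta>)"
      using orbit_coeff_summable[OF F, of \<alpha> \<beta>] by (simp add: sums_iff)
  qed simp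
  have chart: "isCont (\<lambda>p. F (\<phi> (fst p), \<phi> (snd p))) (0, 0)" if \<phi>: "\<phi> \<in> sphere_charts" for \<phi>
    by (rule isCont_holomorphic2[OF holomorphic_on_OmegaD[OF H_Omega_holomorphic[OF F] \<phi> \<phi>]])
       (use \<phi> in \<open>auto simp: sphere_charts_def simp flip: chart_at_infinity_0\<close>)
  have "((\<lambda>\<beta>::complex. (0::complex, \<beta>)) \<longlongrightarrow> (0, 0)) (at 0)" by (intro tendsto_intros)
  from isCont_tendsto_compose[OF chart[of Some] this]
  have "((\<lambda>\<beta>. F (Some 0, Some \<beta>)) \<longlongrightarrow> F (Some 0, Some 0)) (at 0)" by (simp add: sphere_charts_def)
  then have "((\<lambda>\<beta>. F (orbit_point 1 \<beta>)) \<longlongrightarrow> F (Some 0, Some 0)) (at 0)"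
    by (rule Lim_transform_eventually)
       (auto simp: orbit_point_def chart_at_infinity_def eventually_at_filter)
  then show "orbit_coeff F 0 1 = F (Some 0, Some 0)"
    using tendsto_unique[OF _ lim[of 1]] by (simp add: trivial_limit_at)
  have "((\<lambda>\<beta>::complex. (- \<beta>, 0::complex)) \<longlongrightarrow> (- 0, 0)) (at 0)" by (intro tendsto_intros)
  then have "((\<lambda>\<beta>::complex. (- \<beta>, 0::complex)) \<longlongrightarrow> (0, 0)) (at 0)" by simp
  from isCont_tendsto_compose[OF chart[of chart_at_infinity] this]
  have "((\<lambda>\<beta>. F (chart_at_infinity (- \<beta>), None)) \<longlongrightarrow> F (None, None)) (at 0)"
    by (simp add: sphere_charts_def)
  then have "((\<lambda>\<beta>. F (orbit_point 0 \<beta>)) \<longlongrightarrow> F (None, None)) (at 0)"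
    by (rule Lim_transform_eventually)
       (auto simp: orbit_point_def chart_at_infinity_def eventually_at_filter)
  then show "orbit_coeff F 0 0 = F (None, None)"
    using tendsto_unique[OF _ lim[of 0]] by (simp add: trivial_limit_at)
qed

text \<open>
  Where \<open>B \<noteq> 0\<close> this is the expansion along the orbit, and where \<open>B = 0 \<noteq> C\<close> it is the one with
  exchanged factors; there the constant terms have to be matched. The two remaining points are the fixed
  points \<open>(0, 0)\<close> and \<open>(\<infinity>, \<infinity>)\<close> of the action.
\<close>

lemma H_Omega_laurent_expansion:
  assumes F: "F \<in> H_Omega" and p: "p \<in> Omega"
  shows "F p = (\<Sum>n. orbit_coeff F n (coord_A p) * coord_B p ^ n) +
     (\<Sum>n. orbit_coeff (swapped F) (Suc n) (coord_A p) * coord_C p ^ Suc n)"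
proof -
  let ?A = "coord_A p" and ?B = "coord_B p" and ?C = "coord_C p"
  note F' = H_Omega_swap[OF F]
  have BC: "?B * ?C = ?A * (?A - 1)" by (rule coord_B_mult_coord_C[OF p])
  have z: "(\<Sum>n. a n * 0 ^ n) = a 0" for a :: "nat \<Rightarrow> complex"
    by (rule powser_zero)
  consider "?B \<noteq> 0" | "?B = 0" "?C \<noteq> 0" | "?B = 0" "?C = 0" by blast
  then show ?thesis
  proof cases
    case 1
    then have "?C = ?A * (?A - 1) / ?B" using BC by (simp add: field_simps)
    then show ?thesis using orbit_expansion[OF F 1, of ?A] orbit_point_coords[OF p 1] by simp
  next
    case 2
    then have A: "?A = 0 \<or> ?A = 1" using BC by auto
    then have same: "orbit_coeff F 0 ?A = orbit_coeff (swapped F) 0 ?A"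
      using orbit_coeff_0[OF F] orbit_coeff_0[OF F'] by auto
    have p': "prod.swap p \<in> Omega" using p by (cases p; cases "fst p"; cases "snd p") (auto simp: Omega_def mult.commute)
    have "orbit_point ?A ?C = prod.swap p"
      using orbit_point_coords[OF p'] 2 by (simp add: coord_A_swap flip: coord_C_def)
    then have "F p = swapped F (orbit_point ?A ?C)" by simp
    also have "\<dots> = (\<Sum>n. orbit_coeff (swapped F) n ?A * ?C ^ n) +
       (\<Sum>n. orbit_coeff F (Suc n) ?A * (?A * (?A - 1) / ?C) ^ Suc n)"
      using orbit_expansion[OF F' 2(2), of ?A] by simp
    also have "?A * (?A - 1) / ?C = 0" using A by auto
    also have "(\<Sum>n. orbit_coeff (swapped F) n ?A * ?C ^ n) =
       (\<Sum>n. orbit_coeff (swapped F) (Suc n) ?A * ?C ^ Suc n) + orbit_coeff (swapped F) 0 ?A"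
      using suminf_split_head[OF orbit_coeff_summable[OF F', of ?A ?C]] by simp
    finally show ?thesis using same by (simp add: 2 z)
  next
    case 3
    then have "p = (Some 0, Some 0) \<or> p = (None, None)"
      using p by (cases p; cases "fst p"; cases "snd p") (auto simp: coord_C_def Omega_def)
    then show ?thesis using orbit_coeff_0[OF F] by (auto simp: z coord_C_def)
  qed
qed

lemma taylor_coeff_bound:
  assumes F: "F \<in> H_Omega" and R: "R > 0"
  shows "\<exists>M\<ge>0. \<forall>n k. cmod (taylor_coeff F n k) \<le> M / R ^ (nat \<bar>n\<bar> + k)"
proof -
  obtain M where M: "M \<ge> 0" "\<And>n k. cmod (laurent_family.coeff2 (\<lambda>\<alpha> \<beta>. F (orbit_point \<alpha> \<beta>)) n k) \<le> M / R ^ (n + k)"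
    using laurent_family.coeff2_bound[OF laurent_family_H_Omega[OF F] R] by blast
  obtain N where N: "N \<ge> 0" "\<And>n k. cmod (laurent_family.coeff2 (\<lambda>\<alpha> \<beta>. swapped F (orbit_point \<alpha> \<beta>)) n k) \<le> N / R ^ (n + k)"
    using laurent_family.coeff2_bound[OF laurent_family_H_Omega[OF H_Omega_swap[OF F]] R] by blast
  have "cmod (taylor_coeff F n k) \<le> (M + N) / R ^ (nat \<bar>n\<bar> + k)" for n k
  proof (cases "n \<ge> 0")
    case True
    then have "cmod (taylor_coeff F n k) \<le> M / R ^ (nat \<bar>n\<bar> + k)" using M(2) by (simp add: taylor_coeff_def)
    also have "\<dots> \<le> (M + N) / R ^ (nat \<bar>n\<bar> + k)" using N(1) R by (intro divide_right_mono) auto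
    finally show ?thesis .
  next
    case False
    then have "cmod (taylor_coeff F n k) \<le> N / R ^ (nat \<bar>n\<bar> + k)" using N(2) by (simp add: taylor_coeff_def)
    also have "\<dots> \<le> (M + N) / R ^ (nat \<bar>n\<bar> + k)" using M(1) R by (intro divide_right_mono) auto
    finally show ?thesis .
  qed
  then show ?thesis using M(1) N(1) by (intro exI[of _ "M + N"]) auto
qed

lemma summable_on_times_nonneg:
  fixes f :: "'a \<Rightarrow> real" and g :: "'b \<Rightarrow> real"
  assumes "f summable_on A" "g summable_on B" "\<And>x. x \<in> A \<Longrightarrow> f x \<ge> 0" "\<And>y. y \<in> B \<Longrightarrow> g y \<ge> 0"
  shows "(\<lambda>(x, y). f x * g y) summable_on A \<times> B"
proof (rule summable_on_SigmaI)
  show "((\<lambda>y. case (x, y) of (x, y) \<Rightarrow> f x * g y) has_sum f x * infsum g B) B" for x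
    using has_sum_cmult_right[OF has_sum_infsum[OF assms(2)], of "f x"] by simp
  show "(\<lambda>x. f x * infsum g B) summable_on A" by (rule summable_on_cmult_left) fact
qed (use assms in auto)

lemma UNIV_int_split: "(UNIV :: int set) = range int \<union> range (\<lambda>n. - int (Suc n))"
proof -
  have "x \<in> range int \<union> range (\<lambda>n. - int (Suc n))" for x
  proof (cases "x \<ge> 0")
    case True
    then have "x = int (nat x)" by simp
    then show ?thesis by blast
  next
    case False
    then have "x = - int (Suc (nat (- x - 1)))" by simp
    then show ?thesis by blast
  qed
  then show ?thesis by blast
qed

lemma has_sum_int_split:
  fixes f :: "int \<Rightarrow> 'a :: {topological_comm_monoid_add}"
  assumes "((\<lambda>n. f (int n)) has_sum a) UNIV" "((\<lambda>n. f (- int (Suc n))) has_sum b) UNIV"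
  shows "(f has_sum (a + b)) UNIV"
  unfolding UNIV_int_split
proof (rule has_sum_Un_disjoint)
  show "(f has_sum a) (range int)"
    using assms(1) by (subst has_sum_reindex) (auto simp: o_def)
  show "(f has_sum b) (range (\<lambda>n. - int (Suc n)))"
    using assms(2) by (subst has_sum_reindex) (auto simp: o_def inj_on_def)
qed auto

lemma geometric_summable_on_nat: "(\<lambda>n. q ^ n) summable_on UNIV" if "0 \<le> q" "q < 1" for q :: real
  using that by (intro norm_summable_imp_summable_on) (simp add: summable_geometric)

lemma geometric_summable_on_int: "(\<lambda>n. q ^ nat \<bar>n\<bar>) summable_on (UNIV :: int set)" if "0 \<le> q" "q < 1" for q :: real
proof -
  have "((\<lambda>n. q ^ nat \<bar>int n\<bar>) has_sum (\<Sum>\<^sub>\<infinity>n. q ^ n)) UNIV"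
    using has_sum_infsum[OF geometric_summable_on_nat[OF that]] by simp
  moreover have "((\<lambda>n. q ^ nat \<bar>- int (Suc n)\<bar>) has_sum (q * (\<Sum>\<^sub>\<infinity>n. q ^ n))) UNIV"
    using has_sum_cmult_right[OF has_sum_infsum[OF geometric_summable_on_nat[OF that]], of q]
    by (simp add: nat_add_distrib)
  ultimately have "((\<lambda>n. q ^ nat \<bar>n\<bar>) has_sum (\<Sum>\<^sub>\<infinity>n. q ^ n) + q * (\<Sum>\<^sub>\<infinity>n. q ^ n)) (UNIV :: int set)"
    by (rule has_sum_int_split)
  then show ?thesis by (auto simp: summable_on_def)
qed

lemma has_sum_if_sums:
  fixes f :: "nat \<Rightarrow> complex"
  assumes "f summable_on UNIV" "f sums s"
  shows "(f has_sum s) UNIV"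
  using has_sum_infsum[OF assms(1)] has_sum_imp_sums sums_unique2 assms(2) by metis

text \<open>
  Inserting the Taylor series of the orbit coefficients gives a double series, absolutely convergent because its
  coefficients decay like \<open>R\<close> to the power \<open>- \<bar>n\<bar> - k\<close> for \<open>R\<close> twice as large as all coordinates of the point.
\<close>

lemma taylor_expansion:
  assumes F: "F \<in> H_Omega" and p: "p \<in> Omega"
  shows "((\<lambda>(n, k). taylor_coeff F n k * mode_base n p * coord_A p ^ k) has_sum F p) UNIV"
proof -
  let ?t = "\<lambda>n k. taylor_coeff F n k * mode_base n p * coord_A p ^ k"
  note F' = H_Omega_swap[OF F]
  define L where "L = 1 + cmod (coord_A p) + cmod (coord_B p) + cmod (coord_C p)"
  have L: "L \<ge> 1" "cmod (coord_A p) \<le> L" "cmod (coord_B p) \<le> L" "cmod (coord_C p) \<le> L"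
    by (auto simp: L_def)
  obtain M where M: "M \<ge> 0" "\<And>n k. cmod (taylor_coeff F n k) \<le> M / (2 * L) ^ (nat \<bar>n\<bar> + k)"
    using taylor_coeff_bound[OF F, of "2 * L"] L(1) by auto
  have bound: "cmod (?t n k) \<le> M * ((1/2) ^ nat \<bar>n\<bar> * (1/2) ^ k)" for n k
  proof -
    have "cmod (?t n k) \<le> M / (2 * L) ^ (nat \<bar>n\<bar> + k) * L ^ nat \<bar>n\<bar> * L ^ k"
      unfolding norm_mult norm_power using M L
      by (intro mult_mono norm_mode_base_le power_mono mult_nonneg_nonneg divide_nonneg_nonneg zero_le_power) auto
    also have "\<dots> = M * ((1/2) ^ nat \<bar>n\<bar> * (1/2) ^ k)"
      using L(1) by (simp add: power_add power_mult_distrib power_divide)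
    finally show ?thesis .
  qed
  have "(\<lambda>(n, k). (1/2) ^ nat \<bar>n\<bar> * (1/2) ^ k :: real) summable_on (UNIV :: int set) \<times> (UNIV :: nat set)"
    by (intro summable_on_times_nonneg geometric_summable_on_int geometric_summable_on_nat) auto
  then have "(\<lambda>x. M * (case x of (n, k) \<Rightarrow> (1/2) ^ nat \<bar>n\<bar> * (1/2) ^ k)) summable_on (UNIV :: int set) \<times> (UNIV :: nat set)"
    by (rule summable_on_cmult_right)
  then have "(\<lambda>x. cmod (case x of (n, k) \<Rightarrow> ?t n k)) summable_on (UNIV \<times> UNIV)"
    by (rule Infinite_Sum.abs_summable_on_comparison_test') (use bound in \<open>auto simp: case_prod_unfold\<close>)
  then have summ: "(\<lambda>(n, k). ?t n k) summable_on (UNIV \<times> UNIV)" by (rule abs_summable_summable)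
  define g where "g n = (if n \<ge> 0 then orbit_coeff F (nat n) (coord_A p) else orbit_coeff (swapped F) (nat (- n)) (coord_A p)) * mode_base n p" for n
  have inner: "((\<lambda>k. ?t n k) has_sum g n) UNIV" for n
  proof (rule has_sum_if_sums)
    show "?t n summable_on UNIV" by (rule summable_on_SigmaD1[OF summ]) simp
    have "(\<lambda>k. taylor_coeff F n k * coord_A p ^ k) sums
        (if n \<ge> 0 then orbit_coeff F (nat n) (coord_A p) else orbit_coeff (swapped F) (nat (- n)) (coord_A p))"
      unfolding taylor_coeff_def orbit_coeff_def
      using laurent_family.coeff_sums[OF laurent_family_H_Omega[OF F]]
        laurent_family.coeff_sums[OF laurent_family_H_Omega[OF F']] by (cases "n \<ge> 0") simp_all
    from sums_mult2[OF this, of "mode_base n p"]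
    show "?t n sums g n" unfolding g_def by (simp only: mult_ac)
  qed
  have g: "g summable_on UNIV"
  proof -
    have "(\<lambda>n. infsum (\<lambda>k. ?t n k) UNIV) summable_on UNIV"
      using summable_on_SigmaD[OF summ] inner by (auto simp: summable_on_def)
    moreover have "(\<lambda>n. infsum (\<lambda>k. ?t n k) UNIV) = g"
      by (intro ext infsumI inner)
    ultimately show ?thesis by (simp only:)
  qed
  have "(g has_sum ((\<Sum>n. orbit_coeff F n (coord_A p) * coord_B p ^ n) +
     (\<Sum>n. orbit_coeff (swapped F) (Suc n) (coord_A p) * coord_C p ^ Suc n))) UNIV"
  proof (intro has_sum_int_split has_sum_if_sums)
    have inj: "inj int" "inj (\<lambda>n. - int (Suc n))" by (auto simp: inj_on_def)
    show "(\<lambda>n. g (int n)) summable_on UNIV"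
      using summable_on_reindex[OF inj(1), of g] summable_on_subset_banach[OF g] by (simp add: o_def)
    show "(\<lambda>n. g (- int (Suc n))) summable_on UNIV"
      using summable_on_reindex[OF inj(2), of g] summable_on_subset_banach[OF g] by (simp add: o_def)
    have gi: "g (int n) = orbit_coeff F n (coord_A p) * coord_B p ^ n" for n
      by (simp add: g_def mode_base_def)
    show "(\<lambda>n. g (int n)) sums (\<Sum>n. orbit_coeff F n (coord_A p) * coord_B p ^ n)"
      unfolding gi by (rule summable_sums[OF orbit_coeff_summable[OF F]])
    have "nat (- (- int (Suc n))) = Suc n" for n by simp
    then have gj: "g (- int (Suc n)) = orbit_coeff (swapped F) (Suc n) (coord_A p) * coord_C p ^ Suc n" for n
      unfolding g_def mode_base_def by (simp del: power_Suc of_nat_Suc)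
    have "summable (\<lambda>n. orbit_coeff (swapped F) (Suc n) (coord_A p) * coord_C p ^ Suc n)"
      using orbit_coeff_summable[OF F', of "coord_A p" "coord_C p"] by (subst summable_Suc_iff)
    then show "(\<lambda>n. g (- int (Suc n))) sums (\<Sum>n. orbit_coeff (swapped F) (Suc n) (coord_A p) * coord_C p ^ Suc n)"
      unfolding gj by (rule summable_sums)
  qed
  then have "(g has_sum F p) UNIV" unfolding H_Omega_laurent_expansion[OF F p] .
  then have "((\<lambda>(n, k). ?t n k) has_sum F p) (UNIV \<times> UNIV)"
    by (intro has_sum_SigmaI[OF _ _ summ]) (use inner in auto)
  then show ?thesis by simp
qed

section \<open>Expansion in Poisson modes\<close>

text \<open>
  The coefficient of a mode, collected from all the monomials in which it occurs.
\<close>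

definition mode_coeff :: "(riemann_sphere \<times> riemann_sphere \<Rightarrow> complex) \<Rightarrow> int \<Rightarrow> nat \<Rightarrow> complex" where
  "mode_coeff F n m = (-1) ^ nat \<bar>n\<bar> *
     (\<Sum>\<^sub>\<infinity>k. taylor_coeff F n k * of_real (jacobi_power_coeff (nat \<bar>n\<bar>) k (m - nat \<bar>n\<bar>)))"

lemma jacobi_power_coeff_eq_0: "k < j \<Longrightarrow> jacobi_power_coeff l k j = 0"
  by (simp add: jacobi_power_coeff_def jacobi_inner_low_degree degree_monom_eq)

text \<open>
  The triple series that results from expanding the power of \<open>A\<close> in every monomial into Jacobi polynomials of
  degree \<open>j\<close>. Summing over \<open>j\<close> first gives the monomial expansion, summing over \<open>k\<close> first gives the mode
  expansion. The terms with \<open>j > k\<close> vanish, so that \<open>j\<close> and \<open>k\<close> can run over all natural numbers.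
\<close>

definition refined_term :: "(riemann_sphere \<times> riemann_sphere \<Rightarrow> complex) \<Rightarrow> riemann_sphere \<times> riemann_sphere \<Rightarrow> int \<Rightarrow> nat \<Rightarrow> nat \<Rightarrow> complex" where
  "refined_term F p n k j = taylor_coeff F n k * of_real (jacobi_power_coeff (nat \<bar>n\<bar>) k j) *
     ((-1) ^ nat \<bar>n\<bar> * jacobi_mode n (nat \<bar>n\<bar> + j) p)"

text \<open>
  All factors apart from the Taylor coefficient grow at most like \<open>Q\<close> to the power \<open>\<bar>n\<bar> + k\<close> with \<open>Q\<close> depending
  on \<open>K\<close>, so the decay of the Taylor coefficients with \<open>R = 4 Q\<close> dominates. The resulting factor \<open>(1/4)\<^sup>k\<close> is a
  product of two factors \<open>(1/2)\<^sup>k\<close>, one of which is at most \<open>(1/2)\<^sup>j\<close> as \<open>j \<le> k\<close>.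
\<close>

lemma refined_term_bound:
  assumes F: "F \<in> H_Omega" and K: "compact_in_Omega K"
  shows "\<exists>M\<ge>0. \<forall>p\<in>K. \<forall>n k j. cmod (refined_term F p n k j) \<le> M * ((1/2) ^ nat \<bar>n\<bar> * ((1/2) ^ k * (1/2) ^ j))"
proof -
  obtain L where L: "L \<ge> 1" "\<And>p. p \<in> K \<Longrightarrow> cmod (coord_A p) \<le> L" "\<And>p. p \<in> K \<Longrightarrow> cmod (coord_A p - 1) \<le> L"
    "\<And>p. p \<in> K \<Longrightarrow> cmod (coord_B p) \<le> L" "\<And>p. p \<in> K \<Longrightarrow> cmod (coord_C p) \<le> L"
    using coords_bounded_on_compact[OF K] by metis
  \<comment> \<open>\<open>192 = 48 * 4\<close> combines the bounds for the coefficients of \<open>x\<^sup>k\<close> and for the modes.\<close>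
  define Q where "Q = 192 * L"
  have Q: "Q \<ge> 1" using L(1) by (simp add: Q_def)
  obtain M where M: "M \<ge> 0" "\<And>n k. cmod (taylor_coeff F n k) \<le> M / (4 * Q) ^ (nat \<bar>n\<bar> + k)"
    using taylor_coeff_bound[OF F, of "4 * Q"] Q by auto
  have "cmod (refined_term F p n k j) \<le> M * ((1/2) ^ nat \<bar>n\<bar> * ((1/2) ^ k * (1/2) ^ j))" if p: "p \<in> K" for p n k j
  proof (cases "k < j")
    case True
    then show ?thesis using M(1) by (simp add: refined_term_def jacobi_power_coeff_eq_0)
  next
    case False
    define l where "l = nat \<bar>n\<bar>"
    have "cmod (refined_term F p n k j) =
        cmod (taylor_coeff F n k) * \<bar>jacobi_power_coeff l k j\<bar> * cmod (jacobi_mode n (l + j) p)"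
      by (simp add: refined_term_def norm_mult norm_power l_def)
    also have "\<dots> \<le> M / (4 * Q) ^ (l + k) * 48 ^ (l + j) * (4 * L) ^ (l + j)"
    proof (intro mult_mono)
      show "cmod (jacobi_mode n (l + j) p) \<le> (4 * L) ^ (l + j)"
        by (rule norm_jacobi_mode_le) (use L p in \<open>auto simp: l_def\<close>)
      show "cmod (taylor_coeff F n k) \<le> M / (4 * Q) ^ (l + k)" using M(2) by (simp add: l_def)
    qed (use abs_jacobi_power_coeff_le M(1) Q in auto)
    also have "\<dots> = M / (4 * Q) ^ (l + k) * Q ^ (l + j)"
    proof -
      have "48 ^ (l + j) * (4 * L) ^ (l + j) = Q ^ (l + j)"
        unfolding power_mult_distrib[symmetric] by (simp add: Q_def)
      then show ?thesis by (simp only: mult.assoc)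
    qed
    also have "\<dots> \<le> M / (4 * Q) ^ (l + k) * Q ^ (l + k)"
      using Q M(1) False by (intro mult_left_mono power_increasing) auto
    also have "\<dots> = M * (1/4) ^ (l + k)" using Q by (simp add: power_mult_distrib power_divide)
    also have "\<dots> \<le> M * ((1/2) ^ l * ((1/2) ^ k * (1/2) ^ j))"
    proof (intro mult_left_mono M(1))
      have "(1/4 :: real) ^ (l + k) = (1/4) ^ l * ((1/2) ^ k * (1/2) ^ k)"
      proof -
        have "(1/2 :: real) ^ k * (1/2) ^ k = (1/4) ^ k" unfolding power_mult_distrib[symmetric] by simp
        then show ?thesis by (simp only: power_add)
      qed
      also have "\<dots> \<le> (1/2) ^ l * ((1/2) ^ k * (1/2) ^ j)"
        using False by (intro mult_mono power_mono power_decreasing mult_nonneg_nonneg zero_le_power) auto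
      finally show "(1/4 :: real) ^ (l + k) \<le> (1/2) ^ l * ((1/2) ^ k * (1/2) ^ j)" .
    qed
    finally show ?thesis by (simp add: l_def)
  qed
  then show ?thesis using M(1) by blast
qed

lemma refined_term_sum_degree:
  assumes "p \<in> Omega"
  shows "((\<lambda>j. refined_term F p n k j) has_sum (taylor_coeff F n k * mode_base n p * coord_A p ^ k)) UNIV"
proof -
  define l where "l = nat \<bar>n\<bar>"
  have s: "(-1) ^ l * ((-1) ^ l * x) = x" for x :: complex
    by (simp flip: mult.assoc power_mult_distrib)
  have t: "refined_term F p n k j = taylor_coeff F n k * mode_base n p *
      (of_real (jacobi_power_coeff l k j) * poly (jacobi l j) (coord_A p))" for j
  proof -
    have m: "(-1) ^ l * jacobi_mode n (l + j) p = mode_base n p * poly (jacobi l j) (coord_A p)"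
      using assms s by (simp add: jacobi_mode_def l_def mult.assoc)
    show ?thesis unfolding refined_term_def l_def[symmetric] m by (simp only: mult_ac)
  qed
  have "(\<Sum>j\<le>k. refined_term F p n k j) = taylor_coeff F n k * mode_base n p * coord_A p ^ k"
    unfolding t sum_distrib_left[symmetric] power_eq_sum_jacobi[of "coord_A p" k l, symmetric] ..
  then have "((\<lambda>j. refined_term F p n k j) has_sum (taylor_coeff F n k * mode_base n p * coord_A p ^ k)) {..k}"
    by (intro has_sum_finiteI) auto
  moreover have "(refined_term F p n k has_sum s) {..k} \<longleftrightarrow> (refined_term F p n k has_sum s) UNIV" for s
    by (rule has_sum_cong_neutral) (auto simp: refined_term_def jacobi_power_coeff_eq_0)
  ultimately show ?thesis by blast
qed

lemma dominating_summable:
  "(\<lambda>(n, x). (1/2) ^ nat \<bar>n\<bar> * (case x of (k, j) \<Rightarrow> (1/2) ^ k * (1/2) ^ j) :: real) summable_on (UNIV :: int set) \<times> (UNIV :: (nat \<times> nat) set)"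
proof -
  have "(\<lambda>(k, j). (1/2) ^ k * (1/2) ^ j :: real) summable_on (UNIV :: nat set) \<times> (UNIV :: nat set)"
    by (intro summable_on_times_nonneg geometric_summable_on_nat) auto
  then show ?thesis
    by (intro summable_on_times_nonneg[OF geometric_summable_on_int]) (simp_all add: case_prod_unfold)
qed

lemma refined_summable:
  assumes F: "F \<in> H_Omega" and p: "p \<in> Omega"
  shows "(\<lambda>(n, k, j). refined_term F p n k j) summable_on UNIV"
proof -
  have "topspace (subtopology sphere2_topology Omega) = Omega"
    using UNIV_option_conv by (auto simp: topspace_subtopology)
  then have "compact_in_Omega {p}" using p by (simp only: compactin_sing)
  from refined_term_bound[OF F this] obtain M where M0: "M \<ge> 0"
    "\<forall>q\<in>{p}. \<forall>n k j. cmod (refined_term F q n k j) \<le> M * ((1/2) ^ nat \<bar>n\<bar> * ((1/2) ^ k * (1/2) ^ j))"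
    by (elim exE conjE)
  from M0(2) have M: "cmod (refined_term F p n k j) \<le> M * ((1/2) ^ nat \<bar>n\<bar> * ((1/2) ^ k * (1/2) ^ j))" for n k j
    by (simp only: ball_simps)
  have "(\<lambda>y. M * (case y of (n, x) \<Rightarrow> (1/2) ^ nat \<bar>n\<bar> * (case x of (k, j) \<Rightarrow> (1/2) ^ k * (1/2) ^ j))) summable_on (UNIV :: int set) \<times> (UNIV :: (nat \<times> nat) set)"
    by (intro summable_on_cmult_right dominating_summable)
  then have "(\<lambda>y. cmod (case y of (n, k, j) \<Rightarrow> refined_term F p n k j)) summable_on (UNIV :: int set) \<times> (UNIV :: (nat \<times> nat) set)"
    by (rule Infinite_Sum.abs_summable_on_comparison_test') (simp only: case_prod_unfold M)
  then have "(\<lambda>(n, k, j). refined_term F p n k j) summable_on (UNIV :: int set) \<times> (UNIV :: (nat \<times> nat) set)"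
    by (rule abs_summable_summable)
  then show ?thesis by (simp only: UNIV_Times_UNIV)
qed

lemma refined_expansion:
  assumes F: "F \<in> H_Omega" and p: "p \<in> Omega"
  shows "((\<lambda>(n, k, j). refined_term F p n k j) has_sum F p) UNIV"
proof -
  have eq: "(\<lambda>((n, k), j). refined_term F p n k j) summable_on UNIV \<longleftrightarrow> (\<lambda>(n, k, j). refined_term F p n k j) summable_on UNIV"
    by (rule summable_on_reindex_bij_witness[where i = "\<lambda>(n, k, j). ((n, k), j)" and j = "\<lambda>((n, k), j). (n, k, j)"]) auto
  have "((\<lambda>((n, k), j). refined_term F p n k j) has_sum F p) (UNIV \<times> UNIV)"
  proof (rule has_sum_SigmaI[OF _ taylor_expansion[OF F p]])
    fix x :: "int \<times> nat"
    obtain n k where x: "x = (n, k)" by (cases x)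
    show "((\<lambda>j. (\<lambda>((n, k), j). refined_term F p n k j) (x, j)) has_sum
        (\<lambda>(n, k). taylor_coeff F n k * mode_base n p * coord_A p ^ k) x) UNIV"
      unfolding x prod.case by (rule refined_term_sum_degree[OF p])
  next
    show "(\<lambda>((n, k), j). refined_term F p n k j) summable_on UNIV \<times> UNIV"
      using refined_summable[OF F p] by (simp only: UNIV_Times_UNIV eq)
  qed
  then have "((\<lambda>((n, k), j). refined_term F p n k j) has_sum F p) UNIV" by (simp only: UNIV_Times_UNIV)
  moreover have "((\<lambda>((n, k), j). refined_term F p n k j) has_sum F p) UNIV \<longleftrightarrow> ((\<lambda>(n, k, j). refined_term F p n k j) has_sum F p) UNIV"
    by (rule has_sum_reindex_bij_witness[where i = "\<lambda>(n, k, j). ((n, k), j)" and j = "\<lambda>((n, k), j). (n, k, j)"]) auto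
  ultimately show ?thesis by (simp only:)
qed

lemma refined_term_sum_power:
  assumes F: "F \<in> H_Omega" and p: "p \<in> Omega"
  shows "((\<lambda>k. refined_term F p n k j) has_sum (mode_coeff F n (nat \<bar>n\<bar> + j) * jacobi_mode n (nat \<bar>n\<bar> + j) p)) UNIV"
proof -
  define l where "l = nat \<bar>n\<bar>"
  obtain M where M: "M \<ge> 0" "\<And>n k. cmod (taylor_coeff F n k) \<le> M / 2 ^ (nat \<bar>n\<bar> + k)"
    using taylor_coeff_bound[OF F, of 2] by auto
  have "(\<lambda>k. M * 48 ^ (l + j) * (1/2) ^ k) summable_on (UNIV :: nat set)"
    by (intro summable_on_cmult_right geometric_summable_on_nat) auto
  then have "(\<lambda>k. cmod (taylor_coeff F n k * of_real (jacobi_power_coeff l k j))) summable_on UNIV"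
  proof (rule Infinite_Sum.abs_summable_on_comparison_test')
    fix k
    have "cmod (taylor_coeff F n k * of_real (jacobi_power_coeff l k j)) \<le> M / 2 ^ (l + k) * 48 ^ (l + j)"
      unfolding norm_mult norm_of_real
      using M abs_jacobi_power_coeff_le[of l k j] by (intro mult_mono) (auto simp: l_def)
    also have "\<dots> \<le> M / 2 ^ k * 48 ^ (l + j)"
      using M(1) by (intro mult_right_mono divide_left_mono power_increasing) auto
    finally show "cmod (taylor_coeff F n k * of_real (jacobi_power_coeff l k j)) \<le> M * 48 ^ (l + j) * (1/2) ^ k"
      by (simp add: power_divide mult_ac)
  qed
  then have "(\<lambda>k. taylor_coeff F n k * of_real (jacobi_power_coeff l k j)) summable_on UNIV"
    by (rule abs_summable_summable)
  from has_sum_cmult_left[OF has_sum_infsum[OF this], of "(-1) ^ l * jacobi_mode n (l + j) p"]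
  show ?thesis unfolding refined_term_def mode_coeff_def l_def[symmetric] by (simp add: mult_ac)
qed

definition mode_index :: "(nat \<times> int) set" where
  "mode_index = (SIGMA m:UNIV. {- int m..int m})"

lemma mode_index_iff: "(m, n) \<in> mode_index \<longleftrightarrow> \<bar>n\<bar> \<le> int m"
  by (auto simp: mode_index_def)

lemma mode_expansion:
  assumes F: "F \<in> H_Omega" and p: "p \<in> Omega"
  shows "((\<lambda>(m, n). mode_coeff F n m * jacobi_mode n m p) has_sum F p) mode_index"
proof -
  have "((\<lambda>(n, k, j). refined_term F p n k j) has_sum F p) UNIV \<longleftrightarrow>
      ((\<lambda>((n, j), k). refined_term F p n k j) has_sum F p) (UNIV \<times> UNIV)"
    by (rule has_sum_reindex_bij_witness[where j = "\<lambda>(n, k, j). ((n, j), k)" and i = "\<lambda>((n, j), k). (n, k, j)"]) auto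
  then have "((\<lambda>((n, j), k). refined_term F p n k j) has_sum F p) (UNIV \<times> UNIV)"
    using refined_expansion[OF F p] by simp
  then have "((\<lambda>(n, j). mode_coeff F n (nat \<bar>n\<bar> + j) * jacobi_mode n (nat \<bar>n\<bar> + j) p) has_sum F p) UNIV"
    by (rule has_sum_SigmaD) (use refined_term_sum_power[OF F p] in \<open>auto simp: case_prod_unfold\<close>)
  moreover have "((\<lambda>(n, j). mode_coeff F n (nat \<bar>n\<bar> + j) * jacobi_mode n (nat \<bar>n\<bar> + j) p) has_sum F p) UNIV \<longleftrightarrow>
     ((\<lambda>(m, n). mode_coeff F n m * jacobi_mode n m p) has_sum F p) mode_index"
    by (rule has_sum_reindex_bij_witness[where j = "\<lambda>(n, j). (nat \<bar>n\<bar> + j, n)" and i = "\<lambda>(m, n). (n, m - nat \<bar>n\<bar>)"])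
       (auto simp: mode_index_iff)
  ultimately show ?thesis by simp
qed

text \<open>
  The dominating series of the triple sum is a product of geometric series, so summing over \<open>k\<close> leaves
  a dominating series for the modes that is uniform on \<open>K\<close>.
\<close>

lemma mode_terms_dominated:
  assumes F: "F \<in> H_Omega" and K: "compact_in_Omega K"
  shows "\<exists>b. b summable_on mode_index \<and>
    (\<forall>p\<in>K. \<forall>x\<in>mode_index. cmod (case x of (m, n) \<Rightarrow> mode_coeff F n m * jacobi_mode n m p) \<le> b x)"
proof -
  obtain M where M: "M \<ge> 0"
    "\<And>p n k j. p \<in> K \<Longrightarrow> cmod (refined_term F p n k j) \<le> M * ((1/2) ^ nat \<bar>n\<bar> * ((1/2) ^ k * (1/2) ^ j))"
    using refined_term_bound[OF F K] by blast
  define S where "S = (\<Sum>\<^sub>\<infinity>k. (1/2 :: real) ^ k)"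
  have S: "((\<lambda>k. (1/2) ^ k) has_sum S) (UNIV :: nat set)"
    unfolding S_def by (intro has_sum_infsum geometric_summable_on_nat) auto
  define b where "b = (\<lambda>(m, n). M * S * ((1/2) ^ nat \<bar>n\<bar> * (1/2) ^ (m - nat \<bar>n\<bar>)))"
  have "(\<lambda>(n, j). (1/2) ^ nat \<bar>n\<bar> * (1/2) ^ j :: real) summable_on (UNIV :: int set) \<times> (UNIV :: nat set)"
    by (intro summable_on_times_nonneg geometric_summable_on_int geometric_summable_on_nat) auto
  then have "(\<lambda>x. M * S * (case x of (n, j) \<Rightarrow> (1/2) ^ nat \<bar>n\<bar> * (1/2) ^ j)) summable_on (UNIV :: int set) \<times> (UNIV :: nat set)"
    by (rule summable_on_cmult_right)
  moreover have "(\<lambda>x. M * S * (case x of (n, j) \<Rightarrow> (1/2) ^ nat \<bar>n\<bar> * (1/2) ^ j)) summable_on (UNIV :: int set) \<times> (UNIV :: nat set) \<longleftrightarrow>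
     b summable_on mode_index"
    by (rule summable_on_reindex_bij_witness[where j = "\<lambda>(n, j). (nat \<bar>n\<bar> + j, n)" and i = "\<lambda>(m, n). (n, m - nat \<bar>n\<bar>)"])
       (auto simp: mode_index_iff b_def)
  ultimately have "b summable_on mode_index" by simp
  moreover have "cmod (case x of (m, n) \<Rightarrow> mode_coeff F n m * jacobi_mode n m p) \<le> b x"
    if p: "p \<in> K" and x: "x \<in> mode_index" for p x
  proof -
    obtain m n where mn: "x = (m, n)" "\<bar>n\<bar> \<le> int m" using x by (cases x) (auto simp: mode_index_iff)
    define j where "j = m - nat \<bar>n\<bar>"
    have m: "m = nat \<bar>n\<bar> + j" using mn(2) by (simp add: j_def)
    have pO: "p \<in> Omega" using p compact_in_Omega_subset[OF K] by blast
    have g: "((\<lambda>k. M * ((1/2) ^ nat \<bar>n\<bar> * (1/2) ^ j) * (1/2) ^ k) has_sum M * ((1/2) ^ nat \<bar>n\<bar> * (1/2) ^ j) * S) UNIV"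
      by (rule has_sum_cmult_right[OF S])
    have "cmod (mode_coeff F n (nat \<bar>n\<bar> + j) * jacobi_mode n (nat \<bar>n\<bar> + j) p) \<le> M * ((1/2) ^ nat \<bar>n\<bar> * (1/2) ^ j) * S"
      by (rule norm_infsum_le[OF refined_term_sum_power[OF F pO] g])
         (use M(2)[OF p, of n _ j] in \<open>simp add: mult_ac\<close>)
    then show ?thesis by (simp add: mn(1) b_def m mult_ac)
  qed
  ultimately show ?thesis by blast
qed

text \<open>
  Convergence along the finite sets of modes covers every order of summation: the triangular
  partial sums as well as those of an arbitrary enumeration.
\<close>

lemma uniform_mode_expansion:
  assumes F: "F \<in> H_Omega" and K: "compact_in_Omega K"
  shows "uniform_limit K (\<lambda>X p. \<Sum>(m, n)\<in>X. mode_coeff F n m * jacobi_mode n m p) F (finite_subsets_at_top mode_index)"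
    and "\<exists>l. uniform_limit K (\<lambda>X p. \<Sum>(m, n)\<in>X. cmod (mode_coeff F n m * jacobi_mode n m p)) l (finite_subsets_at_top mode_index)"
proof -
  obtain b where b: "b summable_on mode_index"
    "\<And>p x. p \<in> K \<Longrightarrow> x \<in> mode_index \<Longrightarrow> cmod (case x of (m, n) \<Rightarrow> mode_coeff F n m * jacobi_mode n m p) \<le> b x"
    using mode_terms_dominated[OF F K] by blast
  show "uniform_limit K (\<lambda>X p. \<Sum>(m, n)\<in>X. mode_coeff F n m * jacobi_mode n m p) F (finite_subsets_at_top mode_index)"
    by (rule Weierstrass_m_test_general'[OF _ _ b(1)])
       (use b(2) mode_expansion[OF F] compact_in_Omega_subset[OF K] in auto)
  have "uniform_limit K (\<lambda>X p. \<Sum>x\<in>X. cmod (case x of (m, n) \<Rightarrow> mode_coeff F n m * jacobi_mode n m p))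
     (\<lambda>p. \<Sum>\<^sub>\<infinity>x\<in>mode_index. cmod (case x of (m, n) \<Rightarrow> mode_coeff F n m * jacobi_mode n m p)) (finite_subsets_at_top mode_index)"
    by (rule Weierstrass_m_test_general[OF _ b(1)]) (use b(2) in auto)
  then show "\<exists>l. uniform_limit K (\<lambda>X p. \<Sum>(m, n)\<in>X. cmod (mode_coeff F n m * jacobi_mode n m p)) l (finite_subsets_at_top mode_index)"
    by (auto simp: case_prod_unfold)
qed

lemma filterlim_triangles:
  "filterlim (\<lambda>M. SIGMA m:{..M}. {- int m..int m}) (finite_subsets_at_top mode_index) sequentially"
  unfolding filterlim_finite_subsets_at_top
proof (intro allI impI)
  fix X assume X: "finite X \<and> X \<subseteq> mode_index"
  obtain M where M: "\<And>x. x \<in> X \<Longrightarrow> fst x \<le> M"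
    using X by (metis finite_imageI finite_nat_set_iff_bounded_le imageI)
  have "X \<subseteq> (SIGMA m:{..N}. {- int m..int m})" if "N \<ge> M" for N
    using X M that by (force simp: mode_index_def)
  then show "\<forall>\<^sub>F N in sequentially. finite (SIGMA m:{..N}. {- int m..int m}) \<and>
      X \<subseteq> (SIGMA m:{..N}. {- int m..int m}) \<and> (SIGMA m:{..N}. {- int m..int m}) \<subseteq> mode_index"
    unfolding eventually_sequentially by (intro exI[of _ M]) (auto simp: mode_index_def)
qed

lemma filterlim_enumeration:
  assumes "bij_betw e (UNIV :: nat set) I"
  shows "filterlim (\<lambda>N. e ` {..<N}) (finite_subsets_at_top I) sequentially"
  unfolding filterlim_finite_subsets_at_top
proof (intro allI impI)
  fix X assume X: "finite X \<and> X \<subseteq> I"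
  have "\<exists>k. e k = x" if "x \<in> X" for x using assms X that by (auto simp: bij_betw_def)
  then obtain k where k: "\<And>x. x \<in> X \<Longrightarrow> e (k x) = x" by metis
  obtain N0 where N0: "\<And>x. x \<in> X \<Longrightarrow> k x < N0"
    using X by (metis finite_imageI finite_nat_set_iff_bounded imageI)
  have "X \<subseteq> e ` {..<N}" if "N \<ge> N0" for N
  proof
    fix x assume "x \<in> X"
    then show "x \<in> e ` {..<N}" using k N0 that by (intro image_eqI[of _ _ "k x"]) (auto intro: less_le_trans)
  qed
  then show "\<forall>\<^sub>F N in sequentially. finite (e ` {..<N}) \<and> X \<subseteq> e ` {..<N} \<and> e ` {..<N} \<subseteq> I"
    unfolding eventually_sequentially using assms by (intro exI[of _ N0]) (auto simp: bij_betw_def)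
qed

section \<open>Uniqueness of coefficients and the Schauder basis\<close>

lemma continuous_inner_Omega:
  assumes G: "G \<in> H_Omega"
  shows "continuous_map H_topology euclidean (\<lambda>F. inner_Omega F G)"
proof -
  obtain K where K: "compact_in_Omega K" "range antidiagonal \<subseteq> K"
    using antidiagonal_in_compact by blast
  obtain N where N: "N > 0" "\<And>z. cmod (G (antidiagonal z)) \<le> N"
    using H_Omega_bounded_on_antidiagonal[OF G] by blast
  have "openin H_topology {F \<in> H_Omega. inner_Omega F G \<in> U}" if U: "open U" for U
  proof (subst openin_subopen, intro ballI)
    fix F0 assume "F0 \<in> {F \<in> H_Omega. inner_Omega F G \<in> U}"
    then have F0: "F0 \<in> H_Omega" "inner_Omega F0 G \<in> U" by auto
    then obtain e where e: "e > 0" "ball (inner_Omega F0 G) e \<subseteq> U" using U open_contains_ball by blast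
    let ?T = "{F \<in> H_Omega. \<forall>p\<in>K. cmod (F p - F0 p) < e / (2 * N)}"
    have "openin H_topology ?T"
      unfolding H_topology_def using F0(1) K(1) e(1) N(1) by (intro topology_generated_by_Basis) (auto intro!: exI[of _ F0] exI[of _ K])
    moreover have "F0 \<in> ?T" using F0 e N by simp
    moreover have "?T \<subseteq> {F \<in> H_Omega. inner_Omega F G \<in> U}"
    proof
      fix F assume F: "F \<in> ?T"
      have "inner_Omega F G - inner_Omega F0 G = inner_Omega (\<lambda>p. F p - F0 p) G"
        by (rule inner_Omega_diff_left[symmetric]) (use F F0 G in auto)
      also have "cmod \<dots> \<le> e / (2 * N) * N"
        by (rule norm_inner_Omega_le) (use F K(2) N(2) in \<open>auto intro!: less_imp_le\<close>)
      also have "\<dots> < e" using e(1) N(1) by simp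
      finally have "inner_Omega F G \<in> ball (inner_Omega F0 G) e" by (simp add: dist_norm norm_minus_commute)
      then show "F \<in> {F \<in> H_Omega. inner_Omega F G \<in> U}" using F e(2) by auto
    qed
    ultimately show "\<exists>T. openin H_topology T \<and> F0 \<in> T \<and> T \<subseteq> {F \<in> H_Omega. inner_Omega F G \<in> U}" by blast
  qed
  then show ?thesis unfolding continuous_map_def by simp
qed

text \<open>
  By orthogonality the inner product of a mode with the partial sums of an expansion is eventually
  constant, so that continuity of the inner product determines the coefficients of any expansion.
\<close>

lemma inner_Omega_limit:
  assumes lim: "limitin H_topology f F sequentially" and G: "G \<in> H_Omega"
    and v: "\<forall>\<^sub>F N in sequentially. inner_Omega (f N) G = v"
  shows "inner_Omega F G = v"
proof -
  have "limitin euclidean ((\<lambda>F. inner_Omega F G) \<circ> f) (inner_Omega F G) sequentially"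
    by (rule continuous_map_limit[OF continuous_inner_Omega[OF G] lim])
  then have "(\<lambda>N. inner_Omega (f N) G) \<longlonglongrightarrow> inner_Omega F G" by (simp add: o_def)
  moreover have "(\<lambda>N. inner_Omega (f N) G) \<longlonglongrightarrow> v"
    using v by (rule tendsto_eventually)
  ultimately show ?thesis by (rule LIMSEQ_unique)
qed

lemma mode_sqnorm_nz: "\<bar>n\<bar> \<le> int m \<Longrightarrow> mode_sqnorm (nat \<bar>n\<bar>) m \<noteq> 0"
  using mode_sqnorm_pos[of "nat \<bar>n\<bar>" m] by (simp add: nat_le_iff order_less_imp_not_eq2)

lemma partial_sum_eq:
  "poisson_partial_sum c M p = (\<Sum>(m, n)\<in>(SIGMA m:{..M}. {- int m..int m}). c n m * jacobi_mode n m p)"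
  unfolding poisson_partial_sum_def
  by (subst sum.Sigma[symmetric]) (auto intro!: sum.cong simp: poisson_mode_eq)

lemma poisson_expansion_coeff:
  assumes "poisson_expansion F c" "\<bar>n\<bar> \<le> int m"
  shows "c n m = inner_Omega F (poisson_mode n m) / of_real (mode_sqnorm (nat \<bar>n\<bar>) m)"
proof -
  have "inner_Omega F (jacobi_mode n m) = c n m * of_real (mode_sqnorm (nat \<bar>n\<bar>) m)"
  proof (rule inner_Omega_limit)
    show "limitin H_topology (poisson_partial_sum c) F sequentially"
      using assms(1) by (simp add: poisson_expansion_def)
    have "inner_Omega (poisson_partial_sum c M) (jacobi_mode n m) = c n m * of_real (mode_sqnorm (nat \<bar>n\<bar>) m)"
      if "M \<ge> m" for M
    proof -
      let ?X = "SIGMA m:{..M}. {- int m..int m}"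
      have "poisson_partial_sum c M = (\<lambda>p. \<Sum>x\<in>?X. c (snd x) (fst x) * jacobi_mode (snd x) (fst x) p)"
        by (simp add: partial_sum_eq case_prod_unfold fun_eq_iff)
      then have "inner_Omega (poisson_partial_sum c M) (jacobi_mode n m) =
          (\<Sum>x\<in>?X. c (snd x) (fst x) * inner_Omega (jacobi_mode (snd x) (fst x)) (jacobi_mode n m))"
        by (simp only:) (intro inner_Omega_sum_left jacobi_mode_in_H_Omega)
      also have "\<dots> = (\<Sum>x\<in>?X. if x = (m, n) then c n m * of_real (mode_sqnorm (nat \<bar>n\<bar>) m) else 0)"
        by (intro sum.cong refl) (use assms(2) in \<open>auto simp: inner_jacobi_modes split: if_splits\<close>)
      also have "\<dots> = c n m * of_real (mode_sqnorm (nat \<bar>n\<bar>) m)"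
        using that assms(2) by (subst sum.delta) auto
      finally show ?thesis .
    qed
    then show "\<forall>\<^sub>F N in sequentially. inner_Omega (poisson_partial_sum c N) (jacobi_mode n m) =
        c n m * of_real (mode_sqnorm (nat \<bar>n\<bar>) m)"
      by (auto simp: eventually_sequentially)
  qed (rule jacobi_mode_in_H_Omega)
  then show ?thesis using mode_sqnorm_nz[OF assms(2)] by (simp add: poisson_mode_eq[OF assms(2)])
qed

lemma partial_sum_in_H_Omega: "poisson_partial_sum c M \<in> H_Omega"
proof -
  have "poisson_partial_sum c M = (\<lambda>p. \<Sum>x\<in>(SIGMA m:{..M}. {- int m..int m}). c (snd x) (fst x) * jacobi_mode (snd x) (fst x) p)"
    by (simp add: partial_sum_eq case_prod_unfold fun_eq_iff)
  then show ?thesis by (simp only: H_Omega_sum jacobi_mode_in_H_Omega)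
qed

lemma poisson_expansion_mode_coeff:
  assumes F: "F \<in> H_Omega"
  shows "poisson_expansion F (mode_coeff F)"
  unfolding poisson_expansion_def limitin_H_topology_iff
proof (intro conjI allI impI F always_eventually partial_sum_in_H_Omega)
  fix K assume K: "compact_in_Omega K"
  show "uniform_limit K (poisson_partial_sum (mode_coeff F)) F sequentially"
    unfolding partial_sum_eq[abs_def]
    by (rule filterlim_compose[OF uniform_mode_expansion(1)[OF F K] filterlim_triangles])
qed

lemma inj_jacobi_mode: "inj_on (\<lambda>(m, n). jacobi_mode n m) mode_index"
proof (rule inj_onI, clarify)
  fix m n m' n' assume mn: "(m, n) \<in> mode_index" "(m', n') \<in> mode_index" and eq: "jacobi_mode n m = jacobi_mode n' m'"
  have "inner_Omega (jacobi_mode n m) (jacobi_mode n m) \<noteq> 0"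
    using mn mode_sqnorm_nz[of n m] by (simp add: inner_jacobi_modes mode_index_iff)
  then have "inner_Omega (jacobi_mode n m) (jacobi_mode n' m') \<noteq> 0" unfolding eq[symmetric] .
  then show "m = m' \<and> n = n'" using mn by (auto simp: inner_jacobi_modes mode_index_iff split: if_splits)
qed

text \<open>
  An expansion exists in the given order because the mode expansion converges absolutely. Its
  coefficients are quotients of inner products, which are continuous in \<open>F\<close>.
\<close>

lemma schauder_sequence_modes:
  assumes e: "bij_betw e (UNIV :: nat set) mode_index"
  shows "schauder_sequence H_topology (\<lambda>k. jacobi_mode (snd (e k)) (fst (e k)))"
proof -
  let ?b = "\<lambda>k. jacobi_mode (snd (e k)) (fst (e k))"
  let ?q = "\<lambda>k. of_real (mode_sqnorm (nat \<bar>snd (e k)\<bar>) (fst (e k))) :: complex"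
  have idx: "\<bar>snd (e k)\<bar> \<le> int (fst (e k))" for k
    using e mode_index_iff[of "fst (e k)" "snd (e k)"] by (auto simp: bij_betw_def)
  have q: "?q k \<noteq> 0" for k using mode_sqnorm_nz[OF idx[of k]] by simp
  have inner: "inner_Omega (?b j) (?b k) = (if j = k then ?q k else 0)" for j k
  proof -
    have "e j = e k \<longleftrightarrow> j = k" using e by (auto simp: bij_betw_def inj_on_eq_iff)
    then show ?thesis unfolding inner_jacobi_modes[OF idx idx] by (auto simp: prod_eq_iff)
  qed
  have unique: "c = (\<lambda>k. inner_Omega F (?b k) / ?q k)" if "schauder_expansion H_topology ?b F c" for F c
  proof
    fix k
    have "inner_Omega F (?b k) = c k * ?q k"
    proof (rule inner_Omega_limit)
      show "limitin H_topology (\<lambda>N x. \<Sum>k<N. c k * ?b k x) F sequentially"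
        using that by (simp add: schauder_expansion_def)
      have "inner_Omega (\<lambda>x. \<Sum>k<N. c k * ?b k x) (?b k) = c k * ?q k" if "N \<ge> Suc k" for N
      proof -
        have "inner_Omega (\<lambda>x. \<Sum>k<N. c k * ?b k x) (?b k) = (\<Sum>j<N. c j * inner_Omega (?b j) (?b k))"
          by (intro inner_Omega_sum_left jacobi_mode_in_H_Omega)
        also have "\<dots> = (\<Sum>j<N. if j = k then c k * ?q k else 0)"
          by (intro sum.cong refl) (simp add: inner)
        also have "\<dots> = c k * ?q k" using that by (subst sum.delta) auto
        finally show ?thesis .
      qed
      then show "\<forall>\<^sub>F N in sequentially. inner_Omega (\<lambda>x. \<Sum>k<N. c k * ?b k x) (?b k) = c k * ?q k"
        unfolding eventually_sequentially by blast
    qed (rule jacobi_mode_in_H_Omega)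
    then show "c k = inner_Omega F (?b k) / ?q k" using q by simp
  qed
  have exists: "schauder_expansion H_topology ?b F (\<lambda>k. mode_coeff F (snd (e k)) (fst (e k)))" if F: "F \<in> H_Omega" for F
    unfolding schauder_expansion_def limitin_H_topology_iff
  proof (intro conjI allI impI F always_eventually H_Omega_sum jacobi_mode_in_H_Omega)
    fix K assume K: "compact_in_Omega K"
    have "uniform_limit K (\<lambda>N p. \<Sum>(m, n)\<in>e ` {..<N}. mode_coeff F n m * jacobi_mode n m p) F sequentially"
      by (rule filterlim_compose[OF uniform_mode_expansion(1)[OF F K] filterlim_enumeration[OF e]])
    moreover have "(\<Sum>(m, n)\<in>e ` {..<N}. mode_coeff F n m * jacobi_mode n m p) =
        (\<Sum>k<N. mode_coeff F (snd (e k)) (fst (e k)) * ?b k p)" for N p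
      using e by (subst sum.reindex) (auto simp: bij_betw_def inj_on_def case_prod_unfold)
    ultimately show "uniform_limit K (\<lambda>N p. \<Sum>k<N. mode_coeff F (snd (e k)) (fst (e k)) * ?b k p) F sequentially"
      by simp
  qed
  have ex1: "\<exists>!c. schauder_expansion H_topology ?b F c" if "F \<in> H_Omega" for F
    using exists[OF that] unique by blast
  have the: "(THE c. schauder_expansion H_topology ?b F c) k = inner_Omega F (?b k) * (1 / ?q k)" if "F \<in> H_Omega" for F k
    using unique[OF theI'[OF ex1[OF that]]] by (simp add: fun_eq_iff)
  have "continuous_map H_topology euclidean (\<lambda>F. (THE c. schauder_expansion H_topology ?b F c) k)" for k
  proof (rule continuous_map_eq)
    have "continuous_map euclidean euclidean (\<lambda>v. v * (1 / ?q k))"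
      using q[of k] by (auto intro!: continuous_intros)
    from continuous_map_compose[OF continuous_inner_Omega[OF jacobi_mode_in_H_Omega] this]
    show "continuous_map H_topology euclidean (\<lambda>F. inner_Omega F (?b k) * (1 / ?q k))"
      by (simp add: o_def)
  qed (simp add: the)
  then show ?thesis
    unfolding schauder_sequence_def using ex1 jacobi_mode_in_H_Omega by auto
qed

lemma poisson_modes_eq:
  "{poisson_mode n m | n m. \<bar>n\<bar> \<le> int m} = (\<lambda>(m, n). jacobi_mode n m) ` mode_index"
  by (force simp: poisson_mode_eq mode_index_iff)

lemma schauder_basis_poisson_modes: "schauder_basis H_topology {poisson_mode n m | n m. \<bar>n\<bar> \<le> int m}"
  unfolding schauder_basis_def poisson_modes_eq
proof (intro conjI allI impI)
  let ?P = "\<lambda>(m, n). jacobi_mode n m"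
  show "countable (?P ` mode_index)" by simp
  have "infinite mode_index"
  proof -
    have "range (\<lambda>m. (m, 0)) \<subseteq> mode_index" by (auto simp: mode_index_iff)
    moreover have "infinite (range (\<lambda>m::nat. (m, 0::int)))"
      by (simp add: finite_image_iff inj_on_def)
    ultimately show ?thesis using finite_subset by blast
  qed
  then show "infinite (?P ` mode_index)" using inj_jacobi_mode by (simp add: finite_image_iff)
  fix b assume b: "bij_betw b (UNIV :: nat set) (?P ` mode_index)"
  define e where "e = the_inv_into mode_index ?P \<circ> b"
  have "bij_betw e UNIV mode_index"
    unfolding e_def using b bij_betw_the_inv_into[OF inj_on_imp_bij_betw[OF inj_jacobi_mode]] by (rule bij_betw_trans)
  then have "schauder_sequence H_topology (\<lambda>k. jacobi_mode (snd (e k)) (fst (e k)))"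
    by (rule schauder_sequence_modes)
  moreover have "?P (e k) = b k" for k
    unfolding e_def o_def using b by (intro f_the_inv_into_f[OF inj_jacobi_mode]) (auto simp: bij_betw_def)
  ultimately show "schauder_sequence H_topology b" by (simp add: case_prod_unfold)
qed

theorem theorem3p4:
  shows "schauder_basis H_topology {poisson_mode n m | n m. \<bar>n\<bar> \<le> int m} \<and>
    (\<forall>F \<in> H_Omega.
       (\<exists>!c. (\<forall>n m. \<bar>n\<bar> > int m \<longrightarrow> c n m = 0) \<and> poisson_expansion F c) \<and>
       (\<forall>c. poisson_expansion F c \<longrightarrow>
          (\<forall>p\<in>Omega. (\<lambda>m. \<Sum>n = - int m..int m. c n m * poisson_mode n m p) sums F p) \<and>
          (\<forall>p\<in>Omega. (\<lambda>(m, n). cmod (c n m * poisson_mode n m p))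
              summable_on (SIGMA m:UNIV. {- int m..int m})) \<and>
          (\<forall>K. compact_in_Omega K \<longrightarrow>
              uniform_limit K (poisson_partial_sum c) F sequentially \<and>
              uniformly_convergent_on K
                (\<lambda>M p. \<Sum>m\<le>M. \<Sum>n = - int m..int m. cmod (c n m * poisson_mode n m p))) \<and>
          (\<forall>m n. n \<le> m \<longrightarrow>
              c (int n) m = of_nat (2 * m + 1) * of_nat ((m + n) choose n) / of_nat (m choose n)
                * inner_Omega F (poisson_mode (int n) m) \<and>
              c (- int n) m = of_nat (2 * m + 1) * of_nat ((m + n) choose n) / of_nat (m choose n)
                * inner_Omega F (poisson_mode (- int n) m))))"
proof (intro conjI ballI)
  show "schauder_basis H_topology {poisson_mode n m | n m. \<bar>n\<bar> \<le> int m}"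
    by (rule schauder_basis_poisson_modes)
next
  fix F assume F: "F \<in> H_Omega"
  define c0 where "c0 n m = (if \<bar>n\<bar> \<le> int m then mode_coeff F n m else 0)" for n m
  have "poisson_partial_sum c0 = poisson_partial_sum (mode_coeff F)"
    unfolding poisson_partial_sum_def by (intro ext sum.cong refl) (auto simp: c0_def)
  then have c0: "poisson_expansion F c0"
    using poisson_expansion_mode_coeff[OF F] by (simp add: poisson_expansion_def)
  show "\<exists>!c. (\<forall>n m. \<bar>n\<bar> > int m \<longrightarrow> c n m = 0) \<and> poisson_expansion F c"
  proof (rule ex1I[of _ c0])
    show "(\<forall>n m. \<bar>n\<bar> > int m \<longrightarrow> c0 n m = 0) \<and> poisson_expansion F c0"
      using c0 by (simp add: c0_def)
    fix c assume c: "(\<forall>n m. \<bar>n\<bar> > int m \<longrightarrow> c n m = 0) \<and> poisson_expansion F c"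
    show "c = c0"
    proof (intro ext)
      fix n m show "c n m = c0 n m"
      proof (cases "\<bar>n\<bar> \<le> int m")
        case True
        then show ?thesis using poisson_expansion_coeff c c0 by metis
      next
        case False
        then show ?thesis using c by (simp add: c0_def)
      qed
    qed
  qed
  show "\<forall>c. poisson_expansion F c \<longrightarrow>
          (\<forall>p\<in>Omega. (\<lambda>m. \<Sum>n = - int m..int m. c n m * poisson_mode n m p) sums F p) \<and>
          (\<forall>p\<in>Omega. (\<lambda>(m, n). cmod (c n m * poisson_mode n m p))
              summable_on (SIGMA m:UNIV. {- int m..int m})) \<and>
          (\<forall>K. compact_in_Omega K \<longrightarrow>
              uniform_limit K (poisson_partial_sum c) F sequentially \<and>
              uniformly_convergent_on K
                (\<lambda>M p. \<Sum>m\<le>M. \<Sum>n = - int m..int m. cmod (c n m * poisson_mode n m p))) \<and>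
          (\<forall>m n. n \<le> m \<longrightarrow>
              c (int n) m = of_nat (2 * m + 1) * of_nat ((m + n) choose n) / of_nat (m choose n)
                * inner_Omega F (poisson_mode (int n) m) \<and>
              c (- int n) m = of_nat (2 * m + 1) * of_nat ((m + n) choose n) / of_nat (m choose n)
                * inner_Omega F (poisson_mode (- int n) m))"
  proof (intro allI impI conjI ballI)
    fix c assume c: "poisson_expansion F c"
    have eq: "c n m * poisson_mode n m p = mode_coeff F n m * jacobi_mode n m p" if "\<bar>n\<bar> \<le> int m" for n m p
      using poisson_expansion_coeff[OF c that] poisson_expansion_coeff[OF poisson_expansion_mode_coeff[OF F] that] that
      by (simp add: poisson_mode_eq)
    {
      fix p assume p: "p \<in> Omega"
      have sum: "((\<lambda>(m, n). c n m * poisson_mode n m p) has_sum F p) mode_index"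
        using mode_expansion[OF F p]
        by (rule has_sum_cong[THEN iffD1, rotated]) (auto simp: mode_index_iff eq)
      have "((\<lambda>m. \<Sum>n = - int m..int m. c n m * poisson_mode n m p) has_sum F p) UNIV"
        using sum unfolding mode_index_def by (rule has_sum_SigmaD) auto
      then show "(\<lambda>m. \<Sum>n = - int m..int m. c n m * poisson_mode n m p) sums F p"
        by (rule has_sum_imp_sums)
      have "(\<lambda>(m, n). c n m * poisson_mode n m p) summable_on mode_index"
        using sum by (auto simp: summable_on_def)
      then have "(\<lambda>x. cmod (case x of (m, n) \<Rightarrow> c n m * poisson_mode n m p)) summable_on mode_index"
        by (simp add: summable_on_iff_abs_summable_on_complex)
      then show "(\<lambda>(m, n). cmod (c n m * poisson_mode n m p)) summable_on (SIGMA m:UNIV. {- int m..int m})"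
        by (simp add: mode_index_def case_prod_unfold)
    }
    {
      fix K assume K: "compact_in_Omega K"
      show "uniform_limit K (poisson_partial_sum c) F sequentially"
        using c K by (simp add: poisson_expansion_def limitin_H_topology_iff)
      obtain l where "uniform_limit K (\<lambda>X p. \<Sum>(m, n)\<in>X. cmod (mode_coeff F n m * jacobi_mode n m p)) l (finite_subsets_at_top mode_index)"
        using uniform_mode_expansion(2)[OF F K] by blast
      from filterlim_compose[OF this filterlim_triangles]
      have "uniform_limit K (\<lambda>M p. \<Sum>(m, n)\<in>(SIGMA m:{..M}. {- int m..int m}). cmod (mode_coeff F n m * jacobi_mode n m p)) l sequentially" .
      moreover have "(\<Sum>(m, n)\<in>(SIGMA m:{..M}. {- int m..int m}). cmod (mode_coeff F n m * jacobi_mode n m p)) =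
          (\<Sum>m\<le>M. \<Sum>n = - int m..int m. cmod (c n m * poisson_mode n m p))" for M p
        by (subst sum.Sigma[symmetric]) (auto intro!: sum.cong simp: eq)
      ultimately show "uniformly_convergent_on K
          (\<lambda>M p. \<Sum>m\<le>M. \<Sum>n = - int m..int m. cmod (c n m * poisson_mode n m p))"
        unfolding uniformly_convergent_on_def by auto
    }
    fix m n :: nat assume "n \<le> m"
    then show "c (int n) m = of_nat (2 * m + 1) * of_nat ((m + n) choose n) / of_nat (m choose n)
                * inner_Omega F (poisson_mode (int n) m)"
      and "c (- int n) m = of_nat (2 * m + 1) * of_nat ((m + n) choose n) / of_nat (m choose n)
                * inner_Omega F (poisson_mode (- int n) m)"
      using poisson_expansion_coeff[OF c, of "int n" m] poisson_expansion_coeff[OF c, of "- int n" m]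
      by (simp_all add: mode_sqnorm_def del: of_nat_Suc of_nat_add of_nat_mult)
  qed
qed

end
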